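(* Let $E=[0,\infty)$, $\bar E=[0,\infty]$, and let $(X_t,t\geq 0)$ be a non-explosive Markov process with state space $E$, with no negative jumps, with semigroup $(P_t)_{t\geq 0}$ satisfying (i) for every $f\in C_b(E)$ and $t\geq 0$, $P_tf\in C_b(E)$; (ii) for every $f\in C_b(E)$ and $x\in E$, $P_tf(x)\to f(x)$ as $t\to 0$. Assume moreover the entrance boundary condition $$\forall t>0,\quad \lim_{b\to\infty}\liminf_{x\to\infty}\mathbb{P}_x(T_b\leq t)=1,$$ where $T_b:=\inf\{t\geq 0: X_t<b\}$ (with $\inf\emptyset=\infty$). Then $(X_t,t\geq 0)$ can be extended into a Feller process on $\bar E$ such that, under the law $\mathbb{P}_\infty$ of the extended process started from $\infty$, it starts from $\infty$, leaves it instantaneously and stays finite almost surely: $$\mathbb{P}_\infty(X_0=\infty)=1\quad\text{and}\quad \mathbb{P}_\infty(\forall t>0,\ X_t<\infty)=1.$$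
   Context: $C_b(E)$ is the space of bounded continuous functions on $E$, and $C(\bar E)$ is the space of continuous functions on $\bar E$ (i.e. functions in $C_b(E)$ having a finite limit at $\infty$). $\mathbb{P}_x$ denotes the law of the process started from $x$. A process is called Feller on $\bar E$ if its semigroup maps $C(\bar E)$ into $C(\bar E)$ and $P_tf(x)\to f(x)$ as $t\to0$ for every $f\in C(\bar E)$ and every $x\in\bar E$. *)

theory Defs
  imports "HOL-Probability.Probability"
begin

definition cadlag :: "(real \<Rightarrow> 'a::topological_space) \<Rightarrow> bool" where
  "cadlag f \<longleftrightarrow> (\<forall>t\<ge>0. (f \<longlongrightarrow> f t) (at_right t)) \<and> (\<forall>t>0. \<exists>l. (f \<longlongrightarrow> l) (at_left t))"

definition no_negative_jumps :: "(real \<Rightarrow> real) \<Rightarrow> bool" where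
  "no_negative_jumps f \<longleftrightarrow> (\<forall>t>0. \<forall>l. (f \<longlongrightarrow> l) (at_left t) \<longrightarrow> l \<le> f t)"

fun mp_event :: "(real \<Rightarrow> 'w \<Rightarrow> 's) \<Rightarrow> 'w \<Rightarrow> real \<Rightarrow> (real \<times> 's set) list \<Rightarrow> bool" where
  "mp_event X \<omega> t0 [] = True"
| "mp_event X \<omega> t0 ((s, A) # r) = (X (t0 + s) \<omega> \<in> A \<and> mp_event X \<omega> (t0 + s) r)"

text \<open>Finite-dimensional distributions predicted by the Markov property.\<close>
fun mp_fdd :: "('s \<Rightarrow> 'w measure) \<Rightarrow> (real \<Rightarrow> 'w \<Rightarrow> 's) \<Rightarrow> 's \<Rightarrow> (real \<times> 's set) list \<Rightarrow> ennreal" where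
  "mp_fdd Px X x [] = 1"
| "mp_fdd Px X x ((s, A) # r) =
     (\<integral>\<^sup>+ \<omega>. indicator A (X s \<omega>) * mp_fdd Px X (X s \<omega>) r \<partial>(Px x))"

text \<open>A (time-homogeneous) Markov family with state space S: laws Px x of the process X
  started at x, Markov with respect to the natural filtration.\<close>
definition markov_family ::
  "('s::topological_space) set \<Rightarrow> ('s \<Rightarrow> 'w measure) \<Rightarrow> (real \<Rightarrow> 'w \<Rightarrow> 's) \<Rightarrow> bool" where
  "markov_family S Px X \<longleftrightarrow>
     (\<forall>x\<in>S. prob_space (Px x)) \<and>
     (\<forall>x\<in>S. \<forall>t\<ge>0. X t \<in> borel_measurable (Px x)) \<and>
     (\<forall>x\<in>S. \<forall>\<omega>\<in>space (Px x). \<forall>t\<ge>0. X t \<omega> \<in> S) \<and>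
     (\<forall>x\<in>S. AE \<omega> in Px x. X 0 \<omega> = x) \<and>
     (\<forall>t\<ge>0. \<forall>A\<in>sets borel.
        (\<lambda>x. emeasure (Px x) {\<omega>\<in>space (Px x). X t \<omega> \<in> A}) \<in> borel_measurable (restrict_space borel S)) \<and>
     (\<forall>x\<in>S. \<forall>l. (\<forall>(s, A)\<in>set l. s \<ge> 0 \<and> A \<in> sets borel) \<longrightarrow>
        emeasure (Px x) {\<omega>\<in>space (Px x). mp_event X \<omega> 0 l} = mp_fdd Px X x l)"

definition semigroup :: "('s \<Rightarrow> 'w measure) \<Rightarrow> (real \<Rightarrow> 'w \<Rightarrow> 's) \<Rightarrow> real \<Rightarrow> ('s \<Rightarrow> real) \<Rightarrow> 's \<Rightarrow> real" where
  "semigroup Px X t f x = (\<integral>\<omega>. f (X t \<omega>) \<partial>(Px x))"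

definition hit_below :: "(real \<Rightarrow> 'w \<Rightarrow> real) \<Rightarrow> real \<Rightarrow> 'w \<Rightarrow> ennreal" where
  "hit_below X b \<omega> = Inf {ennreal t | t. t \<ge> 0 \<and> X t \<omega> < b}"

end

theory Submission
  imports Defs
begin

text \<open>
  Let \<open>z\<^sub>n\<close> increase strictly to infinity. Without negative jumps, the process started from
  \<open>z\<^sub>n\<^sub>+\<^sub>1\<close> has to pass through \<open>z\<^sub>n\<close> before going below it, so by the strong Markov property a
  path from \<open>z\<^sub>n\<^sub>+\<^sub>1\<close> has the law of a path run up to its first passage time \<open>\<tau>\<^sub>n\<close> below \<open>z\<^sub>n\<close>
  and then continued by an independent path from \<open>z\<^sub>n\<close>. On one product space this couples
  processes \<open>Z\<^sub>n\<close> with the laws of the process started from \<open>z\<^sub>n\<close> such that \<open>Z\<^sub>m\<close>, shifted by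
  \<open>\<tau>\<^sub>n + \<dots> + \<tau>\<^sub>m\<^sub>-\<^sub>1\<close>, is \<open>Z\<^sub>n\<close>. The entrance condition gives that \<open>T\<^sub>n = \<tau>\<^sub>n + \<tau>\<^sub>n\<^sub>+\<^sub>1 + \<dots>\<close>
  tends to \<open>0\<close> almost surely, so that a limit process is defined by \<open>t \<mapsto> Z\<^sub>n (t - T\<^sub>n)\<close> on
  \<open>t \<ge> T\<^sub>n\<close>. It is cadlag, finite at positive times, and above \<open>z\<^sub>n\<close> before \<open>T\<^sub>n\<close>, hence it starts
  from infinity. By right continuity \<open>Z\<^sub>n t\<close> converges to it for every \<open>t > 0\<close>, which yields both
  the Markov property from infinity and the continuity of the semigroup at infinity.
\<close>

subsection \<open>Finite-dimensional laws and continuous test functions\<close>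

text \<open>Nothing in the hypotheses says that the laws started from \<open>x\<close> converge as
  \<open>x\<close> grows; the entrance condition only says that the process comes down fast. The
  coupling turns this into pathwise convergence. Its core is \<open>strong_markov\<close>, and the
  obstacle there is that the Markov property is given only for finite lists of events at
  deterministic times. Two devices bridge the gap. Laws are compared on products of continuous
  \<open>[0,1]\<close>-valued functions at finitely many times, which survive the limits (passage
  times approximated from the right, \<open>Z n\<close> replaced by its limit), and a monotone class
  argument then restores all Borel functions. Path functionals such as a first passage time are
  expressed through countably many times, hence are measurable for the product
  \<open>\<sigma>\<close>-algebra. That \<open>T n\<close> becomes small holds because
  \<open>T n w \<le> r\<close> is the decreasing limit in \<open>m\<close> of the events
  \<open>\<sigma> n m w \<le> r\<close>, each at least as likely as a passage below
  \<open>z n\<close> by time \<open>r / 2\<close> from \<open>z m\<close>. For given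
  \<open>c < 1\<close> the entrance condition provides \<open>n\<close> such that this exceeds
  \<open>c\<close> for all large \<open>m\<close>.\<close>

definition nn_functional :: "((real \<Rightarrow> ennreal) \<Rightarrow> ennreal) \<Rightarrow> bool" where
  "nn_functional \<Lambda> \<longleftrightarrow>
     (\<forall>c. \<forall>f\<in>borel_measurable borel. \<Lambda> (\<lambda>x. c * f x) = c * \<Lambda> f) \<and>
     (\<forall>f\<in>borel_measurable borel. \<forall>g\<in>borel_measurable borel. \<Lambda> (\<lambda>x. f x + g x) = \<Lambda> f + \<Lambda> g) \<and>
     (\<forall>F. (\<forall>i::nat. F i \<in> borel_measurable borel) \<and> incseq F \<longrightarrow>
        \<Lambda> (\<lambda>x. SUP i. F i x) = (SUP i. \<Lambda> (F i)))"

text \<open>Monotonicity is not among the axioms; it comes from continuity along the increasing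
  sequence \<open>f, g, g, ...\<close>.\<close>

lemma nn_functional_mono:
  assumes L: "nn_functional \<Lambda>" and [measurable]: "f \<in> borel_measurable borel" "g \<in> borel_measurable borel"
    and le: "\<And>x. f x \<le> g x"
  shows "\<Lambda> f \<le> \<Lambda> g"
proof -
  define F where "F i = (if i = (0::nat) then f else g)" for i
  have "(\<lambda>x. SUP i. F i x) = g"
  proof
    fix x
    show "(SUP i. F i x) = g x"
    proof (rule antisym)
      show "(SUP i. F i x) \<le> g x" using le by (auto simp: F_def intro!: SUP_least)
      have "F 1 x \<le> (SUP i. F i x)" by (rule SUP_upper) auto
      then show "g x \<le> (SUP i. F i x)" by (simp add: F_def)
    qed
  qed
  moreover have "incseq F" using le by (auto simp: F_def incseq_def le_fun_def)
  ultimately have "\<Lambda> g = (SUP i. \<Lambda> (F i))"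
    using L unfolding nn_functional_def by (auto simp: F_def dest!: spec[of _ F])
  moreover have "\<Lambda> (F 0) \<le> (SUP i. \<Lambda> (F i))" by (rule SUP_upper) auto
  ultimately show ?thesis by (simp add: F_def)
qed

lemma nn_functional_zero:
  assumes "nn_functional \<Lambda>"
  shows "\<Lambda> (\<lambda>x. 0) = 0"
proof -
  have "\<forall>c. \<forall>f\<in>borel_measurable borel. \<Lambda> (\<lambda>x. c * f x) = c * \<Lambda> f"
    using assms unfolding nn_functional_def by blast
  from bspec[OF spec[OF this, of 0], of "\<lambda>x. 0"] show ?thesis by simp
qed

lemma nn_functional_sum:
  assumes L: "nn_functional \<Lambda>" and F: "\<And>i. F i \<in> borel_measurable borel"
  shows "\<Lambda> (\<lambda>x. \<Sum>i<(n::nat). F i x) = (\<Sum>i<n. \<Lambda> (F i))"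
proof (induction n)
  case 0
  then show ?case using nn_functional_zero[OF L] by simp
next
  case (Suc n)
  have "\<Lambda> (\<lambda>x. (\<Sum>i<n. F i x) + F n x) = \<Lambda> (\<lambda>x. \<Sum>i<n. F i x) + \<Lambda> (F n)"
    using L F unfolding nn_functional_def by (auto intro!: borel_measurable_sum)
  then show ?case using Suc by simp
qed

text \<open>Representation in the style of Daniell: additivity and continuity along increasing
  sequences make the values on indicators a measure, and the usual induction on Borel functions
  extends the identity. It turns one free slot of a multilinear expression into an integral.\<close>

lemma nn_functional_integral:
  assumes L: "nn_functional \<Lambda>"
  obtains \<mu> :: "real measure" where "sets \<mu> = sets borel"
    "\<And>f. f \<in> borel_measurable borel \<Longrightarrow> \<Lambda> f = (\<integral>\<^sup>+x. f x \<partial>\<mu>)"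
proof -
  define \<mu> where "\<mu> = measure_of UNIV (sets borel) (\<lambda>A::real set. \<Lambda> (indicator A))"
  have ca: "countably_additive (sets borel) (\<lambda>A::real set. \<Lambda> (indicator A))"
    unfolding countably_additive_def
  proof safe
    fix A :: "nat \<Rightarrow> real set" assume A: "range A \<subseteq> sets borel" "disjoint_family A"
    then have [measurable]: "A i \<in> sets borel" for i by auto
    have "(\<Sum>i. \<Lambda> (indicator (A i))) = (SUP n. \<Sum>i<n. \<Lambda> (indicator (A i)))"
      by (rule suminf_eq_SUP)
    also have "\<dots> = (SUP n. \<Lambda> (\<lambda>x. \<Sum>i<n. indicator (A i) x))"
      by (subst nn_functional_sum[OF L]) auto
    also have "\<dots> = \<Lambda> (\<lambda>x. SUP n. \<Sum>i<n. indicator (A i) x)"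
    proof -
      have inc: "incseq (\<lambda>n x. \<Sum>i<n. indicator (A i) x :: ennreal)"
        by (auto intro!: incseq_SucI le_funI)
      have m: "\<forall>n. (\<lambda>x. \<Sum>i<n. indicator (A i) x :: ennreal) \<in> borel_measurable borel" by auto
      from L m inc show ?thesis
        unfolding nn_functional_def by (auto dest!: spec[of _ "\<lambda>n x. \<Sum>i<n. indicator (A i) x :: ennreal"])
    qed
    also have "(\<lambda>x. SUP n. \<Sum>i<n. indicator (A i) x :: ennreal) = indicator (\<Union>i. A i)"
      using A(2) by (auto simp: fun_eq_iff suminf_eq_SUP[symmetric] suminf_indicator)
    finally show "(\<Sum>i. \<Lambda> (indicator (A i))) = \<Lambda> (indicator (\<Union>i. A i))" .
  qed
  have pos: "positive (sets borel) (\<lambda>A::real set. \<Lambda> (indicator A))"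
    using nn_functional_zero[OF L] by (simp add: positive_def indicator_def[abs_def])
  have sa: "sigma_algebra UNIV (sets (borel::real measure))"
    using sets.sigma_algebra_axioms[of "borel::real measure"] by simp
  have em: "emeasure \<mu> A = \<Lambda> (indicator A)" if "A \<in> sets borel" for A
    unfolding \<mu>_def using emeasure_measure_of_sigma[OF sa pos ca that] .
  have sets: "sets \<mu> = sets borel"
    unfolding \<mu>_def using sigma_algebra.sigma_sets_eq[OF sa] by simp
  have "\<Lambda> f = (\<integral>\<^sup>+x. f x \<partial>\<mu>)" if "f \<in> borel_measurable borel" for f
    using that
  proof (induction rule: borel_measurable_induct)
    case (cong f g)
    then have "f = g" by auto
    with cong show ?case by simp
  next
    case (set A)
    then show ?case by (simp add: em sets)
  next
    case (mult u c)
    have [measurable]: "u \<in> borel_measurable \<mu>" using mult by (simp add: measurable_cong_sets[OF sets refl])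
    have "\<Lambda> (\<lambda>x. c * u x) = c * \<Lambda> u" using L mult unfolding nn_functional_def by auto
    then show ?case using mult by (simp add: nn_integral_cmult)
  next
    case (add u v)
    have [measurable]: "u \<in> borel_measurable \<mu>" "v \<in> borel_measurable \<mu>"
      using add by (simp_all add: measurable_cong_sets[OF sets refl])
    have "\<Lambda> (\<lambda>x. v x + u x) = \<Lambda> v + \<Lambda> u" using L add unfolding nn_functional_def by auto
    then show ?case using add by (simp add: nn_integral_add)
  next
    case (seq U)
    have [measurable]: "U i \<in> borel_measurable \<mu>" for i
      using seq by (simp_all add: measurable_cong_sets[OF sets refl])
    have "\<Lambda> (\<lambda>x. SUP i. U i x) = (SUP i. \<Lambda> (U i))" using L seq unfolding nn_functional_def by auto
    also have "\<dots> = (SUP i. \<integral>\<^sup>+x. U i x \<partial>\<mu>)" using seq by simp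
    also have "\<dots> = (\<integral>\<^sup>+x. (SUP i. U i x) \<partial>\<mu>)"
      using seq by (subst nn_integral_monotone_convergence_SUP) auto
    finally show ?case by (simp add: SUP_apply image_comp)
  qed
  with sets show ?thesis by (rule that)
qed

text \<open>The bound 1 is inherited by products of any length, which provides finiteness and a
  dominating function in every limit below.\<close>

definition unit_fns :: "(real \<Rightarrow> ennreal) set" where
  "unit_fns = {f \<in> borel_measurable borel. \<forall>x. f x \<le> 1}"

definition indicator_fns :: "(real \<Rightarrow> ennreal) set" where
  "indicator_fns = {indicator A | A. A \<in> sets borel}"

definition cont_fns :: "(real \<Rightarrow> ennreal) set" where
  "cont_fns = {\<lambda>x. ennreal (g x) | g. continuous_on UNIV g \<and> (\<forall>x. 0 \<le> g x \<and> g x \<le> 1)}"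

text \<open>Finiteness is asked of one measure only, because \<open>ok_list_extend\<close> bounds
  only one of the two functionals it compares.\<close>

definition determining :: "(real \<Rightarrow> ennreal) set \<Rightarrow> bool" where
  "determining K \<longleftrightarrow> K \<subseteq> unit_fns \<and>
     (\<forall>\<mu> \<nu>. sets \<mu> = sets borel \<and> sets \<nu> = sets borel \<and> emeasure \<mu> UNIV < \<infinity> \<and>
        (\<forall>f\<in>K. (\<integral>\<^sup>+x. f x \<partial>\<mu>) = (\<integral>\<^sup>+x. f x \<partial>\<nu>)) \<longrightarrow> \<mu> = \<nu>)"

lemma determining_indicator_fns: "determining indicator_fns"
  unfolding determining_def
proof (intro conjI allI impI)
  show "indicator_fns \<subseteq> unit_fns"
    by (auto simp: indicator_fns_def unit_fns_def indicator_def)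
  fix \<mu> \<nu> :: "real measure"
  assume "sets \<mu> = sets borel \<and> sets \<nu> = sets borel \<and> emeasure \<mu> UNIV < \<infinity> \<and>
        (\<forall>f\<in>indicator_fns. (\<integral>\<^sup>+x. f x \<partial>\<mu>) = (\<integral>\<^sup>+x. f x \<partial>\<nu>))"
  then have s: "sets \<mu> = sets borel" "sets \<nu> = sets borel"
    and eq: "\<And>f. f \<in> indicator_fns \<Longrightarrow> (\<integral>\<^sup>+x. f x \<partial>\<mu>) = (\<integral>\<^sup>+x. f x \<partial>\<nu>)" by auto
  show "\<mu> = \<nu>"
  proof (rule measure_eqI)
    fix A assume "A \<in> sets \<mu>"
    with s eq[of "indicator A"] show "emeasure \<mu> A = emeasure \<nu> A"
      by (auto simp: indicator_fns_def)
  qed (use s in simp)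
qed

lemma cont_fns_unit: "cont_fns \<subseteq> unit_fns"
proof
  fix f assume "f \<in> cont_fns"
  then obtain g where f: "f = (\<lambda>x. ennreal (g x))" and g: "continuous_on UNIV g" "\<And>x. 0 \<le> g x \<and> g x \<le> 1"
    by (auto simp: cont_fns_def)
  have [measurable]: "g \<in> borel_measurable borel" using g(1) by (rule borel_measurable_continuous_onI)
  show "f \<in> unit_fns" using g(2) by (auto simp: unit_fns_def f)
qed

text \<open>Open half-lines form an intersection-stable generator of the Borel sets, and the
  indicator of each is an increasing limit of continuous functions.\<close>

lemma determining_cont_fns: "determining cont_fns"
  unfolding determining_def
proof (intro conjI allI impI)
  show "cont_fns \<subseteq> unit_fns" by (rule cont_fns_unit)
  fix \<mu> \<nu> :: "real measure"
  assume "sets \<mu> = sets borel \<and> sets \<nu> = sets borel \<and> emeasure \<mu> UNIV < \<infinity> \<and>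
        (\<forall>f\<in>cont_fns. (\<integral>\<^sup>+x. f x \<partial>\<mu>) = (\<integral>\<^sup>+x. f x \<partial>\<nu>))"
  then have s: "sets \<mu> = sets borel" "sets \<nu> = sets borel" and fin: "emeasure \<mu> UNIV < \<infinity>"
    and eq: "\<And>f. f \<in> cont_fns \<Longrightarrow> (\<integral>\<^sup>+x. f x \<partial>\<mu>) = (\<integral>\<^sup>+x. f x \<partial>\<nu>)" by auto
  define E where "E = range (\<lambda>a::real. {a<..})"
  have gen: "sets (borel::real measure) = sigma_sets UNIV E"
    unfolding E_def by (subst borel_Ioi) (simp add: sets_measure_of)
  have emE: "emeasure \<mu> {a<..} = emeasure \<nu> {a<..}" for a :: real
  proof -
    \<comment> \<open>Ramps that vanish up to \<open>a\<close> and reach 1 at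
      \<open>a + 1 / n\<close>; they increase to the indicator of \<open>{a<..}\<close>.\<close>
    define g where "g n x = min 1 (max 0 (real n * (x - a)))" for n x
    have gc: "(\<lambda>x. ennreal (g n x)) \<in> cont_fns" for n
      unfolding cont_fns_def g_def by (auto intro!: exI continuous_intros)
    have inc: "incseq (\<lambda>n x. ennreal (g n x))"
      unfolding incseq_def le_fun_def
    proof (intro allI impI ennreal_leI)
      fix n m :: nat and x assume "n \<le> m"
      show "g n x \<le> g m x"
      proof (cases "a \<le> x")
        case True
        then have "real n * (x - a) \<le> real m * (x - a)" using \<open>n \<le> m\<close> by (intro mult_right_mono) auto
        then show ?thesis by (auto simp: g_def)
      next
        case False
        then have "real n * (x - a) \<le> 0" "real m * (x - a) \<le> 0" by (auto intro!: mult_nonneg_nonpos)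
        then show ?thesis by (simp add: g_def)
      qed
    qed
    have sup: "(SUP n. ennreal (g n x)) = indicator {a<..} x" for x
    proof (cases "a < x")
      case True
      obtain n where n: "real n * (x - a) \<ge> 1"
        using True reals_Archimedean3[of "x - a"] by (auto intro: less_imp_le)
      have "ennreal (g n x) = 1" using n by (simp add: g_def)
      then have "1 \<le> (SUP n. ennreal (g n x))" by (metis SUP_upper UNIV_I)
      moreover have "(SUP n. ennreal (g n x)) \<le> 1" by (rule SUP_least) (simp add: g_def)
      ultimately show ?thesis using True by simp
    next
      case False
      have "g n x = 0" for n using False by (simp add: g_def mult_nonneg_nonpos)
      then show ?thesis using False by simp
    qed
    have "emeasure \<rho> {a<..} = (SUP n. \<integral>\<^sup>+x. ennreal (g n x) \<partial>\<rho>)" if "sets \<rho> = sets borel" for \<rho>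
    proof -
      have m: "(\<lambda>x. ennreal (g n x)) \<in> borel_measurable \<rho>" for n
        using gc[of n] cont_fns_unit by (auto simp: unit_fns_def measurable_cong_sets[OF that refl])
      have "emeasure \<rho> {a<..} = (\<integral>\<^sup>+x. indicator {a<..} x \<partial>\<rho>)" using that by simp
      also have "\<dots> = (\<integral>\<^sup>+x. (SUP n. ennreal (g n x)) \<partial>\<rho>)" by (simp add: sup)
      also have "\<dots> = (SUP n. \<integral>\<^sup>+x. ennreal (g n x) \<partial>\<rho>)"
        using inc m by (rule nn_integral_monotone_convergence_SUP)
      finally show ?thesis .
    qed
    then show ?thesis using s eq[OF gc] by simp
  qed
  show "\<mu> = \<nu>"
  proof (rule measure_eqI_generator_eq[where E=E and \<Omega>=UNIV and A="\<lambda>i. {- real i<..}"])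
    show "Int_stable E"
    proof (rule Int_stableI)
      fix A B assume "A \<in> E" "B \<in> E"
      then obtain a b where "A = {a<..}" "B = {b<..}" by (auto simp: E_def)
      then have "A \<inter> B = {max a b<..}" by auto
      then show "A \<inter> B \<in> E" by (auto simp: E_def)
    qed
    show "emeasure \<mu> A = emeasure \<nu> A" if "A \<in> E" for A using that emE by (auto simp: E_def)
    show "(\<Union>i. {- real i<..}) = UNIV"
    proof safe
      fix x :: real
      obtain n where "- x < real n" using reals_Archimedean2 by blast
      then show "x \<in> (\<Union>i. {- real i<..})" by (auto intro!: exI[of _ n])
    qed auto
    show "emeasure \<mu> {- real i<..} \<noteq> \<infinity>" for i
      using fin emeasure_mono[of "{- real i<..}" UNIV \<mu>] s by (auto simp: top_unique)
  qed (auto simp: E_def gen s)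
qed

section \<open>Products of functions of finitely many coordinates\<close>

definition ok_list :: "'i set \<Rightarrow> (real \<Rightarrow> ennreal) set \<Rightarrow> ('i \<times> (real \<Rightarrow> ennreal)) list \<Rightarrow> bool" where
  "ok_list I K l \<longleftrightarrow> (\<forall>(i, f)\<in>set l. i \<in> I \<and> f \<in> K)"

lemma ok_list_simps [simp]:
  "ok_list I K []" "ok_list I K ((i, f) # l) \<longleftrightarrow> i \<in> I \<and> f \<in> K \<and> ok_list I K l"
  "ok_list I K (l1 @ l2) \<longleftrightarrow> ok_list I K l1 \<and> ok_list I K l2"
  by (auto simp: ok_list_def)

lemma ok_list_mono: "ok_list I K l \<Longrightarrow> K \<subseteq> K' \<Longrightarrow> ok_list I K' l"
  by (auto simp: ok_list_def)

lemma const_one_unit: "(\<lambda>x. 1) \<in> unit_fns" by (auto simp: unit_fns_def)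

text \<open>A multilinear monotone class argument: the slots of the list are upgraded one at a time.\<close>

lemma ok_list_extend:
  fixes \<Phi> \<Psi> :: "('i \<times> (real \<Rightarrow> ennreal)) list \<Rightarrow> ennreal"
  assumes \<Phi>: "\<And>l1 i l2. ok_list I unit_fns (l1 @ l2) \<Longrightarrow> i \<in> I \<Longrightarrow> nn_functional (\<lambda>f. \<Phi> (l1 @ (i, f) # l2))"
    and \<Psi>: "\<And>l1 i l2. ok_list I unit_fns (l1 @ l2) \<Longrightarrow> i \<in> I \<Longrightarrow> nn_functional (\<lambda>f. \<Psi> (l1 @ (i, f) # l2))"
    and fin: "\<And>l. ok_list I unit_fns l \<Longrightarrow> \<Phi> l < \<infinity>"
    and K: "determining K"
    and agree: "\<And>l. ok_list I K l \<Longrightarrow> \<Phi> l = \<Psi> l"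
    and l: "ok_list I unit_fns l"
  shows "\<Phi> l = \<Psi> l"
proof -
  have KU: "K \<subseteq> unit_fns" using K by (simp add: determining_def)
  \<comment> \<open>A prefix of arbitrary slots is followed by a suffix of slots from
    \<open>K\<close>. When the last prefix slot is moved into the suffix, the induction hypothesis
    gives agreement for functions of \<open>K\<close> in that slot, and \<open>determining\<close>
    then frees it.\<close>
  have "\<Phi> (l @ l2) = \<Psi> (l @ l2)" if "ok_list I K l2" for l2
    using l that
  proof (induction l arbitrary: l2 rule: rev_induct)
    case Nil
    then show ?case using agree by simp
  next
    case (snoc p l)
    obtain i f where p: "p = (i, f)" by (cases p)
    have ok: "ok_list I unit_fns (l @ l2)" and i: "i \<in> I" and f: "f \<in> unit_fns"
      using snoc.prems ok_list_mono[OF _ KU] by (auto simp: p)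
    obtain \<mu> where \<mu>: "sets \<mu> = sets borel"
      "\<And>f. f \<in> borel_measurable borel \<Longrightarrow> \<Phi> (l @ (i, f) # l2) = (\<integral>\<^sup>+x. f x \<partial>\<mu>)"
      using nn_functional_integral[OF \<Phi>[OF ok i]] by blast
    obtain \<nu> where \<nu>: "sets \<nu> = sets borel"
      "\<And>f. f \<in> borel_measurable borel \<Longrightarrow> \<Psi> (l @ (i, f) # l2) = (\<integral>\<^sup>+x. f x \<partial>\<nu>)"
      using nn_functional_integral[OF \<Psi>[OF ok i]] by blast
    have "space \<mu> = UNIV" using \<mu>(1) sets_eq_imp_space_eq[of \<mu> borel] by simp
    \<comment> \<open>The total mass is the value with the constant 1 in the free slot; this
      constant lies in \<open>unit_fns\<close>, though perhaps not in \<open>K\<close>.\<close>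
    then have "emeasure \<mu> UNIV = \<Phi> (l @ (i, \<lambda>x. 1) # l2)" by (simp add: \<mu>(2))
    also have "\<dots> < \<infinity>" using ok i const_one_unit by (intro fin) simp
    finally have "emeasure \<mu> UNIV < \<infinity>" .
    moreover have "(\<integral>\<^sup>+x. h x \<partial>\<mu>) = (\<integral>\<^sup>+x. h x \<partial>\<nu>)" if h: "h \<in> K" for h
    proof -
      have "h \<in> borel_measurable borel" using h KU by (auto simp: unit_fns_def)
      moreover have "\<Phi> (l @ (i, h) # l2) = \<Psi> (l @ (i, h) # l2)"
        using snoc.prems i h by (intro snoc.IH) (auto simp: p)
      ultimately show ?thesis by (simp add: \<mu>(2) \<nu>(2))
    qed
    ultimately have "\<mu> = \<nu>" using K \<mu>(1) \<nu>(1) by (auto simp: determining_def)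
    then show ?case using f \<mu>(2)[of f] \<nu>(2)[of f] by (simp add: p unit_fns_def)
  qed
  from this[of "[]"] show ?thesis by simp
qed

definition prod_eval :: "('i \<Rightarrow> 'w \<Rightarrow> real) \<Rightarrow> 'w \<Rightarrow> ('i \<times> (real \<Rightarrow> ennreal)) list \<Rightarrow> ennreal" where
  "prod_eval W \<omega> l = (\<Prod>(i, f)\<leftarrow>l. f (W i \<omega>))"

lemma prod_eval_simps [simp]:
  "prod_eval W \<omega> [] = 1" "prod_eval W \<omega> ((i, f) # l) = f (W i \<omega>) * prod_eval W \<omega> l"
  "prod_eval W \<omega> (l1 @ l2) = prod_eval W \<omega> l1 * prod_eval W \<omega> l2"
  by (auto simp: prod_eval_def)

lemma prod_eval_measurable:
  assumes "\<And>i. i \<in> I \<Longrightarrow> W i \<in> borel_measurable M" "ok_list I unit_fns l"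
  shows "(\<lambda>\<omega>. prod_eval W \<omega> l) \<in> borel_measurable M"
  using assms(2)
proof (induction l)
  case (Cons p l)
  obtain i f where p: "p = (i, f)" by (cases p)
  have [measurable]: "W i \<in> borel_measurable M" "f \<in> borel_measurable borel"
      "(\<lambda>\<omega>. prod_eval W \<omega> l) \<in> borel_measurable M"
    using Cons assms(1) by (auto simp: p unit_fns_def)
  show ?case by (simp add: p)
qed simp

lemma prod_eval_le_1: "ok_list I unit_fns l \<Longrightarrow> prod_eval W \<omega> l \<le> 1"
proof (induction l)
  case (Cons p l)
  then show ?case using mult_mono[of _ 1 "prod_eval W \<omega> l" 1] by (cases p) (auto simp: unit_fns_def)
qed simp

text \<open>Two uses: with evaluation at a random point as \<open>\<Lambda>\<close> it covers
  ordinary integrals, and with an iterated integral as \<open>\<Lambda>\<close> it carries linearity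
  of an inner slot through the outer integrals of \<open>fdd\<close>.\<close>

lemma nn_functional_mixture:
  assumes [measurable]: "w \<in> borel_measurable M"
    and m: "\<And>f. f \<in> borel_measurable borel \<Longrightarrow> (\<lambda>\<omega>. \<Lambda> \<omega> f) \<in> borel_measurable M"
    and L: "\<And>\<omega>. \<omega> \<in> space M \<Longrightarrow> nn_functional (\<Lambda> \<omega>)"
  shows "nn_functional (\<lambda>f. \<integral>\<^sup>+\<omega>. w \<omega> * \<Lambda> \<omega> f \<partial>M)"
proof -
  have "(\<integral>\<^sup>+\<omega>. w \<omega> * \<Lambda> \<omega> (\<lambda>x. c * f x) \<partial>M) = c * (\<integral>\<^sup>+\<omega>. w \<omega> * \<Lambda> \<omega> f \<partial>M)"
    if "f \<in> borel_measurable borel" for c f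
  proof -
    note [measurable] = m[OF that]
    have "w \<omega> * \<Lambda> \<omega> (\<lambda>x. c * f x) = c * (w \<omega> * \<Lambda> \<omega> f)" if "\<omega> \<in> space M" for \<omega>
      using L[OF that] \<open>f \<in> borel_measurable borel\<close> unfolding nn_functional_def by (simp add: ac_simps)
    then show ?thesis by (subst nn_integral_cmult[symmetric]) (auto intro!: nn_integral_cong)
  qed
  moreover have "(\<integral>\<^sup>+\<omega>. w \<omega> * \<Lambda> \<omega> (\<lambda>x. f x + g x) \<partial>M) = (\<integral>\<^sup>+\<omega>. w \<omega> * \<Lambda> \<omega> f \<partial>M) + (\<integral>\<^sup>+\<omega>. w \<omega> * \<Lambda> \<omega> g \<partial>M)"
    if fg: "f \<in> borel_measurable borel" "g \<in> borel_measurable borel" for f g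
  proof -
    note [measurable] = m[OF fg(1)] m[OF fg(2)]
    have "w \<omega> * \<Lambda> \<omega> (\<lambda>x. f x + g x) = w \<omega> * \<Lambda> \<omega> f + w \<omega> * \<Lambda> \<omega> g" if "\<omega> \<in> space M" for \<omega>
      using L[OF that] fg unfolding nn_functional_def by (simp add: distrib_left)
    then show ?thesis by (subst nn_integral_add[symmetric]) (auto intro!: nn_integral_cong)
  qed
  moreover have "(\<integral>\<^sup>+\<omega>. w \<omega> * \<Lambda> \<omega> (\<lambda>x. SUP i. F i x) \<partial>M) = (SUP i. \<integral>\<^sup>+\<omega>. w \<omega> * \<Lambda> \<omega> (F i) \<partial>M)"
    if F: "\<And>i::nat. F i \<in> borel_measurable borel" "incseq F" for F
  proof -
    note [measurable] = m[OF F(1)]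
    have "w \<omega> * \<Lambda> \<omega> (\<lambda>x. SUP i. F i x) = (SUP i. w \<omega> * \<Lambda> \<omega> (F i))" if "\<omega> \<in> space M" for \<omega>
      using L[OF that] F unfolding nn_functional_def by (simp add: SUP_mult_left_ennreal)
    then have "(\<integral>\<^sup>+\<omega>. w \<omega> * \<Lambda> \<omega> (\<lambda>x. SUP i. F i x) \<partial>M) = (\<integral>\<^sup>+\<omega>. (SUP i. w \<omega> * \<Lambda> \<omega> (F i)) \<partial>M)"
      by (auto intro!: nn_integral_cong)
    also have "\<dots> = (SUP i. \<integral>\<^sup>+\<omega>. w \<omega> * \<Lambda> \<omega> (F i) \<partial>M)"
    proof (rule nn_integral_monotone_convergence_SUP_AE)
      fix i
      show "AE \<omega> in M. w \<omega> * \<Lambda> \<omega> (F i) \<le> w \<omega> * \<Lambda> \<omega> (F (Suc i))"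
      proof (rule AE_I2)
        fix \<omega> assume "\<omega> \<in> space M"
        then have "\<Lambda> \<omega> (F i) \<le> \<Lambda> \<omega> (F (Suc i))"
          using F(1) by (rule nn_functional_mono[OF L]) (use incseq_SucD[OF F(2), of i] in \<open>auto simp: F(1) le_fun_def\<close>)
        then show "w \<omega> * \<Lambda> \<omega> (F i) \<le> w \<omega> * \<Lambda> \<omega> (F (Suc i))" by (rule mult_left_mono) simp
      qed
    qed measurable
    finally show ?thesis .
  qed
  ultimately show ?thesis unfolding nn_functional_def by blast
qed

lemma nn_functional_integral_weight:
  assumes "Y \<in> borel_measurable M" "w \<in> borel_measurable M"
  shows "nn_functional (\<lambda>f. \<integral>\<^sup>+\<omega>. w \<omega> * f (Y \<omega>) \<partial>M)"
  using assms by (intro nn_functional_mixture) (auto simp: nn_functional_def)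

lemma nn_functional_prod_eval:
  assumes W: "\<And>i. i \<in> I \<Longrightarrow> W i \<in> borel_measurable M" and ok: "ok_list I unit_fns (l1 @ l2)" "i \<in> I"
  shows "nn_functional (\<lambda>f. \<integral>\<^sup>+\<omega>. prod_eval W \<omega> (l1 @ (i, f) # l2) \<partial>M)"
proof -
  have [measurable]: "(\<lambda>\<omega>. prod_eval W \<omega> l1) \<in> borel_measurable M" "(\<lambda>\<omega>. prod_eval W \<omega> l2) \<in> borel_measurable M"
    using ok by (auto intro!: prod_eval_measurable[OF W])
  have "nn_functional (\<lambda>f. \<integral>\<^sup>+\<omega>. (prod_eval W \<omega> l1 * prod_eval W \<omega> l2) * f (W i \<omega>) \<partial>M)"
    using W[OF ok(2)] by (intro nn_functional_integral_weight) auto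
  then show ?thesis by (simp add: ac_simps)
qed

lemma nn_integral_prod_eval_finite:
  assumes "finite_measure M" "ok_list I unit_fns l"
  shows "(\<integral>\<^sup>+\<omega>. prod_eval W \<omega> l \<partial>M) < \<infinity>"
proof -
  interpret finite_measure M by fact
  have "(\<integral>\<^sup>+\<omega>. prod_eval W \<omega> l \<partial>M) \<le> (\<integral>\<^sup>+\<omega>. 1 \<partial>M)"
    by (intro nn_integral_mono prod_eval_le_1[OF assms(2)])
  also have "\<dots> < \<infinity>" by (simp add: emeasure_eq_measure)
  finally show ?thesis .
qed

text \<open>Agreement on continuous products extends to products of indicators by
  \<open>ok_list_extend\<close>, that is, to cylinders over finite index sets, and these determine a
  finite measure on the product. The measures are not normalised because the lemma is applied to
  measures with densities, which encode conditioning.\<close>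

lemma law_eqI:
  fixes W :: "'i \<Rightarrow> 'a \<Rightarrow> real" and W' :: "'i \<Rightarrow> 'b \<Rightarrow> real"
  assumes fin: "finite_measure M" "finite_measure N"
    and W: "\<And>i. i \<in> I \<Longrightarrow> W i \<in> borel_measurable M"
    and W': "\<And>i. i \<in> I \<Longrightarrow> W' i \<in> borel_measurable N"
    and agree: "\<And>l. ok_list I cont_fns l \<Longrightarrow>
      (\<integral>\<^sup>+\<omega>. prod_eval W \<omega> l \<partial>M) = (\<integral>\<^sup>+\<omega>. prod_eval W' \<omega> l \<partial>N)"
  shows "distr M (PiM I (\<lambda>_. borel)) (\<lambda>\<omega>. \<lambda>i\<in>I. W i \<omega>) = distr N (PiM I (\<lambda>_. borel)) (\<lambda>\<omega>. \<lambda>i\<in>I. W' i \<omega>)"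
proof (rule measure_eqI_PiM_infinite)
  have m: "(\<lambda>\<omega>. \<lambda>i\<in>I. W i \<omega>) \<in> measurable M (PiM I (\<lambda>_. borel))"
    "(\<lambda>\<omega>. \<lambda>i\<in>I. W' i \<omega>) \<in> measurable N (PiM I (\<lambda>_. borel))"
    using W W' by (auto intro!: measurable_restrict)
  show "finite_measure (distr M (PiM I (\<lambda>_. borel)) (\<lambda>\<omega>. \<lambda>i\<in>I. W i \<omega>))"
    using m(1) fin(1) by (rule finite_measure.finite_measure_distr[rotated])
  fix A :: "'i \<Rightarrow> real set" and J
  assume J: "finite J" "J \<subseteq> I" and A: "\<And>i. i \<in> J \<Longrightarrow> A i \<in> sets borel"
  obtain js where js: "set js = J" "distinct js" using finite_distinct_list[OF J(1)] by blast
  define l where "l = map (\<lambda>i. (i, indicator (A i) :: real \<Rightarrow> ennreal)) js"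
  have ok: "ok_list I unit_fns l"
    using js J A by (auto simp: ok_list_def l_def unit_fns_def indicator_def)
  have ev: "prod_eval V \<omega> l = indicator {\<omega>. \<forall>i\<in>J. V i \<omega> \<in> A i} \<omega>" for V :: "'i \<Rightarrow> 'c \<Rightarrow> real" and \<omega>
  proof -
    have "prod_eval V \<omega> (map (\<lambda>i. (i, indicator (A i) :: real \<Rightarrow> ennreal)) ks)
      = indicator {\<omega>. \<forall>i\<in>set ks. V i \<omega> \<in> A i} \<omega>" for ks
      by (induction ks) (auto simp: indicator_def)
    then show ?thesis by (simp add: l_def js)
  qed
  have set: "emeasure (distr M' (PiM I (\<lambda>_. borel)) (\<lambda>\<omega>. \<lambda>i\<in>I. V i \<omega>)) (prod_emb I (\<lambda>_. borel) J (Pi\<^sub>E J A))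
      = (\<integral>\<^sup>+\<omega>. prod_eval V \<omega> l \<partial>M')"
    if V: "\<And>i. i \<in> I \<Longrightarrow> V i \<in> borel_measurable M'" for M' :: "'c measure" and V
  proof -
    have mV: "(\<lambda>\<omega>. \<lambda>i\<in>I. V i \<omega>) \<in> measurable M' (PiM I (\<lambda>_. borel))"
      using V by (auto intro!: measurable_restrict)
    have sV: "prod_emb I (\<lambda>_. borel) J (Pi\<^sub>E J A) \<in> sets (PiM I (\<lambda>_. borel))"
      using J A by (intro sets_PiM_I) auto
    have "(\<lambda>\<omega>. \<lambda>i\<in>I. V i \<omega>) -` prod_emb I (\<lambda>_. borel) J (Pi\<^sub>E J A) \<inter> space M'
       = {\<omega>\<in>space M'. \<forall>i\<in>J. V i \<omega> \<in> A i}"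
      using J by (auto simp: prod_emb_def PiE_def Pi_def extensional_def restrict_def subset_eq)
    moreover have "{\<omega>\<in>space M'. \<forall>i\<in>J. V i \<omega> \<in> A i} \<in> sets M'"
      using measurable_sets[OF mV sV] calculation by simp
    ultimately show ?thesis using mV sV
      by (subst emeasure_distr)
         (auto simp: ev nn_integral_indicator[symmetric] simp del: nn_integral_indicator intro!: nn_integral_cong split: split_indicator)
  qed
  have "(\<integral>\<^sup>+\<omega>. prod_eval W \<omega> l \<partial>M) = (\<integral>\<^sup>+\<omega>. prod_eval W' \<omega> l \<partial>N)"
  proof (rule ok_list_extend[where I=I and K=cont_fns and \<Phi>="\<lambda>l. \<integral>\<^sup>+\<omega>. prod_eval W \<omega> l \<partial>M"])
    show "nn_functional (\<lambda>f. \<integral>\<^sup>+\<omega>. prod_eval W \<omega> (l1 @ (i, f) # l2) \<partial>M)"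
      if "ok_list I unit_fns (l1 @ l2)" "i \<in> I" for l1 i l2
      using W that by (rule nn_functional_prod_eval)
    show "nn_functional (\<lambda>f. \<integral>\<^sup>+\<omega>. prod_eval W' \<omega> (l1 @ (i, f) # l2) \<partial>N)"
      if "ok_list I unit_fns (l1 @ l2)" "i \<in> I" for l1 i l2
      using W' that by (rule nn_functional_prod_eval)
    show "(\<integral>\<^sup>+\<omega>. prod_eval W \<omega> l \<partial>M) < \<infinity>" if "ok_list I unit_fns l" for l
      using fin(1) that by (rule nn_integral_prod_eval_finite)
  qed (use determining_cont_fns agree ok in auto)
  then show "emeasure (distr M (PiM I (\<lambda>_. borel)) (\<lambda>\<omega>. \<lambda>i\<in>I. W i \<omega>)) (prod_emb I (\<lambda>_. borel) J (Pi\<^sub>E J A)) =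
      emeasure (distr N (PiM I (\<lambda>_. borel)) (\<lambda>\<omega>. \<lambda>i\<in>I. W' i \<omega>)) (prod_emb I (\<lambda>_. borel) J (Pi\<^sub>E J A))"
    by (simp add: set[OF W] set[OF W'])
qed simp_all

subsection \<open>The Markov property for products of functions\<close>

text \<open>The analogue of \<open>mp_fdd\<close> with functions in place of sets. Times in the list
  are increments, as in \<open>mp_event\<close>, whereas \<open>prod_eval\<close> reads absolute
  times; \<open>cumul\<close> and \<open>increments\<close> translate between the two.\<close>

fun fdd :: "('s \<Rightarrow> 'w measure) \<Rightarrow> (real \<Rightarrow> 'w \<Rightarrow> 's) \<Rightarrow> 's \<Rightarrow> (real \<times> ('s \<Rightarrow> ennreal)) list \<Rightarrow> ennreal" where
  "fdd Px X x [] = 1"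
| "fdd Px X x ((s, f) # r) = (\<integral>\<^sup>+\<omega>. f (X s \<omega>) * fdd Px X (X s \<omega>) r \<partial>(Px x))"

fun cumul :: "real \<Rightarrow> (real \<times> 'f) list \<Rightarrow> (real \<times> 'f) list" where
  "cumul t0 [] = []"
| "cumul t0 ((s, f) # r) = (t0 + s, f) # cumul (t0 + s) r"

fun increments :: "real \<Rightarrow> (real \<times> 'f) list \<Rightarrow> (real \<times> 'f) list" where
  "increments t0 [] = []"
| "increments t0 ((t, f) # r) = (t - t0, f) # increments t r"

definition shift_list :: "real \<Rightarrow> (real \<times> 'f) list \<Rightarrow> (real \<times> 'f) list" where
  "shift_list q l = map (\<lambda>(t, f). (q + t, f)) l"

lemma cumul_append: "cumul t0 (l1 @ l2) = cumul t0 l1 @ cumul (t0 + (\<Sum>(s, f)\<leftarrow>l1. s)) l2"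
  by (induction t0 l1 rule: cumul.induct) (auto simp: add.assoc)

lemma cumul_increments: "cumul t0 (increments t0 l) = l"
  by (induction t0 l rule: increments.induct) auto

lemma cumul_shift: "cumul (q + t0) l = shift_list q (cumul t0 l)"
  by (induction t0 l rule: cumul.induct) (auto simp: shift_list_def add.assoc)

lemma ok_list_cumul: "t0 \<ge> 0 \<Longrightarrow> ok_list {0..} K l \<Longrightarrow> ok_list {0..} K (cumul t0 l)"
  by (induction t0 l rule: cumul.induct) auto

lemma ok_list_shift: "q \<ge> 0 \<Longrightarrow> ok_list {0..} K l \<Longrightarrow> ok_list {0..} K (shift_list q l)"
  by (auto simp: ok_list_def shift_list_def)

lemma ok_list_increments:
  "sorted (t0 # map fst l) \<Longrightarrow> ok_list UNIV K l \<Longrightarrow> ok_list {0..} K (increments t0 l)"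
  by (induction t0 l rule: increments.induct) auto

lemma sum_increments: "(\<Sum>(s, f)\<leftarrow>increments t0 (l @ [(q, g)]). s) = q - t0"
  by (induction t0 l rule: increments.induct) auto

lemma ok_list_sort [simp]: "ok_list I K (sort_key h l) = ok_list I K l"
  by (simp add: ok_list_def)

text \<open>A product does not depend on the order of its factors, so a list of times may be sorted
  before it is turned into increments, which are then nonnegative.\<close>

lemma prod_eval_sort: "prod_eval W \<omega> (sort_key h l) = prod_eval W \<omega> l"
proof -
  have "prod_eval W \<omega> l = prod_mset (image_mset (\<lambda>(i, f). f (W i \<omega>)) (mset l))" for l
    by (induction l) (auto)
  then show ?thesis by (metis mset_sort)
qed

lemma prod_eval_shift: "prod_eval W \<omega> (shift_list q l) = prod_eval (\<lambda>t. W (q + t)) \<omega> l"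
  by (induction l) (auto simp: shift_list_def)

lemma sorted_map_fst_sort: "ok_list {0..} K l \<Longrightarrow> sorted (0 # map fst (sort_key fst l))"
  by (auto simp: ok_list_def)

lemma ok_list_subset: "ok_list I K l \<Longrightarrow> I \<subseteq> I' \<Longrightarrow> ok_list I' K l"
  by (auto simp: ok_list_def)

lemma prod_eval_indicators:
  "prod_eval X \<omega> (cumul t0 (map (\<lambda>(s, A). (s, indicator A)) l)) = indicator {\<omega>. mp_event X \<omega> t0 l} \<omega>"
  by (induction X \<omega> t0 l rule: mp_event.induct) (auto split: split_indicator)

lemma fdd_indicators: "fdd Px X y (map (\<lambda>(s, A). (s, indicator A)) l) = mp_fdd Px X y l"
  by (induction Px X y l rule: mp_fdd.induct) auto

text \<open>Truncation by \<open>max 0\<close> lets kernels that are measurable only on the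
  half-line be handled as Borel functions on all reals; no value is affected, since the process is
  nonnegative.\<close>

lemma max_measurable: "(\<lambda>y. max 0 y) \<in> measurable borel (restrict_space borel {0::real..})"
  by (rule measurable_restrict_space2) auto

section \<open>Consequences of the Markov property\<close>

locale markov_proc =
  fixes Px :: "real \<Rightarrow> 'w measure" and X :: "real \<Rightarrow> 'w \<Rightarrow> real"
  assumes markov: "markov_family {0..} Px X"
begin

lemma prob: "x \<ge> 0 \<Longrightarrow> prob_space (Px x)"
  and X_measurable: "x \<ge> 0 \<Longrightarrow> t \<ge> 0 \<Longrightarrow> X t \<in> borel_measurable (Px x)"
  and X_nonneg: "x \<ge> 0 \<Longrightarrow> \<omega> \<in> space (Px x) \<Longrightarrow> t \<ge> 0 \<Longrightarrow> X t \<omega> \<ge> 0"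
  and X_0: "x \<ge> 0 \<Longrightarrow> AE \<omega> in Px x. X 0 \<omega> = x"
  and kernel_measurable: "t \<ge> 0 \<Longrightarrow> A \<in> sets borel \<Longrightarrow>
        (\<lambda>x. emeasure (Px x) {\<omega>\<in>space (Px x). X t \<omega> \<in> A}) \<in> borel_measurable (restrict_space borel {0..})"
  and mp_event_eq: "x \<ge> 0 \<Longrightarrow> (\<And>s A. (s, A) \<in> set l \<Longrightarrow> s \<ge> 0 \<and> A \<in> sets borel) \<Longrightarrow>
        emeasure (Px x) {\<omega>\<in>space (Px x). mp_event X \<omega> 0 l} = mp_fdd Px X x l"
  using markov unfolding markov_family_def by (auto simp: Ball_def)

lemma kernel_integral_measurable:
  assumes f: "f \<in> borel_measurable borel" and s: "s \<ge> 0"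
  shows "(\<lambda>y. \<integral>\<^sup>+\<omega>. f (X s \<omega>) \<partial>Px (max 0 y)) \<in> borel_measurable borel"
  using f
proof (induction rule: borel_measurable_induct)
  case (cong f g)
  then have "f = g" by auto
  with cong show ?case by simp
next
  case (set A)
  have "(\<lambda>y. \<integral>\<^sup>+\<omega>. indicator A (X s \<omega>) \<partial>Px (max 0 y))
     = (\<lambda>y. emeasure (Px (max 0 y)) {\<omega>\<in>space (Px (max 0 y)). X s \<omega> \<in> A})"
  proof
    fix y :: real
    have [measurable]: "X s \<in> borel_measurable (Px (max 0 y))" using s by (intro X_measurable) auto
    have "(\<integral>\<^sup>+\<omega>. indicator A (X s \<omega>) \<partial>Px (max 0 y))
       = (\<integral>\<^sup>+\<omega>. indicator {\<omega>\<in>space (Px (max 0 y)). X s \<omega> \<in> A} \<omega> \<partial>Px (max 0 y))"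
      by (intro nn_integral_cong) (auto split: split_indicator)
    also have "\<dots> = emeasure (Px (max 0 y)) {\<omega>\<in>space (Px (max 0 y)). X s \<omega> \<in> A}"
      using set measurable_sets[of "X s" "Px (max 0 y)" borel A]
      by (intro nn_integral_indicator) (auto simp: vimage_def Int_def conj_commute)
    finally show "(\<integral>\<^sup>+\<omega>. indicator A (X s \<omega>) \<partial>Px (max 0 y)) = \<dots>" .
  qed
  then show ?case using measurable_compose[OF max_measurable kernel_measurable[OF s set]] by simp
next
  case (mult u c)
  have "(\<integral>\<^sup>+\<omega>. c * u (X s \<omega>) \<partial>Px (max 0 y)) = c * (\<integral>\<^sup>+\<omega>. u (X s \<omega>) \<partial>Px (max 0 y))" for y
    using mult s X_measurable[of "max 0 y" s] by (intro nn_integral_cmult) (auto intro: measurable_compose)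
  then show ?case using mult by simp
next
  case (add u v)
  have "(\<integral>\<^sup>+\<omega>. v (X s \<omega>) + u (X s \<omega>) \<partial>Px (max 0 y))
     = (\<integral>\<^sup>+\<omega>. v (X s \<omega>) \<partial>Px (max 0 y)) + (\<integral>\<^sup>+\<omega>. u (X s \<omega>) \<partial>Px (max 0 y))" for y
    using add s X_measurable[of "max 0 y" s] by (intro nn_integral_add) (auto intro: measurable_compose)
  then show ?case using add by simp
next
  case (seq U)
  have "(\<integral>\<^sup>+\<omega>. (SUP i. U i) (X s \<omega>) \<partial>Px (max 0 y)) = (SUP i. \<integral>\<^sup>+\<omega>. U i (X s \<omega>) \<partial>Px (max 0 y))" for y
  proof -
    have "(\<integral>\<^sup>+\<omega>. (SUP i. U i (X s \<omega>)) \<partial>Px (max 0 y)) = (SUP i. \<integral>\<^sup>+\<omega>. U i (X s \<omega>) \<partial>Px (max 0 y))"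
      using seq s X_measurable[of "max 0 y" s]
      by (intro nn_integral_monotone_convergence_SUP) (auto intro: measurable_compose simp: incseq_def le_fun_def)
    then show ?thesis by (simp add: image_comp SUP_apply)
  qed
  then show ?case using seq by simp
qed

lemma fdd_max: "x \<ge> 0 \<Longrightarrow> s \<ge> 0 \<Longrightarrow>
  fdd Px X x ((s, f) # r) = (\<integral>\<^sup>+\<omega>. f (X s \<omega>) * fdd Px X (max 0 (X s \<omega>)) r \<partial>(Px x))"
  using X_nonneg by (auto intro!: nn_integral_cong)

lemma fdd_measurable:
  "ok_list {0..} (borel_measurable borel) l \<Longrightarrow> (\<lambda>y. fdd Px X (max 0 y) l) \<in> borel_measurable borel"
proof (induction l)
  case (Cons p l)
  obtain s f where p: "p = (s, f)" by (cases p)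
  with Cons.prems have s: "s \<ge> 0" and [measurable]: "f \<in> borel_measurable borel" by auto
  have [measurable]: "(\<lambda>y. fdd Px X (max 0 y) l) \<in> borel_measurable borel" using Cons p by auto
  have "(\<lambda>y. \<integral>\<^sup>+\<omega>. (\<lambda>v. f v * fdd Px X (max 0 v) l) (X s \<omega>) \<partial>Px (max 0 y)) \<in> borel_measurable borel"
    using s by (intro kernel_integral_measurable) auto
  then show ?case using s by (simp add: p fdd_max del: fdd.simps)
qed simp

lemma fdd_le_1: "x \<ge> 0 \<Longrightarrow> ok_list {0..} unit_fns l \<Longrightarrow> fdd Px X x l \<le> 1"
proof (induction l arbitrary: x)
  case (Cons p l)
  obtain s f where p: "p = (s, f)" by (cases p)
  interpret prob_space "Px x" using prob Cons.prems by simp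
  have "fdd Px X x ((s, f) # l) \<le> (\<integral>\<^sup>+\<omega>. 1 \<partial>Px x)"
    unfolding fdd.simps
  proof (rule nn_integral_mono)
    fix \<omega> assume "\<omega> \<in> space (Px x)"
    then have "fdd Px X (X s \<omega>) l \<le> 1" using Cons X_nonneg by (auto simp: p)
    then show "f (X s \<omega>) * fdd Px X (X s \<omega>) l \<le> 1"
      using Cons.prems mult_mono[of "f (X s \<omega>)" 1 "fdd Px X (X s \<omega>) l" 1] by (auto simp: p unit_fns_def)
  qed
  then show ?case by (simp add: p emeasure_space_1)
qed simp

lemma unit_fns_borel: "unit_fns \<subseteq> borel_measurable borel" by (auto simp: unit_fns_def)

text \<open>The slots after the chosen one act as a weight, those before it as mixtures of
  functionals.\<close>

lemma nn_functional_fdd: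
  assumes "x \<ge> 0" "ok_list {0..} (borel_measurable borel) (l1 @ l2)" "s \<ge> 0"
  shows "nn_functional (\<lambda>f. fdd Px X x (l1 @ (s, f) # l2))"
  using assms
proof (induction l1 arbitrary: x)
  case Nil
  have [measurable]: "X s \<in> borel_measurable (Px x)" "(\<lambda>y. fdd Px X (max 0 y) l2) \<in> borel_measurable borel"
    using Nil by (auto intro!: X_measurable fdd_measurable)
  have "nn_functional (\<lambda>f. \<integral>\<^sup>+\<omega>. fdd Px X (max 0 (X s \<omega>)) l2 * f (X s \<omega>) \<partial>Px x)"
    by (intro nn_functional_integral_weight) auto
  then show ?case using Nil by (simp add: fdd_max mult.commute del: fdd.simps)
next
  case (Cons p l1)
  obtain t g where p: "p = (t, g)" by (cases p)
  have t: "t \<ge> 0" and [measurable]: "g \<in> borel_measurable borel" using Cons.prems by (auto simp: p)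
  have [measurable]: "X t \<in> borel_measurable (Px x)" using Cons.prems t by (auto intro!: X_measurable)
  have m: "(\<lambda>y. fdd Px X (max 0 y) (l1 @ (s, f) # l2)) \<in> borel_measurable borel"
    if "f \<in> borel_measurable borel" for f
    using Cons.prems that by (intro fdd_measurable) (auto simp: p)
  have "nn_functional (\<lambda>f. \<integral>\<^sup>+\<omega>. g (X t \<omega>) * fdd Px X (max 0 (X t \<omega>)) (l1 @ (s, f) # l2) \<partial>Px x)"
  proof (rule nn_functional_mixture)
    show "(\<lambda>\<omega>. fdd Px X (max 0 (X t \<omega>)) (l1 @ (s, f) # l2)) \<in> borel_measurable (Px x)"
      if "f \<in> borel_measurable borel" for f
      using m[OF that] by measurable
    show "nn_functional (\<lambda>f. fdd Px X (max 0 (X t \<omega>)) (l1 @ (s, f) # l2))" for \<omega>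
      using Cons.prems by (intro Cons.IH) (auto simp: p)
  qed simp
  then show ?case using Cons.prems t by (simp add: p fdd_max del: fdd.simps)
qed

lemma X_measurable': "x \<ge> 0 \<Longrightarrow> t \<in> {0..} \<Longrightarrow> X t \<in> borel_measurable (Px x)"
  using X_measurable by simp

text \<open>The Markov property is assumed for lists of sets, which is the case of indicators. Both
  sides are linear and continuous in each slot, so \<open>ok_list_extend\<close> upgrades the
  indicators to arbitrary functions bounded by 1.\<close>

lemma integral_prod_eval_cumul:
  assumes x: "x \<ge> 0" and l: "ok_list {0..} unit_fns l"
  shows "(\<integral>\<^sup>+\<omega>. prod_eval X \<omega> (cumul 0 l) \<partial>Px x) = fdd Px X x l"
proof (rule ok_list_extend[where I="{0..}" and K=indicator_fns and l=l])
  interpret prob_space "Px x" using prob x by simp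
  show "nn_functional (\<lambda>f. \<integral>\<^sup>+\<omega>. prod_eval X \<omega> (cumul 0 (l1 @ (s, f) # l2)) \<partial>Px x)"
    if ok: "ok_list {0..} unit_fns (l1 @ l2)" and s: "s \<in> {0..}" for l1 s l2
  proof -
    have "0 \<le> (\<Sum>(s, f)\<leftarrow>l1. s)"
      using ok by (induction l1) auto
    then show ?thesis
      unfolding cumul_append cumul.simps using ok s x
      by (intro nn_functional_prod_eval[where I="{0..}"]) (auto intro!: X_measurable ok_list_cumul)
  qed
  show "nn_functional (\<lambda>f. fdd Px X x (l1 @ (s, f) # l2))"
    if ok: "ok_list {0..} unit_fns (l1 @ l2)" and s: "s \<in> {0..}" for l1 s l2
    using x s ok_list_mono[OF ok unit_fns_borel] by (intro nn_functional_fdd) auto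
  show "(\<integral>\<^sup>+\<omega>. prod_eval X \<omega> (cumul 0 l) \<partial>Px x) < \<infinity>" if "ok_list {0..} unit_fns l" for l
    using finite_measure_axioms ok_list_cumul[OF order_refl that] by (rule nn_integral_prod_eval_finite)
  show "(\<integral>\<^sup>+\<omega>. prod_eval X \<omega> (cumul 0 l) \<partial>Px x) = fdd Px X x l" if ok: "ok_list {0..} indicator_fns l" for l
  proof -
    have "\<exists>l'. l = map (\<lambda>(s, A). (s, indicator A)) l' \<and> (\<forall>(s, A)\<in>set l'. s \<ge> 0 \<and> A \<in> sets borel)"
      using ok
    proof (induction l)
      case (Cons p l)
      obtain s f where p: "p = (s, f)" by (cases p)
      obtain A where A: "f = indicator A" "A \<in> sets borel" using Cons.prems by (auto simp: p indicator_fns_def)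
      obtain l' where "l = map (\<lambda>(s, A). (s, indicator A)) l'" "\<forall>(s, A)\<in>set l'. s \<ge> 0 \<and> A \<in> sets borel"
        using Cons p by auto
      then show ?case using A Cons.prems by (intro exI[of _ "(s, A) # l'"]) (auto simp: p)
    qed simp
    then obtain l' where l': "l = map (\<lambda>(s, A). (s, indicator A)) l'"
      "\<And>s A. (s, A) \<in> set l' \<Longrightarrow> s \<ge> 0 \<and> A \<in> sets borel" by auto
    \<comment> \<open>The event is where the product of indicators equals 1, so its measurability is
      that of a product of functions.\<close>
    have meas: "{\<omega>\<in>space (Px x). mp_event X \<omega> 0 l'} \<in> sets (Px x)"
    proof -
      have "(\<lambda>\<omega>. prod_eval X \<omega> (cumul 0 l)) \<in> borel_measurable (Px x)"
        using ok x determining_indicator_fns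
        by (intro prod_eval_measurable[where I="{0..}"] X_measurable' ok_list_cumul) (auto simp: determining_def intro: ok_list_mono)
      then have "(\<lambda>\<omega>. prod_eval X \<omega> (cumul 0 l)) -` {1} \<inter> space (Px x) \<in> sets (Px x)"
        by (rule measurable_sets) simp
      also have "(\<lambda>\<omega>. prod_eval X \<omega> (cumul 0 l)) -` {1} \<inter> space (Px x) = {\<omega>\<in>space (Px x). mp_event X \<omega> 0 l'}"
        unfolding l'(1) prod_eval_indicators by (auto split: split_indicator_asm simp: indicator_def)
      finally show ?thesis .
    qed
    have "(\<integral>\<^sup>+\<omega>. prod_eval X \<omega> (cumul 0 l) \<partial>Px x) = (\<integral>\<^sup>+\<omega>. indicator {\<omega>\<in>space (Px x). mp_event X \<omega> 0 l'} \<omega> \<partial>Px x)"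
      unfolding l'(1) prod_eval_indicators by (intro nn_integral_cong) (auto split: split_indicator)
    also have "\<dots> = mp_fdd Px X x l'"
      using meas mp_event_eq[OF x l'(2)] by simp
    finally show ?thesis unfolding l'(1) fdd_indicators .
  qed
qed (auto intro: l determining_indicator_fns)

lemma fdd_time_0:
  assumes x: "x \<ge> 0"
  shows "fdd Px X x ((0, f) # l) = f x * fdd Px X x l"
proof -
  interpret prob_space "Px x" using prob x by simp
  have "(\<integral>\<^sup>+\<omega>. f (X 0 \<omega>) * fdd Px X (X 0 \<omega>) l \<partial>Px x) = (\<integral>\<^sup>+\<omega>. f x * fdd Px X x l \<partial>Px x)"
    using X_0[OF x] by (intro nn_integral_cong_AE) auto
  then show ?thesis by (simp add: emeasure_space_1)
qed

text \<open>Packing the remaining iterated integrals into a single slot at time 0 is the Markov property.\<close>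

lemma fdd_append:
  assumes "x \<ge> 0" "ok_list {0..} (borel_measurable borel) (l1 @ l2)"
  shows "fdd Px X x (l1 @ l2) = fdd Px X x (l1 @ [(0, \<lambda>y. fdd Px X (max 0 y) l2)])"
  using assms
proof (induction l1 arbitrary: x)
  case Nil
  then show ?case using fdd_time_0[of x "\<lambda>y. fdd Px X (max 0 y) l2" "[]"] by simp
next
  case (Cons p l1)
  obtain s f where p: "p = (s, f)" by (cases p)
  have "fdd Px X (X s \<omega>) (l1 @ l2) = fdd Px X (X s \<omega>) (l1 @ [(0, \<lambda>y. fdd Px X (max 0 y) l2)])"
    if "\<omega> \<in> space (Px x)" for \<omega>
    using Cons.prems that by (intro Cons.IH X_nonneg) (auto simp: p)
  then show ?case by (auto simp: p intro!: nn_integral_cong)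
qed

definition expect_from :: "(real \<times> (real \<Rightarrow> ennreal)) list \<Rightarrow> real \<Rightarrow> ennreal" where
  "expect_from l y = (\<integral>\<^sup>+\<omega>. prod_eval X \<omega> l \<partial>Px (max 0 y))"

text \<open>Rewriting the expectation as an iterated integral gives access to its dependence on the
  starting point: measurability here, continuity in \<open>expect_from_cont_fns\<close>.\<close>

lemma expect_from_eq:
  assumes l: "ok_list {0..} unit_fns l"
  shows "expect_from l y = fdd Px X (max 0 y) (increments 0 (sort_key fst l))"
proof -
  have "ok_list {0..} unit_fns (increments 0 (sort_key fst l))"
    using l by (intro ok_list_increments sorted_map_fst_sort) (auto intro: ok_list_subset)
  then show ?thesis
    using integral_prod_eval_cumul[of "max 0 y" "increments 0 (sort_key fst l)"]
    by (simp add: expect_from_def cumul_increments prod_eval_sort)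
qed

lemma expect_from_unit_fns:
  assumes l: "ok_list {0..} unit_fns l"
  shows "expect_from l \<in> unit_fns"
proof -
  have ok: "ok_list {0..} unit_fns (increments 0 (sort_key fst l))"
    using l by (intro ok_list_increments sorted_map_fst_sort) (auto intro: ok_list_subset)
  have "expect_from l = (\<lambda>y. fdd Px X (max 0 y) (increments 0 (sort_key fst l)))"
    using expect_from_eq[OF l] by auto
  then show ?thesis
    using fdd_measurable[OF ok_list_mono[OF ok unit_fns_borel]] fdd_le_1[OF _ ok]
    by (simp add: unit_fns_def)
qed

text \<open>Past and future are concatenated into one list of increments; \<open>fdd_append\<close>
  collapses the future into a single function of the state at time \<open>q\<close>, and the list is
  then read back as a product.\<close>

lemma markov_property:
  assumes x: "x \<ge> 0" and q: "q \<ge> 0"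
    and p: "ok_list {0..q} unit_fns p" and l: "ok_list {0..} unit_fns l"
  shows "(\<integral>\<^sup>+\<omega>. prod_eval X \<omega> p * prod_eval (\<lambda>t. X (q + t)) \<omega> l \<partial>Px x)
       = (\<integral>\<^sup>+\<omega>. prod_eval X \<omega> p * expect_from l (X q \<omega>) \<partial>Px x)"
proof -
  \<comment> \<open>The constant slot makes the increments of the past add up to exactly
    \<open>q\<close>, even if the last time observed is smaller or the past is empty.\<close>
  define l1 where "l1 = increments 0 (sort_key fst p @ [(q, \<lambda>_. 1)])"
  define l2 where "l2 = increments 0 (sort_key fst l)"
  have p0: "ok_list {0..} unit_fns p" using p by (rule ok_list_subset) auto
  have ok1: "ok_list {0..} unit_fns l1"
  proof -
    have "sorted (0 # map fst (sort_key fst p @ [(q, \<lambda>_. 1)]))"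
      using p q by (auto simp: sorted_append ok_list_def)
    then show ?thesis
      unfolding l1_def using p by (intro ok_list_increments) (auto intro: ok_list_subset const_one_unit)
  qed
  have ok2: "ok_list {0..} unit_fns l2"
    unfolding l2_def using l by (intro ok_list_increments sorted_map_fst_sort) (auto intro: ok_list_subset)
  have c1: "cumul 0 l1 = sort_key fst p @ [(q, \<lambda>_. 1)]" by (simp add: l1_def cumul_increments)
  have s1: "(\<Sum>(s, f)\<leftarrow>l1. s) = q" by (simp add: l1_def sum_increments)
  have K: "(\<lambda>y. fdd Px X (max 0 y) l2) = expect_from l" using expect_from_eq[OF l] by (auto simp: l2_def)
  have "(\<integral>\<^sup>+\<omega>. prod_eval X \<omega> p * prod_eval (\<lambda>t. X (q + t)) \<omega> l \<partial>Px x)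
     = (\<integral>\<^sup>+\<omega>. prod_eval X \<omega> (cumul 0 (l1 @ l2)) \<partial>Px x)"
  proof -
    have "cumul q l2 = shift_list q (sort_key fst l)"
      using cumul_shift[of q 0 l2] by (simp add: l2_def cumul_increments)
    then show ?thesis by (simp add: cumul_append c1 s1 prod_eval_sort prod_eval_shift)
  qed
  also have "\<dots> = fdd Px X x (l1 @ l2)"
    using ok1 ok2 x by (intro integral_prod_eval_cumul) auto
  also have "\<dots> = fdd Px X x (l1 @ [(0, expect_from l)])"
    using ok1 ok2 ok_list_mono[OF _ unit_fns_borel] unfolding K[symmetric] by (intro fdd_append x) auto
  also have "\<dots> = (\<integral>\<^sup>+\<omega>. prod_eval X \<omega> (cumul 0 (l1 @ [(0, expect_from l)])) \<partial>Px x)"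
    using ok1 x expect_from_unit_fns[OF l] by (intro integral_prod_eval_cumul[symmetric]) auto
  also have "\<dots> = (\<integral>\<^sup>+\<omega>. prod_eval X \<omega> p * expect_from l (X q \<omega>) \<partial>Px x)"
    by (simp add: cumul_append c1 s1 prod_eval_sort)
  finally show ?thesis .
qed

end

locale feller_proc = markov_proc +
  assumes feller: "\<And>f t. continuous_on {0..} f \<Longrightarrow> bounded (f ` {0..}) \<Longrightarrow> t \<ge> 0 \<Longrightarrow>
                     continuous_on {0..} (semigroup Px X t f)"
    and feller_0: "\<And>f x. continuous_on {0..} f \<Longrightarrow> bounded (f ` {0..}) \<Longrightarrow> x \<ge> 0 \<Longrightarrow>
                     ((\<lambda>t. semigroup Px X t f x) \<longlongrightarrow> f x) (at_right 0)"
begin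

text \<open>The Feller property on bounded continuous functions is applied once per slot, starting
  from the last one.\<close>

lemma fdd_cont:
  "ok_list {0..} cont_fns l \<Longrightarrow> (\<lambda>y. fdd Px X (max 0 y) l) \<in> cont_fns"
proof (induction l)
  case Nil
  then show ?case by (auto simp: cont_fns_def intro!: exI[of _ "\<lambda>_. 1"])
next
  case (Cons p l)
  obtain s f where p: "p = (s, f)" by (cases p)
  have s: "s \<ge> 0" and f: "f \<in> cont_fns" using Cons.prems by (auto simp: p)
  obtain g where g: "f = (\<lambda>x. ennreal (g x))" "continuous_on UNIV g" "\<And>x. 0 \<le> g x \<and> g x \<le> 1"
    using f by (auto simp: cont_fns_def)
  obtain h where h: "(\<lambda>y. fdd Px X (max 0 y) l) = (\<lambda>x. ennreal (h x))" "continuous_on UNIV h" "\<And>x. 0 \<le> h x \<and> h x \<le> 1"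
    using Cons by (auto simp: cont_fns_def p)
  \<comment> \<open>The current slot times the expected value of all later slots: the function to
    which the semigroup is applied.\<close>
  define k where "k x = g x * h x" for x
  have kc: "continuous_on UNIV k" using g h by (auto simp: k_def[abs_def] intro!: continuous_intros)
  have k01: "0 \<le> k x" "k x \<le> 1" for x using g(3)[of x] h(3)[of x] by (auto simp: k_def intro: mult_le_one)
  have [measurable]: "k \<in> borel_measurable borel" using kc by (rule borel_measurable_continuous_onI)
  have S: "fdd Px X y ((s, f) # l) = ennreal (semigroup Px X s k y)"
    and S0: "0 \<le> semigroup Px X s k y" and S1: "semigroup Px X s k y \<le> 1" if y: "y \<ge> 0" for y
  proof -
    interpret prob_space "Px y" using prob y by simp
    have [measurable]: "X s \<in> borel_measurable (Px y)" using y s by (rule X_measurable)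
    have int: "integrable (Px y) (\<lambda>\<omega>. k (X s \<omega>))"
      using k01 by (intro integrable_const_bound[where B=1]) auto
    have "fdd Px X y ((s, f) # l) = (\<integral>\<^sup>+\<omega>. ennreal (k (X s \<omega>)) \<partial>Px y)"
      using y s g h fun_cong[OF h(1)] by (simp add: fdd_max k_def ennreal_mult del: fdd.simps)
    also have "\<dots> = ennreal (semigroup Px X s k y)"
      unfolding semigroup_def using int k01 by (intro nn_integral_eq_integral) auto
    finally show "fdd Px X y ((s, f) # l) = ennreal (semigroup Px X s k y)" .
    show "0 \<le> semigroup Px X s k y" unfolding semigroup_def using k01 by (intro integral_nonneg_AE) auto
    have "(\<integral>\<omega>. k (X s \<omega>) \<partial>Px y) \<le> (\<integral>\<omega>. 1 \<partial>Px y)" using int k01 by (intro integral_mono) auto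
    then show "semigroup Px X s k y \<le> 1" unfolding semigroup_def by (simp add: prob_space)
  qed
  have "continuous_on {0..} (semigroup Px X s k)"
  proof (rule feller)
    show "continuous_on {0..} k" using kc by (rule continuous_on_subset) auto
    show "bounded (k ` {0..})" using k01 by (auto simp: bounded_iff intro!: exI[of _ 1])
  qed (rule s)
  then have "continuous_on UNIV (\<lambda>y. semigroup Px X s k (max 0 y))"
    by (rule continuous_on_compose2) (auto intro!: continuous_intros)
  then show ?case
    unfolding cont_fns_def p using S S0 S1
    by (auto intro!: exI[of _ "\<lambda>y. semigroup Px X s k (max 0 y)"] simp del: fdd.simps)
qed

lemma expect_from_cont_fns:
  assumes l: "ok_list {0..} cont_fns l"
  shows "expect_from l \<in> cont_fns"
proof -
  have ok: "ok_list {0..} cont_fns (increments 0 (sort_key fst l))"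
    using l by (intro ok_list_increments sorted_map_fst_sort) (auto intro: ok_list_subset)
  have "expect_from l = (\<lambda>y. fdd Px X (max 0 y) (increments 0 (sort_key fst l)))"
    using expect_from_eq[OF ok_list_mono[OF l cont_fns_unit]] by auto
  then show ?thesis using fdd_cont[OF ok] by simp
qed

end

subsection \<open>Right-continuous paths and first passage times\<close>

text \<open>The least multiple of \<open>1 / (m + 1)\<close> strictly above \<open>u\<close>.
  Strictness has two uses: right-continuity applies along the approximation, and whether a passage
  time lies in a given cell is decided by the path before the right end of that cell.\<close>

definition grid :: "nat \<Rightarrow> real \<Rightarrow> real" where
  "grid m u = (of_int \<lfloor>real (Suc m) * u\<rfloor> + 1) / real (Suc m)"

lemma grid_gt: "u < grid m u"
  and grid_le: "grid m u \<le> u + 1 / real (Suc m)"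
proof -
  have "real (Suc m) * u < of_int \<lfloor>real (Suc m) * u\<rfloor> + 1" by linarith
  then show "u < grid m u" unfolding grid_def by (simp add: pos_less_divide_eq mult.commute)
  have "of_int \<lfloor>real (Suc m) * u\<rfloor> \<le> real (Suc m) * u" by linarith
  then have "grid m u \<le> (real (Suc m) * u + 1) / real (Suc m)"
    unfolding grid_def by (intro divide_right_mono) auto
  also have "\<dots> = u + 1 / real (Suc m)" by (simp add: field_simps)
  finally show "grid m u \<le> u + 1 / real (Suc m)" .
qed

lemma grid_at_right: "filterlim (\<lambda>m. grid m u) (at_right u) sequentially"
proof (rule tendsto_imp_filterlim_at_right)
  have "(\<lambda>m. u + 1 / real (Suc m)) \<longlonglongrightarrow> u + 0"
    by (intro tendsto_intros LIMSEQ_Suc[OF lim_1_over_n])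
  then have "(\<lambda>m. u + 1 / real (Suc m)) \<longlonglongrightarrow> u" by simp
  from tendsto_sandwich[OF _ _ tendsto_const[of u] this]
  show "(\<lambda>m. grid m u) \<longlonglongrightarrow> u"
    using grid_le[of _ u] less_imp_le[OF grid_gt[of u]] by (simp only: eventually_True simp_thms)
qed (auto simp: grid_gt)

lemma grid_measurable [measurable]: "grid m \<in> borel_measurable borel"
  unfolding grid_def[abs_def] by measurable

definition rcont :: "(real \<Rightarrow> 'a::topological_space) \<Rightarrow> bool" where
  "rcont f \<longleftrightarrow> (\<forall>t\<ge>0. (f \<longlongrightarrow> f t) (at_right t))"

lemma rcont_grid: "rcont f \<Longrightarrow> t \<ge> 0 \<Longrightarrow> (\<lambda>m. f (grid m t)) \<longlonglongrightarrow> f t"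
  unfolding rcont_def using filterlim_compose[OF _ grid_at_right] by blast

lemma rcont_shift:
  assumes "rcont f" "c \<ge> 0"
  shows "rcont (\<lambda>s. f (c + s))"
  unfolding rcont_def
proof (intro allI impI)
  fix t :: real assume "t \<ge> 0"
  then have "(f \<longlongrightarrow> f (c + t)) (at_right (c + t))" using assms by (simp add: rcont_def)
  then show "((\<lambda>s. f (c + s)) \<longlongrightarrow> f (c + t)) (at_right t)"
    by (subst (asm) filterlim_at_right_to_0) (auto simp: filterlim_at_right_to_0[of _ _ t] ac_simps)
qed

lemma rcont_grid_shift:
  assumes "rcont f" "t \<ge> 0" "s \<ge> 0"
  shows "(\<lambda>m. f (grid m t + s)) \<longlonglongrightarrow> f (t + s)"
  using rcont_grid[OF rcont_shift[OF assms(1,3)] assms(2)] by (simp add: add.commute)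

lemma rcont_grid_min:
  assumes "rcont f" "t \<ge> 0" "u \<ge> 0"
  shows "(\<lambda>m. f (min u (grid m t))) \<longlonglongrightarrow> f (min u t)"
proof (cases "u \<le> t")
  case True
  then have "min u (grid m t) = u" for m using grid_gt[of t m] by simp
  then show ?thesis using True by simp
next
  case False
  have "(\<lambda>m. grid m t) \<longlonglongrightarrow> t"
    using grid_at_right[of t] by (simp add: filterlim_at)
  then have "\<forall>\<^sub>F m in sequentially. grid m t < u" using False by (intro order_tendstoD) auto
  then have "\<forall>\<^sub>F m in sequentially. f (grid m t) = f (min u (grid m t))"
    by eventually_elim simp
  then show ?thesis using rcont_grid[OF assms(1,2)] False by (auto intro: Lim_transform_eventually)
qed

text \<open>The random time is replaced by \<open>grid m\<close>, which takes countably many values,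
  and right-continuity gives the limit.\<close>

lemma rcont_eval_measurable:
  fixes Y :: "real \<Rightarrow> 'a \<Rightarrow> real"
  assumes Y: "\<And>t. t \<ge> 0 \<Longrightarrow> Y t \<in> borel_measurable M"
    and rc: "\<And>\<omega>. \<omega> \<in> space M \<Longrightarrow> rcont (\<lambda>t. Y t \<omega>)"
    and [measurable]: "\<theta> \<in> borel_measurable M" and \<theta>: "\<And>\<omega>. \<omega> \<in> space M \<Longrightarrow> \<theta> \<omega> \<ge> 0"
  shows "(\<lambda>\<omega>. Y (\<theta> \<omega>) \<omega>) \<in> borel_measurable M"
proof (rule borel_measurable_LIMSEQ_metric)
  fix m
  \<comment> \<open>The composition ranges over all integers \<open>k\<close>, so
    \<open>max 0\<close> keeps the time nonnegative where \<open>Y\<close> is known to be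
    measurable.\<close>
  have "(\<lambda>\<omega>. (\<lambda>k::int. Y (max 0 ((of_int k + 1) / real (Suc m)))) \<lfloor>real (Suc m) * \<theta> \<omega>\<rfloor> \<omega>) \<in> borel_measurable M"
    by (rule measurable_compose_countable) (auto intro!: Y)
  then show "(\<lambda>\<omega>. Y (max 0 (grid m (\<theta> \<omega>))) \<omega>) \<in> borel_measurable M"
    by (simp add: grid_def)
next
  fix \<omega> assume w: "\<omega> \<in> space M"
  have "max 0 (grid m (\<theta> \<omega>)) = grid m (\<theta> \<omega>)" for m
    using \<theta>[OF w] grid_gt[of "\<theta> \<omega>" m] by simp
  then show "(\<lambda>m. Y (max 0 (grid m (\<theta> \<omega>))) \<omega>) \<longlonglongrightarrow> Y (\<theta> \<omega>) \<omega>"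
    using rcont_grid[OF rc[OF w] \<theta>[OF w]] by simp
qed

lemma cadlag_rcont: "cadlag f \<Longrightarrow> rcont f" by (simp add: cadlag_def rcont_def)

text \<open>By right-continuity a visit below \<open>b\<close> persists for a short while, hence
  includes a rational time. The strict inequality on the left leaves room for that later
  time.\<close>

lemma hit_below_less_iff:
  assumes rc: "rcont (\<lambda>t. X t \<omega>)"
  shows "hit_below X b \<omega> < y \<longleftrightarrow> (\<exists>s\<in>\<rat>. 0 \<le> s \<and> ennreal s < y \<and> X s \<omega> < b)"
proof
  assume "hit_below X b \<omega> < y"
  then obtain t where t: "t \<ge> 0" "X t \<omega> < b" "ennreal t < y"
    unfolding hit_below_def Inf_less_iff by auto
  \<comment> \<open>A finite bound is interposed because \<open>y\<close> may be infinite.\<close>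
  obtain u where u: "t < u" "ennreal u \<le> y"
  proof (cases y)
    case (real r)
    then show ?thesis using t that[of r] by (auto simp: ennreal_less_iff)
  next
    case top
    then show ?thesis using that[of "t + 1"] by simp
  qed
  have "((\<lambda>t. X t \<omega>) \<longlongrightarrow> X t \<omega>) (at_right t)" using rc t by (simp add: rcont_def)
  then have "\<forall>\<^sub>F s in at_right t. X s \<omega> < b" using t(2) by (rule order_tendstoD)
  then obtain c where c: "c > t" "\<And>s. t < s \<Longrightarrow> s < c \<Longrightarrow> X s \<omega> < b"
    unfolding eventually_at_right_field by blast
  have "t < min c u" using c u by simp
  from Rats_dense_in_real[OF this] obtain s where s: "s \<in> \<rat>" "t < s" "s < min c u" by blast
  have "ennreal s < ennreal u" using s t(1) by (intro ennreal_lessI) auto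
  then have "ennreal s < y" using u(2) by (rule less_le_trans)
  then show "\<exists>s\<in>\<rat>. 0 \<le> s \<and> ennreal s < y \<and> X s \<omega> < b"
    using s t(1) c(2) by (intro bexI[of _ s]) auto
next
  assume "\<exists>s\<in>\<rat>. 0 \<le> s \<and> ennreal s < y \<and> X s \<omega> < b"
  then show "hit_below X b \<omega> < y" unfolding hit_below_def Inf_less_iff by auto
qed

lemma before_hit_below: "t \<ge> 0 \<Longrightarrow> ennreal t < hit_below X b \<omega> \<Longrightarrow> b \<le> X t \<omega>"
proof (rule ccontr)
  assume "t \<ge> 0" "ennreal t < hit_below X b \<omega>" "\<not> b \<le> X t \<omega>"
  then have "hit_below X b \<omega> \<le> ennreal t"
    unfolding hit_below_def by (intro Inf_lower) auto
  then show False using \<open>ennreal t < hit_below X b \<omega>\<close> by simp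
qed

lemma sets_hits:
  fixes U :: "real \<Rightarrow> 'a \<Rightarrow> real"
  assumes D: "countable D" "D \<subseteq> I" and U: "\<And>t. t \<in> I \<Longrightarrow> U t \<in> borel_measurable N"
  shows "{\<omega>\<in>space N. \<exists>s\<in>D. U s \<omega> < b} \<in> sets N"
proof -
  have "{\<omega>\<in>space N. \<exists>s\<in>D. U s \<omega> < b} = (\<Union>s\<in>D. {\<omega>\<in>space N. U s \<omega> < b})" by auto
  also have "\<dots> \<in> sets N"
  proof (rule sets.countable_UN'[OF D(1)], safe)
    fix s assume "s \<in> D"
    then have [measurable]: "U s \<in> borel_measurable N" using U D(2) by auto
    show "{\<omega>\<in>space N. U s \<omega> < b} \<in> sets N" by measurable
  qed
  finally show ?thesis .
qed

lemma countable_rat_subset: "countable {s\<in>\<rat>. P (s::real)}"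
  by (rule countable_subset[OF _ countable_rat]) auto

lemma hit_below_measurable:
  assumes Y: "\<And>t. t \<ge> 0 \<Longrightarrow> X t \<in> borel_measurable M"
    and rc: "\<And>\<omega>. \<omega> \<in> space M \<Longrightarrow> rcont (\<lambda>t. X t \<omega>)"
  shows "hit_below X b \<in> borel_measurable M"
proof (rule borel_measurableI_less)
  fix y
  have "{\<omega>\<in>space M. hit_below X b \<omega> < y} = {\<omega>\<in>space M. \<exists>s\<in>{s\<in>\<rat>. 0 \<le> s \<and> ennreal s < y}. X s \<omega> < b}"
    using hit_below_less_iff[of X _ b y, OF rc] by auto
  also have "\<dots> \<in> sets M"
    by (rule sets_hits[where I="{0..}"]) (auto intro: countable_rat_subset Y)
  finally show "{\<omega> \<in> space M. hit_below X b \<omega> < y} \<in> sets M" .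
qed

text \<open>The absence of negative jumps enters only here: the level \<open>b\<close> cannot be jumped over downwards.\<close>

lemma at_hit_below:
  assumes cad: "cadlag (\<lambda>t. X t \<omega>)" and nnj: "no_negative_jumps (\<lambda>t. X t \<omega>)"
    and X0: "b \<le> X 0 \<omega>" and fin: "hit_below X b \<omega> < \<infinity>"
  shows "X (enn2real (hit_below X b \<omega>)) \<omega> = b"
proof -
  define t where "t = enn2real (hit_below X b \<omega>)"
  have t: "ennreal t = hit_below X b \<omega>" "t \<ge> 0" using fin by (auto simp: t_def)
  have rc: "((\<lambda>t. X t \<omega>) \<longlongrightarrow> X t \<omega>) (at_right t)" using cad t(2) by (simp add: cadlag_def)
  \<comment> \<open>Above \<open>b\<close> at time \<open>t\<close>, the path would stay above
    \<open>b\<close> for a while, and with \<open>before_hit_below\<close> the infimum would be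
    larger than \<open>t\<close>.\<close>
  have "X t \<omega> \<le> b"
  proof (rule ccontr)
    assume "\<not> X t \<omega> \<le> b"
    then have "\<forall>\<^sub>F s in at_right t. b < X s \<omega>" using rc by (intro order_tendstoD) auto
    then obtain c where c: "c > t" "\<And>s. t < s \<Longrightarrow> s < c \<Longrightarrow> b < X s \<omega>"
      unfolding eventually_at_right_field by blast
    have "hit_below X b \<omega> < ennreal c" unfolding t(1)[symmetric] using c(1) t(2) by (intro ennreal_lessI) auto
    then obtain s where s: "s \<ge> 0" "X s \<omega> < b" "ennreal s < ennreal c"
      unfolding hit_below_def Inf_less_iff by auto
    have "t \<le> s"
    proof (rule ccontr)
      assume "\<not> t \<le> s"
      then have "ennreal s < hit_below X b \<omega>" unfolding t(1)[symmetric] using s by (intro ennreal_lessI) auto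
      then show False using before_hit_below[of s X b \<omega>] s by simp
    qed
    moreover have "s < c" using s by (simp add: ennreal_less_iff)
    ultimately show False using c(2)[of s] s \<open>\<not> X t \<omega> \<le> b\<close> by (cases "s = t") auto
  qed
  \<comment> \<open>The left limit at \<open>t\<close> is at least \<open>b\<close>, and the path
    can only jump upwards from it; at time 0 the starting value is used instead.\<close>
  moreover have "b \<le> X t \<omega>"
  proof (cases "t = 0")
    case True
    then show ?thesis using X0 by simp
  next
    case False
    then have "t > 0" using t by simp
    then obtain l where l: "((\<lambda>t. X t \<omega>) \<longlongrightarrow> l) (at_left t)" using cad unfolding cadlag_def by blast
    have "\<forall>\<^sub>F s in at_left t. b \<le> X s \<omega>"
      unfolding eventually_at_left_field
    proof (intro exI[of _ 0] conjI allI impI)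
      fix s assume s: "0 < s" "s < t"
      then have "ennreal s < hit_below X b \<omega>" unfolding t(1)[symmetric] by (intro ennreal_lessI) auto
      then show "b \<le> X s \<omega>" using s before_hit_below[of s X b \<omega>] by simp
    qed fact
    then have "b \<le> l" using l by (intro tendsto_lowerbound[OF l]) auto
    also have "l \<le> X t \<omega>" using nnj l \<open>t > 0\<close> by (auto simp: no_negative_jumps_def)
    finally show ?thesis .
  qed
  ultimately show ?thesis by (simp add: t_def)
qed

lemma prod_eval_tendsto:
  assumes l: "ok_list I cont_fns l" and W: "\<And>i. i \<in> I \<Longrightarrow> ((\<lambda>n. W n i \<omega>) \<longlongrightarrow> W' i \<omega>) F"
  shows "((\<lambda>n. prod_eval (W n) \<omega> l) \<longlongrightarrow> prod_eval W' \<omega> l) F"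
  using l
proof (induction l)
  case (Cons p l)
  obtain i f where p: "p = (i, f)" by (cases p)
  with Cons.prems have i: "i \<in> I" and f: "f \<in> cont_fns" and l: "ok_list I cont_fns l" by auto
  obtain g where g: "f = (\<lambda>x. ennreal (g x))" "continuous_on UNIV g" using f by (auto simp: cont_fns_def)
  have "((\<lambda>n. g (W n i \<omega>)) \<longlongrightarrow> g (W' i \<omega>)) F"
    using continuous_on_tendsto_compose[OF g(2) W[OF i]] by simp
  then have lim: "((\<lambda>n. f (W n i \<omega>)) \<longlongrightarrow> f (W' i \<omega>)) F" unfolding g(1) by (rule tendsto_ennrealI)
  have "prod_eval W' \<omega> l \<le> 1" using prod_eval_le_1[OF ok_list_mono[OF l cont_fns_unit]] .
  \<comment> \<open>Multiplication in \<open>ennreal\<close> is not continuous at 0 times infinity,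
    so finiteness of both limits is recorded first.\<close>
  then have "prod_eval W' \<omega> l \<noteq> top" by (auto simp: top_unique)
  moreover have "f (W' i \<omega>) \<noteq> top" by (simp add: g(1))
  ultimately show ?case unfolding p prod_eval_simps using Cons.IH[OF l] lim by (intro tendsto_mult_ennreal) auto
qed simp

lemma cont_fns_tendsto: "f \<in> cont_fns \<Longrightarrow> (g \<longlongrightarrow> y) F \<Longrightarrow> ((\<lambda>n. f (g n)) \<longlongrightarrow> f y) F"
proof -
  assume "f \<in> cont_fns" and lim: "(g \<longlongrightarrow> y) F"
  then obtain h where "f = (\<lambda>x. ennreal (h x))" "continuous_on UNIV h" by (auto simp: cont_fns_def)
  then show ?thesis using continuous_on_tendsto_compose[of UNIV h g y F] lim by (auto intro!: tendsto_ennrealI)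
qed

lemma law_integral_eq:
  fixes W :: "'i \<Rightarrow> 'a \<Rightarrow> real" and W' :: "'i \<Rightarrow> 'b \<Rightarrow> real"
  assumes fin: "finite_measure M" "finite_measure N"
    and W: "\<And>i. i \<in> I \<Longrightarrow> W i \<in> borel_measurable M"
    and W': "\<And>i. i \<in> I \<Longrightarrow> W' i \<in> borel_measurable N"
    and agree: "\<And>l. ok_list I cont_fns l \<Longrightarrow>
      (\<integral>\<^sup>+\<omega>. prod_eval W \<omega> l \<partial>M) = (\<integral>\<^sup>+\<omega>. prod_eval W' \<omega> l \<partial>N)"
    and h: "h \<in> borel_measurable (PiM I (\<lambda>_. borel))"
  shows "(\<integral>\<^sup>+\<omega>. h (\<lambda>i\<in>I. W i \<omega>) \<partial>M) = (\<integral>\<^sup>+\<omega>. h (\<lambda>i\<in>I. W' i \<omega>) \<partial>N)"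
proof -
  have m: "(\<lambda>\<omega>. \<lambda>i\<in>I. W i \<omega>) \<in> measurable M (PiM I (\<lambda>_. borel))"
    "(\<lambda>\<omega>. \<lambda>i\<in>I. W' i \<omega>) \<in> measurable N (PiM I (\<lambda>_. borel))"
    using W W' by (auto intro!: measurable_restrict)
  have "(\<integral>\<^sup>+\<omega>. h (\<lambda>i\<in>I. W i \<omega>) \<partial>M) = (\<integral>\<^sup>+w. h w \<partial>distr M (PiM I (\<lambda>_. borel)) (\<lambda>\<omega>. \<lambda>i\<in>I. W i \<omega>))"
    using m h by (simp add: nn_integral_distr)
  also have "\<dots> = (\<integral>\<^sup>+w. h w \<partial>distr N (PiM I (\<lambda>_. borel)) (\<lambda>\<omega>. \<lambda>i\<in>I. W' i \<omega>))"
    by (subst law_eqI[OF fin W W' agree]) auto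
  also have "\<dots> = (\<integral>\<^sup>+\<omega>. h (\<lambda>i\<in>I. W' i \<omega>) \<partial>N)"
    using m h by (simp add: nn_integral_distr)
  finally show ?thesis .
qed

subsection \<open>The strong Markov property at a first passage time\<close>

lemma finite_measure_density_le_1:
  assumes "finite_measure M" and [measurable]: "f \<in> borel_measurable M" and le: "\<And>\<omega>. \<omega> \<in> space M \<Longrightarrow> f \<omega> \<le> 1"
  shows "finite_measure (density M f)"
proof
  interpret finite_measure M by fact
  have "emeasure (density M f) (space M) = (\<integral>\<^sup>+\<omega>. f \<omega> \<partial>M)"
    by (subst emeasure_density) (auto intro!: nn_integral_cong)
  also have "\<dots> \<le> (\<integral>\<^sup>+\<omega>. 1 \<partial>M)" using le by (intro nn_integral_mono) auto
  also have "\<dots> < \<infinity>" by (simp add: emeasure_eq_measure)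
  finally show "emeasure (density M f) (space (density M f)) \<noteq> \<infinity>" by simp
qed

text \<open>The switch takes place at the passage time itself, where the first path is at
  \<open>b\<close> by \<open>at_hit_below\<close>; the second path is therefore meant to start from
  \<open>b\<close>. A path that never goes below \<open>b\<close> is never left.\<close>

definition conc :: "(real \<Rightarrow> 'w \<Rightarrow> real) \<Rightarrow> real \<Rightarrow> (real \<Rightarrow> 'v \<Rightarrow> real) \<Rightarrow> real \<Rightarrow> 'w \<times> 'v \<Rightarrow> real" where
  "conc X b X' t = (\<lambda>(\<omega>, \<omega>'). if ennreal t < hit_below X b \<omega> then X t \<omega>
     else X' (t - enn2real (hit_below X b \<omega>)) \<omega>')"

text \<open>\<open>None\<close> stands for the passage time itself and \<open>Some u\<close> for the path at time \<open>u\<close>, stopped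
  at the passage time.\<close>

definition past_index :: "real option set" where
  "past_index = insert None (Some ` {0..})"

text \<open>Together with \<open>rights\<close> this separates a product over past and future
  coordinates into a past factor and a future factor.\<close>

fun lefts :: "(('a + 'b) \<times> 'f) list \<Rightarrow> ('a \<times> 'f) list" where
  "lefts [] = []" | "lefts ((Inl i, f) # l) = (i, f) # lefts l" | "lefts ((Inr i, f) # l) = lefts l"

fun rights :: "(('a + 'b) \<times> 'f) list \<Rightarrow> ('b \<times> 'f) list" where
  "rights [] = []" | "rights ((Inl i, f) # l) = rights l" | "rights ((Inr i, f) # l) = (i, f) # rights l"

lemma ok_list_lefts: "ok_list (A <+> B) K l \<Longrightarrow> ok_list A K (lefts l)"
  by (induction l rule: lefts.induct) auto

lemma ok_list_rights: "ok_list (A <+> B) K l \<Longrightarrow> ok_list B K (rights l)"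
  by (induction l rule: rights.induct) auto

lemma prod_eval_lefts_rights:
  "prod_eval W \<omega> l = prod_eval (\<lambda>i. W (Inl i)) \<omega> (lefts l) * prod_eval (\<lambda>i. W (Inr i)) \<omega> (rights l)"
  by (induction l rule: lefts.induct) (auto simp: ac_simps)

locale path_proc = feller_proc +
  assumes cadlag_paths: "\<And>x \<omega>. x \<ge> 0 \<Longrightarrow> \<omega> \<in> space (Px x) \<Longrightarrow> cadlag (\<lambda>t. X t \<omega>)"
    and no_neg_jumps: "\<And>x \<omega>. x \<ge> 0 \<Longrightarrow> \<omega> \<in> space (Px x) \<Longrightarrow> no_negative_jumps (\<lambda>t. X t \<omega>)"
begin

lemma X_rcont: "x \<ge> 0 \<Longrightarrow> \<omega> \<in> space (Px x) \<Longrightarrow> rcont (\<lambda>t. X t \<omega>)"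
  using cadlag_rcont cadlag_paths by blast

lemma hit_measurable: "x \<ge> 0 \<Longrightarrow> hit_below X b \<in> borel_measurable (Px x)"
  by (intro hit_below_measurable X_measurable X_rcont)

definition past :: "real \<Rightarrow> real option \<Rightarrow> 'a \<Rightarrow> real" where
  "past \<theta> i \<omega> = (case i of None \<Rightarrow> \<theta> | Some u \<Rightarrow> X (min u \<theta>) \<omega>)"

text \<open>Arbitrary functionals of the path on \<open>[0,q]\<close> are needed, since the value of
  a passage time is not a finite product. The future factor and its conditional expectation are
  taken as densities; by \<open>markov_property\<close> the path on \<open>[0,q]\<close> has the
  same law under both weighted measures.\<close>

lemma markov_past:
  assumes x: "x \<ge> 0" and q: "q \<ge> 0" and l: "ok_list {0..} unit_fns l"
    and h: "h \<in> borel_measurable (PiM {0..q} (\<lambda>_. borel))"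
  shows "(\<integral>\<^sup>+\<omega>. h (\<lambda>i\<in>{0..q}. X i \<omega>) * prod_eval (\<lambda>t. X (q + t)) \<omega> l \<partial>Px x)
       = (\<integral>\<^sup>+\<omega>. h (\<lambda>i\<in>{0..q}. X i \<omega>) * expect_from l (X q \<omega>) \<partial>Px x)"
proof -
  interpret prob_space "Px x" using prob x by simp
  define f1 where "f1 \<omega> = prod_eval (\<lambda>t. X (q + t)) \<omega> l" for \<omega>
  define f2 where "f2 \<omega> = expect_from l (X q \<omega>)" for \<omega>
  have m1[measurable]: "f1 \<in> borel_measurable (Px x)"
    unfolding f1_def[abs_def] using l x q by (intro prod_eval_measurable[where I="{0..}"] X_measurable) auto
  have e: "expect_from l \<in> borel_measurable borel" "\<And>y. expect_from l y \<le> 1"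
    using expect_from_unit_fns[OF l] by (auto simp: unit_fns_def)
  have m2[measurable]: "f2 \<in> borel_measurable (Px x)"
    unfolding f2_def[abs_def] using X_measurable[OF x q] e(1) by (rule measurable_compose)
  have fin: "finite_measure (density (Px x) f1)" "finite_measure (density (Px x) f2)"
    by (rule finite_measure_density_le_1[OF finite_measure_axioms]; simp add: f1_def f2_def prod_eval_le_1[OF l] e m1[unfolded f1_def] m2[unfolded f2_def])+
  have Xm: "X i \<in> borel_measurable (density (Px x) f1)" "X i \<in> borel_measurable (density (Px x) f2)"
    if "i \<in> {0..q}" for i
    using that x X_measurable by auto
  have "(\<integral>\<^sup>+\<omega>. h (\<lambda>i\<in>{0..q}. X i \<omega>) \<partial>density (Px x) f1) = (\<integral>\<^sup>+\<omega>. h (\<lambda>i\<in>{0..q}. X i \<omega>) \<partial>density (Px x) f2)"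
  proof (rule law_integral_eq[OF fin Xm])
    fix p assume p: "ok_list {0..q} cont_fns p"
    then have pu: "ok_list {0..q} unit_fns p" using cont_fns_unit by (rule ok_list_mono)
    have pm: "(\<lambda>\<omega>. prod_eval X \<omega> p) \<in> borel_measurable (Px x)"
      using pu x by (intro prod_eval_measurable[where I="{0..q}"] X_measurable) auto
    show "(\<integral>\<^sup>+\<omega>. prod_eval X \<omega> p \<partial>density (Px x) f1) = (\<integral>\<^sup>+\<omega>. prod_eval X \<omega> p \<partial>density (Px x) f2)"
      using markov_property[OF x q pu l] pm
      by (simp add: nn_integral_density f1_def[symmetric] f2_def[symmetric] mult.commute)
  qed (use h in auto)
  moreover have "(\<lambda>\<omega>. h (\<lambda>i\<in>{0..q}. X i \<omega>)) \<in> borel_measurable (Px x)"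
    using h x X_measurable by (intro measurable_compose[OF measurable_restrict]) auto
  ultimately show ?thesis
    by (simp add: nn_integral_density f1_def[symmetric] f2_def[symmetric] mult.commute)
qed

lemma past_measurable:
  assumes x: "x \<ge> 0" and i: "i \<in> past_index"
    and \<theta>: "\<theta> \<in> borel_measurable (Px x)" "\<And>\<omega>. \<omega> \<in> space (Px x) \<Longrightarrow> \<theta> \<omega> \<ge> 0"
  shows "(\<lambda>\<omega>. past (\<theta> \<omega>) i \<omega>) \<in> borel_measurable (Px x)"
proof (cases i)
  case None
  then show ?thesis using \<theta> by (simp add: past_def)
next
  case (Some u)
  then have "u \<ge> 0" using i by (auto simp: past_index_def)
  then have "(\<lambda>\<omega>. X (min u (\<theta> \<omega>)) \<omega>) \<in> borel_measurable (Px x)"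
    using x \<theta> by (intro rcont_eval_measurable[where Y=X and \<theta>="\<lambda>\<omega>. min u (\<theta> \<omega>)"]) (auto intro: X_measurable X_rcont)
  then show ?thesis by (simp add: past_def Some)
qed

lemma future_measurable:
  assumes x: "x \<ge> 0" and s: "s \<in> {0..}"
    and \<theta>: "\<theta> \<in> borel_measurable (Px x)" "\<And>\<omega>. \<omega> \<in> space (Px x) \<Longrightarrow> \<theta> \<omega> \<ge> 0"
  shows "(\<lambda>\<omega>. X (\<theta> \<omega> + s) \<omega>) \<in> borel_measurable (Px x)"
  using assms by (intro rcont_eval_measurable[where Y=X and \<theta>="\<lambda>\<omega>. \<theta> \<omega> + s"]) (auto intro: X_measurable X_rcont)

text \<open>The discretised passage time takes countably many values \<open>q k\<close>. On the
  event of each value it is a constant, and the Markov property at the deterministic time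
  \<open>q k\<close> applies.\<close>

lemma strong_markov_grid:
  fixes m :: nat and b :: real
  assumes x: "x \<ge> 0" and p: "ok_list past_index unit_fns p" and l: "ok_list {0..} unit_fns l"
  defines "\<theta> \<equiv> \<lambda>\<omega>. grid m (enn2real (hit_below X b \<omega>))"
  shows "(\<integral>\<^sup>+\<omega>. indicator {\<omega>. hit_below X b \<omega> < \<infinity>} \<omega> *
            (prod_eval (past (\<theta> \<omega>)) \<omega> p * prod_eval (\<lambda>s. X (\<theta> \<omega> + s)) \<omega> l) \<partial>Px x)
       = (\<integral>\<^sup>+\<omega>. indicator {\<omega>. hit_below X b \<omega> < \<infinity>} \<omega> *
            (prod_eval (past (\<theta> \<omega>)) \<omega> p * expect_from l (X (\<theta> \<omega>) \<omega>)) \<partial>Px x)"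
proof -
  define d where "d = real (Suc m)"
  have d: "d > 0" by (simp add: d_def)
  define q where "q k = (real k + 1) / d" for k
  \<comment> \<open>Both conditions compare the passage time strictly with a bound of at most
    \<open>q k\<close>, so rational times before \<open>q k\<close> decide them.\<close>
  define E where "E k = {\<omega>. hit_below X b \<omega> < ennreal (q k) \<and> \<not> hit_below X b \<omega> < ennreal (real k / d)}" for k
  have q0: "q k \<ge> 0" for k using d by (simp add: q_def)
  note [measurable] = hit_measurable[OF x, of b]
  have split: "indicator {\<omega>. hit_below X b \<omega> < \<infinity>} \<omega> * \<Phi> (\<theta> \<omega>) = (\<Sum>k. indicator (E k) \<omega> * \<Phi> (q k))"
    for \<Phi> :: "real \<Rightarrow> ennreal" and \<omega>
  proof (cases "hit_below X b \<omega>")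
    case top
    then show ?thesis by (simp add: E_def)
  next
    case (real t)
    define k0 where "k0 = nat \<lfloor>d * t\<rfloor>"
    have "\<omega> \<in> E k \<longleftrightarrow> k = k0" for k
    proof -
      have "\<omega> \<in> E k \<longleftrightarrow> t < q k \<and> real k / d \<le> t"
        using real d q0 by (simp add: E_def ennreal_less_iff not_less)
      also have "\<dots> \<longleftrightarrow> d * t < real k + 1 \<and> real k \<le> d * t"
        using d by (simp add: q_def pos_less_divide_eq pos_divide_le_eq mult.commute)
      also have "\<dots> \<longleftrightarrow> \<lfloor>d * t\<rfloor> = int k" by (auto simp: floor_eq_iff)
      also have "\<dots> \<longleftrightarrow> k = k0" using d real by (auto simp: k0_def)
      finally show ?thesis .
    qed
    then have "(\<lambda>k. indicator (E k) \<omega> * \<Phi> (q k)) = (\<lambda>k. if k = k0 then \<Phi> (q k) else 0)"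
      by (auto simp: indicator_def)
    then have "(\<Sum>k. indicator (E k) \<omega> * \<Phi> (q k)) = \<Phi> (q k0)"
      using sums_unique[OF sums_single[of k0 "\<lambda>k. \<Phi> (q k)"]] by simp
    moreover have "\<theta> \<omega> = q k0"
      using real d by (simp add: \<theta>_def grid_def q_def k0_def d_def)
    ultimately show ?thesis using real by simp
  qed
  have [measurable]: "E k \<inter> space (Px x) \<in> sets (Px x)" for k
  proof -
    have "{\<omega>\<in>space (Px x). hit_below X b \<omega> < ennreal (q k) \<and> \<not> hit_below X b \<omega> < ennreal (real k / d)} \<in> sets (Px x)"
      by measurable
    then show ?thesis by (simp add: E_def Int_def conj_commute)
  qed
  have Em: "(indicator (E k) :: _ \<Rightarrow> ennreal) \<in> borel_measurable (Px x)" for k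
    by (rule borel_measurable_indicator') (use \<open>E k \<inter> space (Px x) \<in> sets (Px x)\<close> in \<open>simp add: Int_def conj_commute\<close>)
  have Pm: "(\<lambda>\<omega>. prod_eval (past (q k)) \<omega> p) \<in> borel_measurable (Px x)" for k
    using x q0 by (intro prod_eval_measurable[OF _ p] past_measurable) auto
  have Rm: "(\<lambda>\<omega>. prod_eval (\<lambda>s. X (q k + s)) \<omega> l) \<in> borel_measurable (Px x)" for k
    using x q0 by (intro prod_eval_measurable[OF _ l] X_measurable) auto
  have Km: "(\<lambda>\<omega>. expect_from l (X (q k) \<omega>)) \<in> borel_measurable (Px x)" for k
    using X_measurable[OF x q0] expect_from_unit_fns[OF l] by (auto simp: unit_fns_def intro: measurable_compose)
  have main: "(\<integral>\<^sup>+\<omega>. indicator (E k) \<omega> * (prod_eval (past (q k)) \<omega> p * prod_eval (\<lambda>s. X (q k + s)) \<omega> l) \<partial>Px x)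
     = (\<integral>\<^sup>+\<omega>. indicator (E k) \<omega> * (prod_eval (past (q k)) \<omega> p * expect_from l (X (q k) \<omega>)) \<partial>Px x)" for k
  proof -
    define S where "S = PiM {0..q k} (\<lambda>_. borel :: real measure)"
    \<comment> \<open>The event of a passage before \<open>u\<close>, expressed on the product over
      \<open>[0,q k]\<close> through countably many coordinates.\<close>
    define B where "B u = {w\<in>space S. \<exists>s\<in>{s\<in>\<rat>. 0 \<le> s \<and> s < u}. w s < b}" for u
    define h where "h w = indicator (B (q k) - B (real k / d)) w *
       prod_eval (\<lambda>i w. case i of None \<Rightarrow> q k | Some u \<Rightarrow> w (min u (q k))) w p" for w
    have Bs: "B u \<in> sets S" if "u \<le> q k" for u
      unfolding B_def using that
      by (intro sets_hits[where I="{0..q k}" and U="\<lambda>s w. w s"])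
         (auto intro: countable_rat_subset simp: S_def)
    have le: "real k / d \<le> q k" using d by (simp add: q_def divide_right_mono)
    have hm: "h \<in> borel_measurable S"
    proof -
      have "(\<lambda>w. prod_eval (\<lambda>i w. case i of None \<Rightarrow> q k | Some u \<Rightarrow> w (min u (q k))) w p) \<in> borel_measurable S"
        using q0[of k]
        by (intro prod_eval_measurable[OF _ p])
           (auto simp: S_def past_index_def split: option.split intro!: measurable_component_singleton)
      then show ?thesis
        unfolding h_def[abs_def] using Bs[of "q k"] Bs[OF le] by (intro borel_measurable_times_ennreal borel_measurable_indicator) auto
    qed
    have hX: "h (\<lambda>i\<in>{0..q k}. X i \<omega>) = indicator (E k) \<omega> * prod_eval (past (q k)) \<omega> p"
      if w: "\<omega> \<in> space (Px x)" for \<omega>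
    proof -
      have B: "(\<lambda>i\<in>{0..q k}. X i \<omega>) \<in> B u \<longleftrightarrow> hit_below X b \<omega> < ennreal u" if "u \<le> q k" for u
        using that hit_below_less_iff[of X \<omega> b "ennreal u", OF X_rcont[OF x w]]
        by (auto simp: B_def S_def space_PiM ennreal_less_iff)
      have "prod_eval (\<lambda>i w. case i of None \<Rightarrow> q k | Some u \<Rightarrow> w (min u (q k))) (\<lambda>i\<in>{0..q k}. X i \<omega>) p = prod_eval (past (q k)) \<omega> p"
        using p
      proof (induction p)
        case (Cons a p)
        obtain i f where a: "a = (i, f)" by (cases a)
        have "(case i of None \<Rightarrow> q k | Some u \<Rightarrow> (\<lambda>i\<in>{0..q k}. X i \<omega>) (min u (q k))) = past (q k) i \<omega>"
          using Cons.prems q0[of k] by (auto simp: a past_def past_index_def split: option.split)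
        moreover have "ok_list past_index unit_fns p" using Cons.prems by (simp add: a)
        ultimately show ?case by (simp only: a prod_eval_simps Cons.IH)
      qed simp
      moreover have "indicator (B (q k) - B (real k / d)) (\<lambda>i\<in>{0..q k}. X i \<omega>) = (indicator (E k) \<omega> :: ennreal)"
        using B[of "q k"] B[OF le] by (simp add: indicator_def E_def)
      ultimately show ?thesis by (simp add: h_def)
    qed
    have "(\<integral>\<^sup>+\<omega>. indicator (E k) \<omega> * (prod_eval (past (q k)) \<omega> p * prod_eval (\<lambda>s. X (q k + s)) \<omega> l) \<partial>Px x)
       = (\<integral>\<^sup>+\<omega>. h (\<lambda>i\<in>{0..q k}. X i \<omega>) * prod_eval (\<lambda>s. X (q k + s)) \<omega> l \<partial>Px x)"
      by (intro nn_integral_cong) (simp add: hX mult.assoc)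
    also have "\<dots> = (\<integral>\<^sup>+\<omega>. h (\<lambda>i\<in>{0..q k}. X i \<omega>) * expect_from l (X (q k) \<omega>) \<partial>Px x)"
      using hm unfolding S_def by (intro markov_past x q0 l)
    also have "\<dots> = (\<integral>\<^sup>+\<omega>. indicator (E k) \<omega> * (prod_eval (past (q k)) \<omega> p * expect_from l (X (q k) \<omega>)) \<partial>Px x)"
      by (intro nn_integral_cong) (simp add: hX mult.assoc)
    finally show ?thesis .
  qed
  show ?thesis
    unfolding split[of _ "\<lambda>\<theta>. prod_eval (past \<theta>) _ p * prod_eval (\<lambda>s. X (\<theta> + s)) _ l"]
      split[of _ "\<lambda>\<theta>. prod_eval (past \<theta>) _ p * expect_from l (X \<theta> _)"]
    using Em Pm Rm Km main by (subst (1 2) nn_integral_suminf) auto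
qed

text \<open>The discretised identity passes to the limit, since all factors are continuous functions
  of right-continuous evaluations. At the passage time the path is at \<open>b\<close>, so the
  conditional expectation of the future is a constant: the future is independent of the stopped
  path.\<close>

lemma strong_markov:
  assumes b: "0 \<le> b" "b \<le> x" and p: "ok_list past_index cont_fns p" and l: "ok_list {0..} cont_fns l"
  defines "\<theta> \<equiv> \<lambda>\<omega>. enn2real (hit_below X b \<omega>)"
  shows "(\<integral>\<^sup>+\<omega>. indicator {\<omega>. hit_below X b \<omega> < \<infinity>} \<omega> *
            (prod_eval (past (\<theta> \<omega>)) \<omega> p * prod_eval (\<lambda>s. X (\<theta> \<omega> + s)) \<omega> l) \<partial>Px x)
       = (\<integral>\<^sup>+\<omega>. indicator {\<omega>. hit_below X b \<omega> < \<infinity>} \<omega> * prod_eval (past (\<theta> \<omega>)) \<omega> p \<partial>Px x) * expect_from l b"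
proof -
  have x: "x \<ge> 0" using b by simp
  interpret prob_space "Px x" using prob x by simp
  define F where "F = {\<omega>. hit_below X b \<omega> < \<infinity>}"
  define K where "K = expect_from l"
  define P where "P \<eta> \<omega> = prod_eval (past (\<eta> \<omega>)) \<omega> p" for \<eta> \<omega>
  define R where "R \<eta> \<omega> = prod_eval (\<lambda>s. X (\<eta> \<omega> + s)) \<omega> l" for \<eta> \<omega>
  define g where "g m \<omega> = grid m (\<theta> \<omega>)" for m \<omega>
  have pu: "ok_list past_index unit_fns p" and lu: "ok_list {0..} unit_fns l"
    using p l cont_fns_unit by (auto intro: ok_list_mono)
  have K: "K \<in> cont_fns" "K \<in> unit_fns" unfolding K_def using l lu by (auto intro: expect_from_cont_fns expect_from_unit_fns)
  have le1: "P \<eta> \<omega> \<le> 1" "R \<eta> \<omega> \<le> 1" "K y \<le> 1" for \<eta> \<omega> y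
    unfolding P_def R_def using prod_eval_le_1[OF pu] prod_eval_le_1[OF lu] K(2) by (auto simp: unit_fns_def)
  note [measurable] = hit_measurable[OF x, of b]
  have \<theta>m[measurable]: "\<theta> \<in> borel_measurable (Px x)" unfolding \<theta>_def by measurable
  have \<theta>0: "\<theta> \<omega> \<ge> 0" for \<omega> by (simp add: \<theta>_def)
  have g0: "g m \<omega> \<ge> 0" for m \<omega> using grid_gt[of "\<theta> \<omega>" m] \<theta>0[of \<omega>] by (simp add: g_def)
  have gm: "g m \<in> borel_measurable (Px x)" for m unfolding g_def[abs_def] by measurable
  have Fm[measurable]: "(indicator F :: _ \<Rightarrow> ennreal) \<in> borel_measurable (Px x)"
    unfolding F_def by (rule borel_measurable_indicator') measurable
  have Pm: "P \<eta> \<in> borel_measurable (Px x)" and Rm: "R \<eta> \<in> borel_measurable (Px x)"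
    and Km: "(\<lambda>\<omega>. K (X (\<eta> \<omega>) \<omega>)) \<in> borel_measurable (Px x)"
    if \<eta>: "\<eta> \<in> borel_measurable (Px x)" "\<And>\<omega>. \<eta> \<omega> \<ge> 0" for \<eta>
  proof -
    have "(\<lambda>\<omega>. prod_eval (\<lambda>i \<omega>. past (\<eta> \<omega>) i \<omega>) \<omega> p) \<in> borel_measurable (Px x)"
      using x \<eta> by (intro prod_eval_measurable[OF _ pu] past_measurable) auto
    then show "P \<eta> \<in> borel_measurable (Px x)" by (simp add: P_def[abs_def] prod_eval_def)
    have "(\<lambda>\<omega>. prod_eval (\<lambda>s \<omega>. X (\<eta> \<omega> + s) \<omega>) \<omega> l) \<in> borel_measurable (Px x)"
      using x \<eta> by (intro prod_eval_measurable[OF _ lu] future_measurable) auto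
    then show "R \<eta> \<in> borel_measurable (Px x)" by (simp add: R_def[abs_def] prod_eval_def)
    have "(\<lambda>\<omega>. X (\<eta> \<omega> + 0) \<omega>) \<in> borel_measurable (Px x)"
      using x \<eta> by (intro future_measurable) auto
    then show "(\<lambda>\<omega>. K (X (\<eta> \<omega>) \<omega>)) \<in> borel_measurable (Px x)"
      using K(2) by (auto simp: unit_fns_def intro: measurable_compose)
  qed
  have limP: "(\<lambda>m. P (g m) \<omega>) \<longlonglongrightarrow> P \<theta> \<omega>" if w: "\<omega> \<in> space (Px x)" for \<omega>
    unfolding P_def g_def
  proof (rule prod_eval_tendsto[OF p])
    fix i assume i: "i \<in> past_index"
    show "(\<lambda>m. past (grid m (\<theta> \<omega>)) i \<omega>) \<longlonglongrightarrow> past (\<theta> \<omega>) i \<omega>"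
    proof (cases i)
      case None
      then show ?thesis using grid_at_right[of "\<theta> \<omega>"] by (simp add: past_def filterlim_at)
    next
      case (Some u)
      then show ?thesis using i rcont_grid_min[OF X_rcont[OF x w] \<theta>0[of \<omega>], of u] by (auto simp: past_def past_index_def)
    qed
  qed
  \<comment> \<open>One dominated convergence statement, used for the future product and for its
    conditional expectation.\<close>
  have conv: "(\<lambda>m. \<integral>\<^sup>+\<omega>. indicator F \<omega> * (P (g m) \<omega> * r m \<omega>) \<partial>Px x) \<longlonglongrightarrow> (\<integral>\<^sup>+\<omega>. indicator F \<omega> * (P \<theta> \<omega> * r' \<omega>) \<partial>Px x)"
    if [measurable]: "\<And>m. r m \<in> borel_measurable (Px x)" "r' \<in> borel_measurable (Px x)"
      and r: "\<And>m \<omega>. r m \<omega> \<le> 1" "\<And>\<omega>. r' \<omega> \<le> 1"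
      and lim: "\<And>\<omega>. \<omega> \<in> space (Px x) \<Longrightarrow> (\<lambda>m. r m \<omega>) \<longlonglongrightarrow> r' \<omega>" for r r'
  proof (rule nn_integral_dominated_convergence[where w="\<lambda>_. 1"])
    note [measurable] = Pm[OF gm g0] Pm[OF \<theta>m \<theta>0]
    show "(\<lambda>\<omega>. indicator F \<omega> * (P (g m) \<omega> * r m \<omega>)) \<in> borel_measurable (Px x)" for m by measurable
    show "(\<lambda>\<omega>. indicator F \<omega> * (P \<theta> \<omega> * r' \<omega>)) \<in> borel_measurable (Px x)" by measurable
    show "AE \<omega> in Px x. indicator F \<omega> * (P (g m) \<omega> * r m \<omega>) \<le> 1" for m
    proof (rule AE_I2)
      fix \<omega>
      have "P (g m) \<omega> * r m \<omega> \<le> 1" using mult_mono[OF le1(1)[of "g m" \<omega>] r(1)[of m \<omega>]] by simp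
      then show "indicator F \<omega> * (P (g m) \<omega> * r m \<omega>) \<le> 1" by (simp split: split_indicator)
    qed
    show "AE \<omega> in Px x. (\<lambda>m. indicator F \<omega> * (P (g m) \<omega> * r m \<omega>)) \<longlonglongrightarrow> indicator F \<omega> * (P \<theta> \<omega> * r' \<omega>)"
    proof (rule AE_I2)
      fix \<omega> assume w: "\<omega> \<in> space (Px x)"
      have "P \<theta> \<omega> \<noteq> \<infinity>" "r' \<omega> \<noteq> \<infinity>" using le1(1)[of \<theta> \<omega>] r(2)[of \<omega>] by (auto simp: top_unique)
      then have "(\<lambda>m. P (g m) \<omega> * r m \<omega>) \<longlonglongrightarrow> P \<theta> \<omega> * r' \<omega>"
        using limP[OF w] lim[OF w] by (intro tendsto_mult_ennreal) auto
      then show "(\<lambda>m. indicator F \<omega> * (P (g m) \<omega> * r m \<omega>)) \<longlonglongrightarrow> indicator F \<omega> * (P \<theta> \<omega> * r' \<omega>)"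
        by (simp split: split_indicator)
    qed
  qed (auto simp: emeasure_space_1)
  have "(\<lambda>m. \<integral>\<^sup>+\<omega>. indicator F \<omega> * (P (g m) \<omega> * R (g m) \<omega>) \<partial>Px x) \<longlonglongrightarrow> (\<integral>\<^sup>+\<omega>. indicator F \<omega> * (P \<theta> \<omega> * R \<theta> \<omega>) \<partial>Px x)"
  proof (rule conv)
    fix \<omega> assume w: "\<omega> \<in> space (Px x)"
    show "(\<lambda>m. R (g m) \<omega>) \<longlonglongrightarrow> R \<theta> \<omega>"
      unfolding R_def g_def using rcont_grid_shift[OF X_rcont[OF x w] \<theta>0[of \<omega>]] by (intro prod_eval_tendsto[OF l]) auto
  qed (use Rm[OF gm g0] Rm[OF \<theta>m \<theta>0] le1 in auto)
  moreover have "(\<lambda>m. \<integral>\<^sup>+\<omega>. indicator F \<omega> * (P (g m) \<omega> * K (X (g m \<omega>) \<omega>)) \<partial>Px x)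
     \<longlonglongrightarrow> (\<integral>\<^sup>+\<omega>. indicator F \<omega> * (P \<theta> \<omega> * K (X (\<theta> \<omega>) \<omega>)) \<partial>Px x)"
  proof (rule conv)
    fix \<omega> assume w: "\<omega> \<in> space (Px x)"
    show "(\<lambda>m. K (X (g m \<omega>) \<omega>)) \<longlonglongrightarrow> K (X (\<theta> \<omega>) \<omega>)"
      unfolding g_def using rcont_grid[OF X_rcont[OF x w] \<theta>0[of \<omega>]] by (rule cont_fns_tendsto[OF K(1)])
  qed (use Km[OF gm g0] Km[OF \<theta>m \<theta>0] le1 in auto)
  moreover have "(\<integral>\<^sup>+\<omega>. indicator F \<omega> * (P (g m) \<omega> * R (g m) \<omega>) \<partial>Px x)
     = (\<integral>\<^sup>+\<omega>. indicator F \<omega> * (P (g m) \<omega> * K (X (g m \<omega>) \<omega>)) \<partial>Px x)" for m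
    unfolding F_def P_def R_def K_def g_def \<theta>_def by (rule strong_markov_grid[OF x pu lu])
  ultimately have "(\<integral>\<^sup>+\<omega>. indicator F \<omega> * (P \<theta> \<omega> * R \<theta> \<omega>) \<partial>Px x)
     = (\<integral>\<^sup>+\<omega>. indicator F \<omega> * (P \<theta> \<omega> * K (X (\<theta> \<omega>) \<omega>)) \<partial>Px x)"
    by (simp add: LIMSEQ_unique)
  \<comment> \<open>Here \<open>at_hit_below\<close> replaces the random position by the level
    \<open>b\<close>.\<close>
  also have "\<dots> = (\<integral>\<^sup>+\<omega>. (indicator F \<omega> * P \<theta> \<omega>) * K b \<partial>Px x)"
  proof (rule nn_integral_cong_AE, rule AE_mp[OF X_0[OF x]], intro AE_I2 impI)
    fix \<omega> assume w: "\<omega> \<in> space (Px x)" and "X 0 \<omega> = x"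
    then have "hit_below X b \<omega> < \<infinity> \<Longrightarrow> X (\<theta> \<omega>) \<omega> = b"
      unfolding \<theta>_def using b x by (intro at_hit_below cadlag_paths no_neg_jumps) auto
    then show "indicator F \<omega> * (P \<theta> \<omega> * K (X (\<theta> \<omega>) \<omega>)) = indicator F \<omega> * P \<theta> \<omega> * K b"
      by (auto simp: F_def mult.assoc split: split_indicator)
  qed
  also have "\<dots> = (\<integral>\<^sup>+\<omega>. indicator F \<omega> * P \<theta> \<omega> \<partial>Px x) * K b"
    using Fm Pm[OF \<theta>m \<theta>0] by (intro nn_integral_multc) auto
  finally show ?thesis by (simp add: F_def K_def P_def R_def)
qed

end

subsection \<open>Concatenation at a first passage time\<close>

lemma prod_eval_cong:
  assumes "ok_list I K l" "\<And>i. i \<in> I \<Longrightarrow> U i w = V i w'"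
  shows "prod_eval U w l = prod_eval V w' l"
  using assms by (induction l) auto

lemma conc_nonneg_arg:
  assumes "\<not> ennreal t < hit_below X b \<omega>" "t \<ge> 0"
  shows "enn2real (hit_below X b \<omega>) \<le> t" "hit_below X b \<omega> < \<infinity>"
proof -
  have "hit_below X b \<omega> \<le> ennreal t" using assms by simp
  then show "hit_below X b \<omega> < \<infinity>" "enn2real (hit_below X b \<omega>) \<le> t"
    using assms by (auto simp: less_top[symmetric] top_unique intro!: enn2real_leI)
qed

text \<open>For \<open>t \<ge> 0\<close> the truncation changes nothing, but it makes the time
  argument nonnegative everywhere, as \<open>rcont_eval_measurable\<close> requires.\<close>

lemma conc_max:
  "t \<ge> 0 \<Longrightarrow> conc X b X' t = (\<lambda>(\<omega>, \<omega>'). if ennreal t < hit_below X b \<omega> then X t \<omega>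
     else X' (max 0 (t - enn2real (hit_below X b \<omega>))) \<omega>')"
  using conc_nonneg_arg[of t X b] by (auto simp: conc_def fun_eq_iff max_def)

context path_proc
begin

definition same_law :: "'b measure \<Rightarrow> (real \<Rightarrow> 'b \<Rightarrow> real) \<Rightarrow> real \<Rightarrow> bool" where
  "same_law M' X' y \<longleftrightarrow> (\<forall>l. ok_list {0..} cont_fns l \<longrightarrow> (\<integral>\<^sup>+\<omega>. prod_eval X' \<omega> l \<partial>M') = expect_from l y)"

lemma conc_measurable:
  fixes M' :: "'b measure"
  assumes x: "x \<ge> 0" and X': "\<And>t. t \<ge> 0 \<Longrightarrow> X' t \<in> borel_measurable M'"
    and rc: "\<And>\<omega>. \<omega> \<in> space M' \<Longrightarrow> rcont (\<lambda>t. X' t \<omega>)" and t: "t \<ge> 0"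
  shows "conc X b X' t \<in> borel_measurable (Px x \<Otimes>\<^sub>M M')"
proof -
  note [measurable] = hit_measurable[OF x, of b] X_measurable[OF x t]
  have [measurable]: "(\<lambda>p. X' (max 0 (t - enn2real (hit_below X b (fst p)))) (snd p)) \<in> borel_measurable (Px x \<Otimes>\<^sub>M M')"
    by (rule rcont_eval_measurable[where Y="\<lambda>t p. X' t (snd p)" and \<theta>="\<lambda>p. max 0 (t - enn2real (hit_below X b (fst p)))"])
       (auto intro!: measurable_compose[OF measurable_snd] X' rc simp: space_pair_measure)
  show ?thesis unfolding conc_max[OF t] case_prod_unfold by measurable
qed

text \<open>On the event of a finite passage time, \<open>strong_markov\<close> says that passage
  time, stopped path and future have the joint law obtained when the future is replaced by an
  independent path from \<open>b\<close>. The original path and \<open>conc\<close> are the same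
  measurable function of these data, so their laws agree there; elsewhere \<open>conc\<close> is the
  original path.\<close>

lemma conc_law:
  fixes M' :: "'b measure"
  assumes b: "0 \<le> b" "b \<le> x" and pM: "prob_space M'"
    and X': "\<And>t. t \<ge> 0 \<Longrightarrow> X' t \<in> borel_measurable M'"
    and rc: "\<And>\<omega>. \<omega> \<in> space M' \<Longrightarrow> rcont (\<lambda>t. X' t \<omega>)"
    and law: "same_law M' X' b"
  shows "same_law (Px x \<Otimes>\<^sub>M M') (conc X b X') x"
  unfolding same_law_def
proof (intro allI impI)
  fix l :: "(real \<times> (real \<Rightarrow> ennreal)) list" assume l: "ok_list {0..} cont_fns l"
  have lu: "ok_list {0..} unit_fns l" using l cont_fns_unit by (rule ok_list_mono)
  have x: "x \<ge> 0" using b by simp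
  interpret P: prob_space "Px x" using prob x by simp
  interpret M': prob_space M' by fact
  interpret PM: pair_prob_space "Px x" M' ..
  note [measurable] = hit_measurable[OF x, of b]
  define \<theta> where "\<theta> \<omega> = enn2real (hit_below X b \<omega>)" for \<omega>
  have \<theta>m[measurable]: "\<theta> \<in> borel_measurable (Px x)" unfolding \<theta>_def[abs_def] by measurable
  have \<theta>0: "\<theta> \<omega> \<ge> 0" for \<omega> by (simp add: \<theta>_def)
  define F where "F = {\<omega>. hit_below X b \<omega> < \<infinity>}"
  have Fm[measurable]: "(indicator F :: _ \<Rightarrow> ennreal) \<in> borel_measurable (Px x)"
    unfolding F_def by (rule borel_measurable_indicator') measurable
  have Fcm[measurable]: "(indicator (- F) :: _ \<Rightarrow> ennreal) \<in> borel_measurable (Px x)"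
  proof -
    have "- F = {\<omega>. \<not> hit_below X b \<omega> < \<infinity>}" by (auto simp: F_def)
    then show ?thesis by (simp only:) (rule borel_measurable_indicator', measurable)
  qed
  define I where "I = past_index <+> {0::real..}"
  have I_simps: "Inl None \<in> I" "\<And>t. t \<ge> 0 \<Longrightarrow> Inl (Some t) \<in> I" "\<And>s. s \<ge> 0 \<Longrightarrow> Inr s \<in> I"
    by (auto simp: I_def past_index_def)
  define W where "W i \<omega> = (case i of Inl j \<Rightarrow> past (\<theta> \<omega>) j \<omega> | Inr s \<Rightarrow> X (\<theta> \<omega> + s) \<omega>)" for i \<omega>
  define W' where "W' i p = (case i of Inl j \<Rightarrow> past (\<theta> (fst p)) j (fst p) | Inr s \<Rightarrow> X' s (snd p))" for i p
  \<comment> \<open>Restriction to the paths that do pass below \<open>b\<close>. These measures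
    need not have mass 1, but they are finite.\<close>
  define N1 where "N1 = density (Px x) (indicator F)"
  define N2 where "N2 = density (Px x \<Otimes>\<^sub>M M') (\<lambda>p. indicator F (fst p))"
  have fin: "finite_measure N1" "finite_measure N2"
    unfolding N1_def N2_def
    by (rule finite_measure_density_le_1, rule P.finite_measure_axioms PM.finite_measure_axioms,
        measurable, simp add: indicator_def)+
  have Wm: "W i \<in> borel_measurable (Px x)" if "i \<in> I" for i
    using that unfolding W_def[abs_def] I_def
    by (auto split: sum.split intro!: past_measurable future_measurable x \<theta>m \<theta>0)
  have W'm: "W' i \<in> borel_measurable (Px x \<Otimes>\<^sub>M M')" if "i \<in> I" for i
  proof (cases i)
    case (Inl j)
    have "(\<lambda>\<omega>. past (\<theta> \<omega>) j \<omega>) \<in> borel_measurable (Px x)"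
      using that Inl by (intro past_measurable x \<theta>m \<theta>0) (auto simp: I_def)
    then show ?thesis unfolding W'_def[abs_def] Inl sum.case by measurable
  next
    case (Inr s)
    then have "X' s \<in> borel_measurable M'" using that by (intro X') (auto simp: I_def)
    then show ?thesis unfolding W'_def[abs_def] Inr sum.case by measurable
  qed
  have joint: "(\<integral>\<^sup>+\<omega>. prod_eval W \<omega> k \<partial>N1) = (\<integral>\<^sup>+p. prod_eval W' p k \<partial>N2)" if k: "ok_list I cont_fns k" for k
  proof -
    have ok: "ok_list past_index cont_fns (lefts k)" "ok_list {0..} cont_fns (rights k)"
      using k ok_list_lefts ok_list_rights unfolding I_def by blast+
    have oku: "ok_list I unit_fns k" "ok_list past_index unit_fns (lefts k)" "ok_list {0..} unit_fns (rights k)"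
      using k ok cont_fns_unit by (auto intro: ok_list_mono)
    define A where "A \<omega> = indicator F \<omega> * prod_eval (past (\<theta> \<omega>)) \<omega> (lefts k)" for \<omega>
    define B where "B \<omega>' = prod_eval X' \<omega>' (rights k)" for \<omega>'
    have Am[measurable]: "A \<in> borel_measurable (Px x)"
    proof -
      have "(\<lambda>\<omega>. prod_eval (\<lambda>i \<omega>. past (\<theta> \<omega>) i \<omega>) \<omega> (lefts k)) \<in> borel_measurable (Px x)"
        by (intro prod_eval_measurable[OF _ oku(2)] past_measurable x \<theta>m \<theta>0)
      then show ?thesis unfolding A_def[abs_def] prod_eval_def by measurable
    qed
    have Bm[measurable]: "B \<in> borel_measurable M'"
      unfolding B_def[abs_def] by (intro prod_eval_measurable[OF _ oku(3)] X') auto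
    have "(\<integral>\<^sup>+\<omega>. prod_eval W \<omega> k \<partial>N1) = (\<integral>\<^sup>+\<omega>. indicator F \<omega> * prod_eval W \<omega> k \<partial>Px x)"
      unfolding N1_def by (intro nn_integral_density Fm prod_eval_measurable[OF Wm oku(1)])
    also have "\<dots> = (\<integral>\<^sup>+\<omega>. indicator F \<omega> *
            (prod_eval (past (\<theta> \<omega>)) \<omega> (lefts k) * prod_eval (\<lambda>s. X (\<theta> \<omega> + s)) \<omega> (rights k)) \<partial>Px x)"
      by (subst prod_eval_lefts_rights) (simp add: W_def prod_eval_def)
    also have "\<dots> = (\<integral>\<^sup>+\<omega>. A \<omega> \<partial>Px x) * expect_from (rights k) b"
      unfolding A_def F_def \<theta>_def by (rule strong_markov[OF b ok])
    also have "\<dots> = (\<integral>\<^sup>+\<omega>. A \<omega> \<partial>Px x) * (\<integral>\<^sup>+\<omega>'. B \<omega>' \<partial>M')"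
      using law ok by (simp add: same_law_def B_def)
    also have "\<dots> = (\<integral>\<^sup>+\<omega>. A \<omega> * (\<integral>\<^sup>+\<omega>'. B \<omega>' \<partial>M') \<partial>Px x)" by (simp add: nn_integral_multc)
    also have "\<dots> = (\<integral>\<^sup>+\<omega>. (\<integral>\<^sup>+\<omega>'. A \<omega> * B \<omega>' \<partial>M') \<partial>Px x)" by (simp add: nn_integral_cmult)
    also have "\<dots> = (\<integral>\<^sup>+p. A (fst p) * B (snd p) \<partial>(Px x \<Otimes>\<^sub>M M'))"
      using M'.nn_integral_fst[of "\<lambda>p. A (fst p) * B (snd p)" "Px x"] by simp
    also have "\<dots> = (\<integral>\<^sup>+p. indicator F (fst p) * prod_eval W' p k \<partial>(Px x \<Otimes>\<^sub>M M'))"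
      by (intro nn_integral_cong, subst prod_eval_lefts_rights)
         (simp add: W'_def A_def B_def prod_eval_def mult.assoc)
    also have "\<dots> = (\<integral>\<^sup>+p. prod_eval W' p k \<partial>N2)"
      unfolding N2_def by (intro nn_integral_density[symmetric] prod_eval_measurable[OF W'm oku(1)]) measurable
    finally show ?thesis .
  qed
  \<comment> \<open>Recovers the position at time \<open>t\<close> from passage time, stopped path
    and future. Evaluating the future at a random time is not evidently measurable on the
    uncountable product; a limit along \<open>grid m\<close> is, and right-continuity identifies it
    with the value.\<close>
  define glue where "glue t w = (if t < w (Inl None) then w (Inl (Some t))
      else lim (\<lambda>m. w (Inr (grid m (max 0 (t - w (Inl None)))))))" for t and w :: "real option + real \<Rightarrow> real"
  have grid0: "grid m u \<ge> 0" if "u \<ge> 0" for m u using grid_gt[of u m] that by simp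
  have glue_m: "glue t \<in> borel_measurable (PiM I (\<lambda>_. borel))" if t: "t \<ge> 0" for t
  proof -
    let ?S = "PiM I (\<lambda>_. borel :: real measure)"
    have [measurable]: "(\<lambda>w. w (Inl None)) \<in> borel_measurable ?S" "(\<lambda>w. w (Inl (Some t))) \<in> borel_measurable ?S"
      using t by (auto intro!: measurable_component_singleton simp: I_def past_index_def)
    have [measurable]: "(\<lambda>w. w (Inr (grid m (max 0 (t - w (Inl None)))))) \<in> borel_measurable ?S" for m
    proof -
      have "(\<lambda>w. (\<lambda>k::int. \<lambda>w. w (Inr (max 0 ((of_int k + 1) / real (Suc m))))) \<lfloor>real (Suc m) * max 0 (t - w (Inl None))\<rfloor> w)
         \<in> borel_measurable ?S"
      proof (rule measurable_compose_countable[where f="\<lambda>(k::int) w. w (Inr (max 0 ((of_int k + 1) / real (Suc m))))"])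
        show "(\<lambda>w. w (Inr (max 0 ((of_int k + 1) / real (Suc m))))) \<in> borel_measurable ?S" for k :: int
          by (rule measurable_component_singleton) (auto simp: I_def)
      qed measurable
      moreover have "max 0 ((of_int \<lfloor>real (Suc m) * max 0 u\<rfloor> + 1) / real (Suc m)) = grid m (max 0 u)" for u
        using grid0[of "max 0 u" m] by (simp add: grid_def)
      ultimately show ?thesis by simp
    qed
    show ?thesis unfolding glue_def by measurable
  qed
  define h where "h w = prod_eval glue w l" for w
  have hm: "h \<in> borel_measurable (PiM I (\<lambda>_. borel))"
    unfolding h_def[abs_def] by (intro prod_eval_measurable[OF _ lu] glue_m) auto
  have hW: "h (\<lambda>i\<in>I. W i \<omega>) = prod_eval X \<omega> l" if w: "\<omega> \<in> space (Px x)" for \<omega>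
    unfolding h_def
  proof (rule prod_eval_cong[OF lu])
    fix t :: real assume "t \<in> {0..}"
    then have t: "t \<ge> 0" by simp
    show "glue t (\<lambda>i\<in>I. W i \<omega>) = X t \<omega>"
    proof (cases "t < \<theta> \<omega>")
      case True
      then show ?thesis using t by (simp add: glue_def W_def I_simps past_def)
    next
      case False
      have "(\<lambda>m. X (\<theta> \<omega> + grid m (t - \<theta> \<omega>)) \<omega>) \<longlonglongrightarrow> X (\<theta> \<omega> + (t - \<theta> \<omega>)) \<omega>"
        using rcont_grid[OF rcont_shift[OF X_rcont[OF x w] \<theta>0[of \<omega>]], of "t - \<theta> \<omega>"] False by simp
      then have "lim (\<lambda>m. X (\<theta> \<omega> + grid m (t - \<theta> \<omega>)) \<omega>) = X t \<omega>" by (simp add: limI)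
      then show ?thesis using False t grid0[of "t - \<theta> \<omega>"]
        by (simp add: glue_def W_def I_simps past_def)
    qed
  qed
  have hW': "h (\<lambda>i\<in>I. W' i (\<omega>, \<omega>')) = prod_eval (conc X b X') (\<omega>, \<omega>') l"
    if w: "\<omega> \<in> space (Px x)" "\<omega>' \<in> space M'" "\<omega> \<in> F" for \<omega> \<omega>'
    unfolding h_def
  proof (rule prod_eval_cong[OF lu])
    fix t :: real assume "t \<in> {0..}"
    then have t: "t \<ge> 0" by simp
    have T: "hit_below X b \<omega> = ennreal (\<theta> \<omega>)" using w(3) by (auto simp: F_def \<theta>_def)
    have lt: "ennreal t < hit_below X b \<omega> \<longleftrightarrow> t < \<theta> \<omega>" using t by (simp add: T ennreal_less_iff)
    show "glue t (\<lambda>i\<in>I. W' i (\<omega>, \<omega>')) = conc X b X' t (\<omega>, \<omega>')"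
    proof (cases "t < \<theta> \<omega>")
      case True
      then show ?thesis using t lt by (simp add: glue_def W'_def I_simps past_def conc_def)
    next
      case False
      have "(\<lambda>m. X' (grid m (t - \<theta> \<omega>)) \<omega>') \<longlonglongrightarrow> X' (t - \<theta> \<omega>) \<omega>'"
        using rcont_grid[OF rc[OF w(2)], of "t - \<theta> \<omega>"] False by simp
      then have "lim (\<lambda>m. X' (grid m (t - \<theta> \<omega>)) \<omega>') = X' (t - \<theta> \<omega>) \<omega>'" by (simp add: limI)
      then show ?thesis using False t lt grid0[of "t - \<theta> \<omega>"]
        by (simp add: glue_def W'_def I_simps past_def conc_def \<theta>_def[symmetric])
    qed
  qed
  define C where "C p = prod_eval (conc X b X') p l" for p
  define G where "G \<omega> = prod_eval X \<omega> l" for \<omega>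
  have cm[measurable]: "C \<in> borel_measurable (Px x \<Otimes>\<^sub>M M')"
    unfolding C_def[abs_def] by (intro prod_eval_measurable[OF _ lu] conc_measurable x X' rc) auto
  have xm[measurable]: "G \<in> borel_measurable (Px x)"
    unfolding G_def[abs_def] by (intro prod_eval_measurable[OF _ lu] X_measurable x) auto
  have on_F: "(\<integral>\<^sup>+p. indicator F (fst p) * C p \<partial>(Px x \<Otimes>\<^sub>M M'))
     = (\<integral>\<^sup>+\<omega>. indicator F \<omega> * G \<omega> \<partial>Px x)"
  proof -
    have W'n: "W' i \<in> borel_measurable N2" if "i \<in> I" for i using W'm[OF that] by (simp add: N2_def)
    have Wn: "W i \<in> borel_measurable N1" if "i \<in> I" for i using Wm[OF that] by (simp add: N1_def)
    have hWm: "(\<lambda>\<omega>. h (\<lambda>i\<in>I. W i \<omega>)) \<in> borel_measurable (Px x)"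
      using hm Wm by (intro measurable_compose[OF measurable_restrict]) auto
    have hW'm: "(\<lambda>\<omega>. h (\<lambda>i\<in>I. W' i \<omega>)) \<in> borel_measurable (Px x \<Otimes>\<^sub>M M')"
      using hm W'm by (intro measurable_compose[OF measurable_restrict]) auto
    have "(\<integral>\<^sup>+p. indicator F (fst p) * C p \<partial>(Px x \<Otimes>\<^sub>M M'))
       = (\<integral>\<^sup>+p. indicator F (fst p) * h (\<lambda>i\<in>I. W' i p) \<partial>(Px x \<Otimes>\<^sub>M M'))"
      by (intro nn_integral_cong) (auto simp: C_def hW' space_pair_measure split: split_indicator)
    also have "\<dots> = (\<integral>\<^sup>+p. h (\<lambda>i\<in>I. W' i p) \<partial>N2)"
      unfolding N2_def using hW'm by (intro nn_integral_density[symmetric]) measurable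
    also have "\<dots> = (\<integral>\<^sup>+\<omega>. h (\<lambda>i\<in>I. W i \<omega>) \<partial>N1)"
      by (rule law_integral_eq[OF fin(2,1) W'n Wn joint[symmetric] hm])
    also have "\<dots> = (\<integral>\<^sup>+\<omega>. indicator F \<omega> * h (\<lambda>i\<in>I. W i \<omega>) \<partial>Px x)"
      unfolding N1_def using hWm by (intro nn_integral_density Fm)
    also have "\<dots> = (\<integral>\<^sup>+\<omega>. indicator F \<omega> * G \<omega> \<partial>Px x)"
      by (intro nn_integral_cong) (simp add: hW G_def)
    finally show ?thesis .
  qed
  have off_F: "(\<integral>\<^sup>+p. indicator (- F) (fst p) * C p \<partial>(Px x \<Otimes>\<^sub>M M'))
     = (\<integral>\<^sup>+\<omega>. indicator (- F) \<omega> * G \<omega> \<partial>Px x)"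
  proof -
    have e: "C (\<omega>, \<omega>') = G \<omega>" if "\<omega> \<notin> F" for \<omega> \<omega>'
      using that unfolding C_def G_def by (intro prod_eval_cong[OF lu]) (auto simp: conc_def F_def not_less top_unique)
    have "(\<integral>\<^sup>+p. indicator (- F) (fst p) * C p \<partial>(Px x \<Otimes>\<^sub>M M'))
       = (\<integral>\<^sup>+p. indicator (- F) (fst p) * G (fst p) \<partial>(Px x \<Otimes>\<^sub>M M'))"
      by (intro nn_integral_cong) (auto simp: e split: split_indicator)
    also have "\<dots> = (\<integral>\<^sup>+\<omega>. (\<integral>\<^sup>+\<omega>'. indicator (- F) \<omega> * G \<omega> \<partial>M') \<partial>Px x)"
      using M'.nn_integral_fst[of "\<lambda>p. indicator (- F) (fst p) * G (fst p)" "Px x"] by simp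
    finally show ?thesis by (simp add: M'.emeasure_space_1)
  qed
  have "(\<integral>\<^sup>+p. C p \<partial>(Px x \<Otimes>\<^sub>M M'))
     = (\<integral>\<^sup>+p. indicator F (fst p) * C p + indicator (- F) (fst p) * C p \<partial>(Px x \<Otimes>\<^sub>M M'))"
    by (intro nn_integral_cong) (auto split: split_indicator)
  also have "\<dots> = (\<integral>\<^sup>+\<omega>. indicator F \<omega> * G \<omega> \<partial>Px x) + (\<integral>\<^sup>+\<omega>. indicator (- F) \<omega> * G \<omega> \<partial>Px x)"
    unfolding on_F[symmetric] off_F[symmetric] by (rule nn_integral_add) measurable
  also have "\<dots> = (\<integral>\<^sup>+\<omega>. indicator F \<omega> * G \<omega> + indicator (- F) \<omega> * G \<omega> \<partial>Px x)"
    by (rule nn_integral_add[symmetric]) measurable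
  also have "\<dots> = (\<integral>\<^sup>+\<omega>. G \<omega> \<partial>Px x)"
    by (intro nn_integral_cong) (auto split: split_indicator)
  also have "\<dots> = expect_from l x" using x by (simp add: expect_from_def G_def)
  finally show "(\<integral>\<^sup>+p. prod_eval (conc X b X') p l \<partial>(Px x \<Otimes>\<^sub>M M')) = expect_from l x"
    unfolding C_def .
qed

end

subsection \<open>Coupling along a sequence tending to infinity\<close>

lemma shift_at_right: "filterlim (\<lambda>s. s - a) (at_right (t - a)) (at_right (t::real))"
  by (rule tendsto_imp_filterlim_at_right) (auto intro!: tendsto_intros simp: eventually_at_filter)

lemma shift_at_left: "filterlim (\<lambda>s. s - a) (at_left (t - a)) (at_left (t::real))"
  by (rule tendsto_imp_filterlim_at_left) (auto intro!: tendsto_intros simp: eventually_at_filter)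

lemma cadlag_from_shift:
  assumes f: "cadlag f" and t: "a < t" and eq: "\<And>s. a < s \<Longrightarrow> g s = f (s - a)"
  shows "(g \<longlongrightarrow> g t) (at_right t)" "\<exists>l. (g \<longlongrightarrow> l) (at_left t)"
proof -
  have "((\<lambda>s. f (s - a)) \<longlongrightarrow> f (t - a)) (at_right t)"
    using f t by (intro filterlim_compose[OF _ shift_at_right]) (simp add: cadlag_def)
  moreover have "\<forall>\<^sub>F s in at_right t. f (s - a) = g s"
    unfolding eventually_at_right_field using t eq by (auto intro!: exI[of _ "t + 1"])
  ultimately show "(g \<longlongrightarrow> g t) (at_right t)"
    using eq[OF t] by (auto intro: Lim_transform_eventually)
  obtain l where "(f \<longlongrightarrow> l) (at_left (t - a))" using f t unfolding cadlag_def by (meson diff_gt_0_iff_gt)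
  then have "((\<lambda>s. f (s - a)) \<longlongrightarrow> l) (at_left t)" using filterlim_compose[OF _ shift_at_left] by blast
  moreover have "\<forall>\<^sub>F s in at_left t. f (s - a) = g s"
    unfolding eventually_at_left_field using t eq by (auto intro!: exI[of _ a])
  ultimately show "\<exists>l. (g \<longlongrightarrow> l) (at_left t)" by (auto intro: Lim_transform_eventually)
qed

text \<open>At the switching time the left limit comes from the first path and right-continuity from
  the second; the two values need not match.\<close>

lemma cadlag_conc:
  assumes f: "cadlag (\<lambda>t. X t \<omega>)" and g: "cadlag (\<lambda>t. X' t \<omega>')"
  shows "cadlag (\<lambda>t. conc X b X' t (\<omega>, \<omega>'))"
proof (cases "hit_below X b \<omega>")
  case top
  have eq: "conc X b X' t (\<omega>, \<omega>') = X t \<omega>" for t by (simp add: conc_def top)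
  show ?thesis unfolding eq by (rule f)
next
  case (real a)
  have c1: "conc X b X' s (\<omega>, \<omega>') = X s \<omega>" if "0 \<le> s" "s < a" for s
    using that real by (simp add: conc_def ennreal_less_iff)
  have c2: "conc X b X' s (\<omega>, \<omega>') = X' (s - a) \<omega>'" if "a \<le> s" for s
    using that real by (simp add: conc_def ennreal_less_iff)
  show ?thesis
    unfolding cadlag_def
  proof safe
    fix t :: real assume t: "0 \<le> t"
    show "((\<lambda>t. conc X b X' t (\<omega>, \<omega>')) \<longlongrightarrow> conc X b X' t (\<omega>, \<omega>')) (at_right t)"
    proof (cases "t < a")
      case True
      have "\<forall>\<^sub>F s in at_right t. X s \<omega> = conc X b X' s (\<omega>, \<omega>')"
        unfolding eventually_at_right_field using True c1 t by (auto intro!: exI[of _ a])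
      then show ?thesis using f t c1[OF t True] unfolding cadlag_def by (auto intro: Lim_transform_eventually)
    next
      case False
      have "((\<lambda>s. X' (s - a) \<omega>') \<longlongrightarrow> X' (t - a) \<omega>') (at_right t)"
        using g False by (intro filterlim_compose[OF _ shift_at_right, where g="\<lambda>s. X' s \<omega>'"]) (simp add: cadlag_def)
      moreover have "\<forall>\<^sub>F s in at_right t. X' (s - a) \<omega>' = conc X b X' s (\<omega>, \<omega>')"
        unfolding eventually_at_right_field using False c2 by (auto intro!: exI[of _ "t + 1"])
      ultimately show ?thesis using c2[of t] False by (auto intro: Lim_transform_eventually)
    qed
  next
    fix t :: real assume t: "0 < t"
    show "\<exists>l. ((\<lambda>t. conc X b X' t (\<omega>, \<omega>')) \<longlongrightarrow> l) (at_left t)"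
    proof (cases "t \<le> a")
      case True
      obtain l where "((\<lambda>t. X t \<omega>) \<longlongrightarrow> l) (at_left t)" using f t unfolding cadlag_def by blast
      moreover have "\<forall>\<^sub>F s in at_left t. X s \<omega> = conc X b X' s (\<omega>, \<omega>')"
        unfolding eventually_at_left_field using True c1 t by (auto intro!: exI[of _ 0])
      ultimately show ?thesis by (auto intro: Lim_transform_eventually)
    next
      case False
      then show ?thesis using cadlag_from_shift(2)[OF g, of a t] c2 by simp
    qed
  qed
qed

text \<open>The sequence may take the value \<open>u\<close> itself, so the filter
  \<open>at_right u\<close> cannot be used directly. It is applied to times that may become
  stationary.\<close>

lemma rcont_tendsto_from_right:
  assumes f: "rcont f" and u: "u \<ge> 0" and s: "s \<longlonglongrightarrow> u" and ge: "\<And>m. u \<le> s m"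
  shows "(\<lambda>m. f (s m)) \<longlonglongrightarrow> f u"
proof (rule topological_tendstoI)
  fix S assume S: "open S" "f u \<in> S"
  have "(f \<longlongrightarrow> f u) (at_right u)" using f u by (simp add: rcont_def)
  then have "\<forall>\<^sub>F v in at_right u. f v \<in> S" using S by (rule topological_tendstoD)
  then obtain c where c: "u < c" "\<And>v. u < v \<Longrightarrow> v < c \<Longrightarrow> f v \<in> S"
    unfolding eventually_at_right_field by blast
  have "\<forall>\<^sub>F m in sequentially. s m < c" using s c(1) by (rule order_tendstoD)
  then show "\<forall>\<^sub>F m in sequentially. f (s m) \<in> S"
  proof eventually_elim
    case (elim m)
    then show ?case using c(2)[of "s m"] ge[of m] S by (cases "s m = u") auto
  qed
qed

context path_proc
begin

lemma same_law_integral: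
  fixes M' :: "'b measure"
  assumes y: "y \<ge> 0" and pM: "prob_space M'"
    and X': "\<And>t. t \<ge> 0 \<Longrightarrow> X' t \<in> borel_measurable M'"
    and law: "same_law M' X' y" and h: "h \<in> borel_measurable (PiM {0..} (\<lambda>_. borel))"
  shows "(\<integral>\<^sup>+\<omega>. h (\<lambda>i\<in>{0..}. X' i \<omega>) \<partial>M') = (\<integral>\<^sup>+\<omega>. h (\<lambda>i\<in>{0..}. X i \<omega>) \<partial>Px y)"
proof (rule law_integral_eq[OF _ _ _ _ _ h])
  show "finite_measure M'" "finite_measure (Px y)"
    using pM prob[OF y] by (auto simp: prob_space_def)
  show "(\<integral>\<^sup>+\<omega>. prod_eval X' \<omega> l \<partial>M') = (\<integral>\<^sup>+\<omega>. prod_eval X \<omega> l \<partial>Px y)" if "ok_list {0..} cont_fns l" for l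
    using law that y by (simp add: same_law_def expect_from_def)
qed (use X' X_measurable y in auto)

text \<open>Laws are compared on the product \<open>\<sigma>\<close>-algebra, hence the formulation
  with a countable set of times.\<close>

lemma same_law_hits:
  fixes M' :: "'b measure"
  assumes y: "y \<ge> 0" and pM: "prob_space M'"
    and X': "\<And>t. t \<ge> 0 \<Longrightarrow> X' t \<in> borel_measurable M'"
    and law: "same_law M' X' y" and D: "countable D" "D \<subseteq> {0..}"
  shows "measure M' {\<omega>\<in>space M'. \<exists>s\<in>D. X' s \<omega> < b} = measure (Px y) {\<omega>\<in>space (Px y). \<exists>s\<in>D. X s \<omega> < b}"
proof -
  let ?S = "PiM {0..} (\<lambda>_. borel :: real measure)"
  define B where "B = {w\<in>space ?S. \<exists>s\<in>D. w s < b}"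
  have mB: "B \<in> sets ?S"
    unfolding B_def by (rule sets_hits[OF D, where U="\<lambda>s w. w s"]) simp
  have m1: "{\<omega>\<in>space M'. \<exists>s\<in>D. X' s \<omega> < b} \<in> sets M'"
    by (rule sets_hits[OF D]) (use X' in simp)
  have m2: "{\<omega>\<in>space (Px y). \<exists>s\<in>D. X s \<omega> < b} \<in> sets (Px y)"
    by (rule sets_hits[OF D]) (use X_measurable y in simp)
  have "emeasure M' {\<omega>\<in>space M'. \<exists>s\<in>D. X' s \<omega> < b} = (\<integral>\<^sup>+\<omega>. indicator B (\<lambda>i\<in>{0..}. X' i \<omega>) \<partial>M')"
    unfolding nn_integral_indicator[OF m1, symmetric]
    using D(2) by (intro nn_integral_cong) (auto simp: B_def space_PiM subset_eq split: split_indicator)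
  also have "\<dots> = (\<integral>\<^sup>+\<omega>. indicator B (\<lambda>i\<in>{0..}. X i \<omega>) \<partial>Px y)"
    using mB by (intro same_law_integral y pM X' law) auto
  also have "\<dots> = emeasure (Px y) {\<omega>\<in>space (Px y). \<exists>s\<in>D. X s \<omega> < b}"
    unfolding nn_integral_indicator[OF m2, symmetric]
    using D(2) by (intro nn_integral_cong) (auto simp: B_def space_PiM subset_eq split: split_indicator)
  finally show ?thesis by (simp add: measure_def)
qed

end

section \<open>The coupled processes on the product space\<close>

locale entrance_proc = path_proc +
  assumes entrance: "\<And>t. t > 0 \<Longrightarrow> ((\<lambda>b. Liminf at_top (\<lambda>x. ereal (measure (Px x)
                      {\<omega>\<in>space (Px x). hit_below X b \<omega> \<le> ennreal t}))) \<longlongrightarrow> 1) at_top"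

text \<open>The levels are a parameter because \<open>semigroup_at_top\<close> repeats the
  construction along a second sequence.\<close>

locale entrance_seq = entrance_proc +
  fixes z :: "nat \<Rightarrow> real"
  assumes z_nonneg: "\<And>n. z n \<ge> 0" and z_strict: "\<And>n. z n < z (Suc n)"
    and z_at_top: "filterlim z at_top sequentially"
begin

definition \<Omega> :: "(nat \<Rightarrow> 'a) measure" where "\<Omega> = PiM UNIV (\<lambda>k. Px (z k))"

text \<open>The component \<open>w (Suc n)\<close> starts from \<open>z (Suc n)\<close>, hence the
  shift of the index. The value may be infinite.\<close>

definition \<tau> :: "nat \<Rightarrow> (nat \<Rightarrow> 'a) \<Rightarrow> ennreal" where "\<tau> n w = hit_below X (z n) (w (Suc n))"

text \<open>The continuation receives the whole family \<open>w\<close>, of which \<open>Z n\<close>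
  reads only the components \<open>0\<close> to \<open>n\<close>.\<close>

primrec Z :: "nat \<Rightarrow> real \<Rightarrow> (nat \<Rightarrow> 'a) \<Rightarrow> real" where
  "Z 0 = (\<lambda>t w. X t (w 0))"
| "Z (Suc n) = (\<lambda>t w. conc X (z n) (Z n) t (w (Suc n), w))"

definition \<sigma> :: "nat \<Rightarrow> nat \<Rightarrow> (nat \<Rightarrow> 'a) \<Rightarrow> ennreal" where "\<sigma> n m w = (\<Sum>k\<in>{n..<m}. \<tau> k w)"

definition T :: "nat \<Rightarrow> (nat \<Rightarrow> 'a) \<Rightarrow> ennreal" where "T n w = (\<Sum>k. \<tau> (k + n) w)"

sublocale \<Omega>: prob_space \<Omega>
  unfolding \<Omega>_def using prob z_nonneg by (intro prob_space_PiM) auto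

lemma z_mono: "n \<le> m \<Longrightarrow> z n \<le> z m"
  by (rule lift_Suc_mono_le[of z, OF less_imp_le[OF z_strict]])

lemma space_component: "w \<in> space \<Omega> \<Longrightarrow> w k \<in> space (Px (z k))"
  by (auto simp: \<Omega>_def space_PiM)

lemma component_measurable [measurable]: "(\<lambda>w. w k) \<in> measurable \<Omega> (Px (z k))"
  unfolding \<Omega>_def by (rule measurable_component_singleton) simp

lemma \<tau>_measurable [measurable]: "\<tau> n \<in> borel_measurable \<Omega>"
  unfolding \<tau>_def[abs_def] by (rule measurable_compose[OF component_measurable hit_measurable[OF z_nonneg]])

lemma \<sigma>_measurable [measurable]: "\<sigma> n m \<in> borel_measurable \<Omega>"
  unfolding \<sigma>_def[abs_def] by measurable

lemma T_measurable [measurable]: "T n \<in> borel_measurable \<Omega>"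
  unfolding T_def[abs_def] by measurable

lemma Z_cadlag: "w \<in> space \<Omega> \<Longrightarrow> cadlag (\<lambda>t. Z n t w)"
proof (induction n)
  case 0
  then show ?case using cadlag_paths[OF z_nonneg space_component] by simp
next
  case (Suc n)
  have "cadlag (\<lambda>t. conc X (z n) (Z n) t (w (Suc n), w))"
    by (rule cadlag_conc[where X=X and X'="Z n"])
       (use Suc cadlag_paths[OF z_nonneg space_component] in auto)
  then show ?case by simp
qed

lemma Z_rcont: "w \<in> space \<Omega> \<Longrightarrow> rcont (\<lambda>t. Z n t w)"
  using Z_cadlag cadlag_rcont by blast

lemma Z_nonneg: "w \<in> space \<Omega> \<Longrightarrow> t \<ge> 0 \<Longrightarrow> Z n t w \<ge> 0"
proof (induction n arbitrary: t)
  case 0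
  then show ?case using X_nonneg[OF z_nonneg space_component] by simp
next
  case (Suc n)
  then show ?case using X_nonneg[OF z_nonneg space_component] by (simp add: conc_max)
qed

lemma Z_measurable: "t \<ge> 0 \<Longrightarrow> Z n t \<in> borel_measurable \<Omega>"
proof (induction n arbitrary: t)
  case 0
  have "(\<lambda>w. X t (w 0)) \<in> borel_measurable \<Omega>"
    by (rule measurable_compose[OF component_measurable X_measurable[OF z_nonneg 0]])
  then show ?case by simp
next
  case (Suc n)
  have "conc X (z n) (Z n) t \<in> borel_measurable (Px (z (Suc n)) \<Otimes>\<^sub>M \<Omega>)"
    using Suc Z_rcont by (intro conc_measurable z_nonneg) auto
  moreover have "(\<lambda>w. (w (Suc n), w)) \<in> measurable \<Omega> (Px (z (Suc n)) \<Otimes>\<^sub>M \<Omega>)" by measurable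
  ultimately have "(\<lambda>w. conc X (z n) (Z n) t (w (Suc n), w)) \<in> borel_measurable \<Omega>"
    by (rule measurable_compose[rotated])
  then show ?case by simp
qed

text \<open>This is the independence behind the coupling: the component \<open>Suc n\<close> can be
  resampled without touching \<open>Z n\<close>.\<close>

lemma Z_upd: "n \<le> m \<Longrightarrow> Z n t (w(Suc m := v)) = Z n t w"
  by (induction n arbitrary: t) (auto simp: conc_def)

text \<open>\<open>conc_law\<close> concerns a product of two spaces. Overwriting the component
  \<open>Suc n\<close> by an independent path from \<open>z (Suc n)\<close> preserves
  \<open>\<Omega>\<close> and transports its conclusion to \<open>Z (Suc n)\<close>.\<close>

lemma Z_law: "same_law \<Omega> (Z n) (z n)"
proof (induction n)
  case 0
  show ?case
    unfolding same_law_def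
  proof (intro allI impI)
    fix l :: "(real \<times> (real \<Rightarrow> ennreal)) list" assume "ok_list {0..} cont_fns l"
    then have lu: "ok_list {0..} unit_fns l" using cont_fns_unit by (rule ok_list_mono)
    have "distr \<Omega> (Px (z 0)) (\<lambda>w. w 0) = Px (z 0)"
      unfolding \<Omega>_def using prob z_nonneg by (intro distr_PiM_component) auto
    then have "(\<integral>\<^sup>+\<omega>. prod_eval X \<omega> l \<partial>Px (z 0)) = (\<integral>\<^sup>+\<omega>. prod_eval X \<omega> l \<partial>distr \<Omega> (Px (z 0)) (\<lambda>w. w 0))" by simp
    also have "\<dots> = (\<integral>\<^sup>+w. prod_eval X (w 0) l \<partial>\<Omega>)"
      by (intro nn_integral_distr component_measurable prod_eval_measurable[OF _ lu])
         (simp add: X_measurable[OF z_nonneg])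
    finally show "(\<integral>\<^sup>+\<omega>. prod_eval (Z 0) \<omega> l \<partial>\<Omega>) = expect_from l (z 0)"
      using z_nonneg[of 0] by (simp add: expect_from_def prod_eval_def)
  qed
next
  case (Suc n)
  have cl: "same_law (Px (z (Suc n)) \<Otimes>\<^sub>M \<Omega>) (conc X (z n) (Z n)) (z (Suc n))"
    using Suc z_nonneg z_strict[of n] Z_measurable Z_rcont \<Omega>.prob_space_axioms
    by (intro conc_law) auto
  show ?case
    unfolding same_law_def
  proof (intro allI impI)
    fix l :: "(real \<times> (real \<Rightarrow> ennreal)) list" assume l: "ok_list {0..} cont_fns l"
    then have lu: "ok_list {0..} unit_fns l" using cont_fns_unit by (rule ok_list_mono)
    let ?P = "Px (z (Suc n)) \<Otimes>\<^sub>M \<Omega>"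
    have d: "distr ?P \<Omega> (\<lambda>(v, w). w(Suc n := v)) = \<Omega>"
      using distr_pair_PiM_eq_PiM[of UNIV "\<lambda>k. Px (z k)" "Suc n"] prob z_nonneg by (simp add: \<Omega>_def)
    have m: "(\<lambda>(v, w). w(Suc n := v)) \<in> measurable ?P \<Omega>"
    proof -
      have "(\<lambda>p. (case p of (v, w) \<Rightarrow> w(Suc n := v)) i) \<in> measurable ?P (Px (z i))" for i
        by (cases "i = Suc n") (auto simp: case_prod_unfold intro!: measurable_compose[OF measurable_snd component_measurable])
      then show ?thesis
        unfolding \<Omega>_def by (intro measurable_PiM_single') (auto simp: space_pair_measure space_PiM)
    qed
    have "(\<integral>\<^sup>+w. prod_eval (Z (Suc n)) w l \<partial>\<Omega>) = (\<integral>\<^sup>+w. prod_eval (Z (Suc n)) w l \<partial>distr ?P \<Omega> (\<lambda>(v, w). w(Suc n := v)))"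
      by (simp only: d)
    also have "\<dots> = (\<integral>\<^sup>+p. prod_eval (Z (Suc n)) (case p of (v, w) \<Rightarrow> w(Suc n := v)) l \<partial>?P)"
      by (intro nn_integral_distr m prod_eval_measurable[OF _ lu]) (simp add: Z_measurable del: Z.simps)
    also have "\<dots> = (\<integral>\<^sup>+p. prod_eval (conc X (z n) (Z n)) p l \<partial>?P)"
      by (intro nn_integral_cong prod_eval_cong[OF lu]) (auto simp: conc_def Z_upd)
    also have "\<dots> = expect_from l (z (Suc n))" using cl l by (simp add: same_law_def)
    finally show "(\<integral>\<^sup>+w. prod_eval (Z (Suc n)) w l \<partial>\<Omega>) = expect_from l (z (Suc n))" .
  qed
qed

lemma \<sigma>_Suc: "n \<le> m \<Longrightarrow> \<sigma> n (Suc m) w = \<sigma> n m w + \<tau> m w"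
  by (simp add: \<sigma>_def)

lemma Z_shift:
  assumes "n \<le> m" "\<sigma> n m w \<le> ennreal t" "t \<ge> 0"
  shows "Z m t w = Z n (t - enn2real (\<sigma> n m w)) w"
  using assms
proof (induction m arbitrary: t rule: dec_induct)
  case base
  then show ?case by (simp add: \<sigma>_def)
next
  case (step m)
  have le: "\<sigma> n m w + \<tau> m w \<le> ennreal t" using step by (simp add: \<sigma>_Suc)
  have "\<sigma> n m w + \<tau> m w < \<infinity>" by (rule le_less_trans[OF le]) simp
  then obtain a c where a: "\<sigma> n m w = ennreal a" "a \<ge> 0" and c: "\<tau> m w = ennreal c" "c \<ge> 0"
    by (cases "\<sigma> n m w"; cases "\<tau> m w") auto
  have ac: "a + c \<le> t" using le a c step.prems by (simp add: ennreal_plus[symmetric] del: ennreal_plus)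
  have "Z (Suc m) t w = Z m (t - c) w"
    using ac a c step.prems by (simp add: conc_def \<tau>_def[symmetric] ennreal_less_iff)
  also have "\<dots> = Z n (t - c - enn2real (\<sigma> n m w)) w"
    using ac a c by (intro step.IH) (auto intro!: ennreal_leI)
  also have "t - c - enn2real (\<sigma> n m w) = t - enn2real (\<sigma> n (Suc m) w)"
    using a c step by (simp add: \<sigma>_Suc ennreal_plus[symmetric] del: ennreal_plus)
  finally show ?case .
qed

text \<open>Before its own passage time the outermost path is above \<open>z m\<close>, hence above
  \<open>z n\<close>; afterwards the problem reduces to \<open>Z m\<close> with that time
  subtracted.\<close>

lemma Z_lower:
  assumes "n \<le> m" "ennreal t < \<sigma> n m w" "t \<ge> 0"
  shows "z n \<le> Z m t w"
  using assms
proof (induction m arbitrary: t rule: dec_induct)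
  case base
  then show ?case by (simp add: \<sigma>_def)
next
  case (step m)
  show ?case
  proof (cases "ennreal t < \<tau> m w")
    case True
    then have "z m \<le> X t (w (Suc m))" using step.prems before_hit_below[of t X "z m" "w (Suc m)"] by (simp add: \<tau>_def)
    then show ?thesis using True step z_mono[of n m] by (simp add: conc_def \<tau>_def)
  next
    case False
    then have "\<tau> m w \<le> ennreal t" by simp
    then have "\<tau> m w < \<infinity>" by (rule le_less_trans) simp
    then obtain c where c: "\<tau> m w = ennreal c" "c \<ge> 0" by (cases "\<tau> m w") auto
    have ct: "c \<le> t" using False c step.prems by (simp add: ennreal_less_iff)
    have "ennreal (t - c) < \<sigma> n m w"
    proof (rule ccontr)
      assume "\<not> ennreal (t - c) < \<sigma> n m w"
      then have "\<sigma> n m w + \<tau> m w \<le> ennreal (t - c) + ennreal c" unfolding c by (intro add_right_mono) simp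
      also have "\<dots> = ennreal t" using ct c by (simp add: ennreal_plus[symmetric] del: ennreal_plus)
      finally show False using step by (simp add: \<sigma>_Suc)
    qed
    then have "z n \<le> Z m (t - c) w" using ct by (intro step.IH) auto
    then show ?thesis using False c by (simp add: conc_def \<tau>_def[symmetric])
  qed
qed

lemma T_eq_SUP: "T n w = (SUP m. \<sigma> n (n + m) w)"
proof -
  have "(\<Sum>k<m. \<tau> (k + n) w) = \<sigma> n (n + m) w" for m
    unfolding \<sigma>_def by (induction m) (auto simp: add.commute)
  then show ?thesis unfolding T_def suminf_eq_SUP by simp
qed

lemma \<sigma>_le_T: "n \<le> m \<Longrightarrow> \<sigma> n m w \<le> T n w"
  unfolding T_eq_SUP using SUP_upper[of "m - n" UNIV "\<lambda>m. \<sigma> n (n + m) w"] by simp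

lemma T_split: "n \<le> m \<Longrightarrow> T n w = \<sigma> n m w + T m w"
proof (induction m rule: dec_induct)
  case base
  then show ?case by (simp add: \<sigma>_def)
next
  case (step m)
  have "T m w = \<tau> m w + T (Suc m) w"
    unfolding T_def using suminf_offset[of "\<lambda>k. \<tau> (k + m) w" 1] by (simp add: add.commute)
  then show ?case using step by (simp add: \<sigma>_Suc add.assoc)
qed

lemma T_antimono: "n \<le> m \<Longrightarrow> T m w \<le> T n w"
  using T_split[of n m w] by simp

end

lemma cadlag_ennreal:
  assumes "cadlag f"
  shows "cadlag (\<lambda>t. ennreal (f t))"
  unfolding cadlag_def
proof safe
  fix t :: real assume "t \<ge> 0"
  then have "(f \<longlongrightarrow> f t) (at_right t)" using assms by (simp add: cadlag_def)
  then show "((\<lambda>t. ennreal (f t)) \<longlongrightarrow> ennreal (f t)) (at_right t)" by (rule tendsto_ennrealI)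
next
  fix t :: real assume "t > 0"
  then obtain l where "(f \<longlongrightarrow> l) (at_left t)" using assms unfolding cadlag_def by blast
  then have "((\<lambda>t. ennreal (f t)) \<longlongrightarrow> ennreal l) (at_left t)" by (rule tendsto_ennrealI)
  then show "\<exists>l. ((\<lambda>t. ennreal (f t)) \<longlongrightarrow> l) (at_left t)" ..
qed

section \<open>The limit process\<close>

context entrance_seq
begin

text \<open>An immediate passage would mean, by \<open>at_hit_below\<close>, that the path starts at
  \<open>z n\<close> instead of \<open>z (Suc n)\<close>. Positivity keeps the limit process above
  \<open>z n\<close> during a nondegenerate interval.\<close>

lemma AE_\<tau>_pos: "AE w in \<Omega>. 0 < \<tau> n w"
proof -
  have "AE w in \<Omega>. X 0 (w (Suc n)) = z (Suc n)"
    unfolding \<Omega>_def using X_0[OF z_nonneg[of "Suc n"]] prob[OF z_nonneg] by (intro AE_PiM_component) auto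
  then show ?thesis
  proof (rule AE_mp, intro AE_I2 impI)
    fix w assume w: "w \<in> space \<Omega>" and X0: "X 0 (w (Suc n)) = z (Suc n)"
    show "0 < \<tau> n w"
    proof (rule ccontr)
      assume "\<not> 0 < \<tau> n w"
      then have 0: "hit_below X (z n) (w (Suc n)) = 0" by (simp add: \<tau>_def)
      then have "X (enn2real (hit_below X (z n) (w (Suc n)))) (w (Suc n)) = z n"
        using space_component[OF w, of "Suc n"] z_nonneg[of "Suc n"] z_strict[of n] X0
        by (intro at_hit_below[where X=X] cadlag_paths no_neg_jumps) auto
      then show False using 0 X0 z_strict[of n] by simp
    qed
  qed
qed

text \<open>A passage of \<open>Z m\<close> below \<open>z n\<close> at some time implies, by
  \<open>Z_lower\<close>, that \<open>\<sigma> n m\<close> is at most that time.\<close>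

lemma prob_\<sigma>_ge:
  assumes "n \<le> m" "r > 0"
  shows "measure (Px (z m)) {\<omega>\<in>space (Px (z m)). hit_below X (z n) \<omega> \<le> ennreal (r / 2)}
    \<le> measure \<Omega> {w\<in>space \<Omega>. \<sigma> n m w \<le> ennreal r}"
proof -
  interpret P: prob_space "Px (z m)" using prob z_nonneg by simp
  \<comment> \<open>Passage by \<open>r / 2\<close> is strictly before \<open>r\<close>, hence is
    witnessed by a rational time below \<open>r\<close>; this gap explains the factor 2.\<close>
  define D where "D = {s\<in>\<rat>. 0 \<le> s \<and> s < r}"
  have D: "countable D" "D \<subseteq> {0..}"
    by (auto simp: D_def intro: countable_rat_subset)
  have Dm: "{\<omega>\<in>space (Px (z m)). \<exists>s\<in>D. X s \<omega> < z n} \<in> sets (Px (z m))"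
    by (rule sets_hits[OF D]) (simp add: X_measurable[OF z_nonneg])
  have "measure (Px (z m)) {\<omega>\<in>space (Px (z m)). hit_below X (z n) \<omega> \<le> ennreal (r / 2)}
     \<le> measure (Px (z m)) {\<omega>\<in>space (Px (z m)). \<exists>s\<in>D. X s \<omega> < z n}"
  proof (rule P.finite_measure_mono[OF _ Dm], safe)
    fix \<omega> assume w: "\<omega> \<in> space (Px (z m))" "hit_below X (z n) \<omega> \<le> ennreal (r / 2)"
    have "hit_below X (z n) \<omega> < ennreal r"
      using w(2) by (rule le_less_trans) (use assms in \<open>auto intro: ennreal_lessI\<close>)
    then show "\<exists>s\<in>D. X s \<omega> < z n"
      using hit_below_less_iff[of X \<omega> "z n" "ennreal r", OF X_rcont[OF z_nonneg w(1)]]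
      by (auto simp: D_def ennreal_less_iff)
  qed
  also have "\<dots> = measure \<Omega> {w\<in>space \<Omega>. \<exists>s\<in>D. Z m s w < z n}"
    using D by (intro same_law_hits[symmetric] z_nonneg \<Omega>.prob_space_axioms Z_measurable Z_law) auto
  also have "\<dots> \<le> measure \<Omega> {w\<in>space \<Omega>. \<sigma> n m w \<le> ennreal r}"
  proof (rule \<Omega>.finite_measure_mono)
    show "{w\<in>space \<Omega>. \<exists>s\<in>D. Z m s w < z n} \<subseteq> {w\<in>space \<Omega>. \<sigma> n m w \<le> ennreal r}"
    proof safe
      fix w s assume s: "s \<in> D" "Z m s w < z n"
      have "\<not> ennreal s < \<sigma> n m w" using Z_lower[OF assms(1), of s w] s by (auto simp: D_def)
      then have "\<sigma> n m w \<le> ennreal s" by simp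
      also have "\<dots> \<le> ennreal r" using s by (auto simp: D_def intro!: ennreal_leI)
      finally show "\<sigma> n m w \<le> ennreal r" .
    qed
  qed measurable
  finally show ?thesis .
qed

text \<open>The level \<open>z n\<close> is chosen first, so that the lower limit over starting
  points exceeds \<open>c\<close>; then \<open>prob_\<sigma>_ge\<close> applies for all large
  \<open>m\<close>, and continuity from above lets \<open>m\<close> tend to infinity. Finally
  \<open>c\<close> is arbitrary below 1.\<close>

lemma AE_T_small:
  assumes r: "r > 0"
  shows "AE w in \<Omega>. \<exists>n. T n w \<le> ennreal r"
proof -
  define A where "A = {w\<in>space \<Omega>. \<exists>n. T n w \<le> ennreal r}"
  have Am[measurable]: "A \<in> sets \<Omega>" unfolding A_def by measurable
  have "c \<le> measure \<Omega> A" if c: "c < 1" for c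
  proof -
    have "\<forall>\<^sub>F b in at_top. ereal c < Liminf at_top (\<lambda>x. ereal (measure (Px x)
                      {\<omega>\<in>space (Px x). hit_below X b \<omega> \<le> ennreal (r / 2)}))"
      using order_tendstoD(1)[OF entrance[of "r / 2"], of "ereal c"] r c by simp
    then have "\<forall>\<^sub>F n in sequentially. ereal c < Liminf at_top (\<lambda>x. ereal (measure (Px x)
                      {\<omega>\<in>space (Px x). hit_below X (z n) \<omega> \<le> ennreal (r / 2)}))"
      using z_at_top by (rule eventually_compose_filterlim)
    then obtain n where n: "ereal c < Liminf at_top (\<lambda>x. ereal (measure (Px x)
                      {\<omega>\<in>space (Px x). hit_below X (z n) \<omega> \<le> ennreal (r / 2)}))"
      unfolding eventually_sequentially by blast
    from eventually_compose_filterlim[OF less_LiminfD[OF n] z_at_top]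
    have ev: "\<forall>\<^sub>F m in sequentially. c < measure (Px (z m))
                      {\<omega>\<in>space (Px (z m)). hit_below X (z n) \<omega> \<le> ennreal (r / 2)}" by simp
    define B where "B m = {w\<in>space \<Omega>. \<sigma> n (n + m) w \<le> ennreal r}" for m
    have Bm: "range B \<subseteq> sets \<Omega>" unfolding B_def by (auto, measurable)
    have "decseq B"
    proof (rule decseq_SucI)
      fix m
      have "\<sigma> n (n + m) w \<le> \<sigma> n (n + Suc m) w" for w using \<sigma>_Suc[of n "n + m" w] by simp
      then show "B (Suc m) \<subseteq> B m" unfolding B_def by (auto intro: order_trans)
    qed
    from \<Omega>.finite_Lim_measure_decseq[OF Bm this]
    have lim: "(\<lambda>m. measure \<Omega> (B m)) \<longlonglongrightarrow> measure \<Omega> (\<Inter>m. B m)" .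
    have "\<forall>\<^sub>F m in sequentially. c \<le> measure \<Omega> (B m)"
    proof -
      have "filterlim (\<lambda>m. n + m) sequentially sequentially"
        by (rule filterlim_subseq) (auto simp: strict_mono_def)
      from eventually_compose_filterlim[OF ev this]
      show ?thesis
      proof eventually_elim
        case (elim m)
        then show ?case using prob_\<sigma>_ge[of n "n + m" r] r by (simp add: B_def)
      qed
    qed
    then have "c \<le> measure \<Omega> (\<Inter>m. B m)" using lim by (intro tendsto_lowerbound[OF lim]) auto
    also have "\<dots> \<le> measure \<Omega> A"
    proof (rule \<Omega>.finite_measure_mono[OF _ Am])
      show "(\<Inter>m. B m) \<subseteq> A"
        by (auto simp: A_def B_def T_eq_SUP intro!: exI[of _ n] SUP_least)
    qed
    finally show ?thesis .
  qed
  then have "1 \<le> measure \<Omega> A" by (rule dense_le)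
  then have "measure \<Omega> A = 1" using \<Omega>.prob_le_1[of A] by simp
  then have "AE w in \<Omega>. w \<in> A" using \<Omega>.prob_eq_1[OF Am] by simp
  then show ?thesis by eventually_elim (auto simp: A_def)
qed

text \<open>Countably many almost sure conditions that make the limit process exist; the second says
  that \<open>T n w\<close> tends to 0.\<close>

definition good :: "(nat \<Rightarrow> 'a) \<Rightarrow> bool" where
  "good w \<longleftrightarrow> (\<forall>n. 0 < \<tau> n w) \<and> (\<forall>j::nat. \<exists>n. T n w \<le> ennreal (1 / real (Suc j)))"

lemma good_measurable [measurable]: "Measurable.pred \<Omega> good"
  unfolding good_def by measurable

lemma AE_good: "AE w in \<Omega>. good w"
  unfolding good_def AE_conj_iff AE_all_countable using AE_\<tau>_pos AE_T_small by auto

lemma good_T: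
  assumes "good w" "r > 0"
  obtains n where "T n w < ennreal r"
proof -
  obtain j where j: "inverse (real (Suc j)) < r" using reals_Archimedean[OF assms(2)] by blast
  obtain n where "T n w \<le> ennreal (1 / real (Suc j))" using assms(1) by (auto simp: good_def)
  also have "\<dots> < ennreal r" using j assms(2) by (intro ennreal_lessI) (auto simp: inverse_eq_divide)
  finally show ?thesis by (rule that)
qed

lemma good_T_pos: "good w \<Longrightarrow> 0 < T n w"
  using \<sigma>_le_T[of n "Suc n" w] by (auto simp: good_def \<sigma>_def intro: less_le_trans)

definition Zlim :: "real \<Rightarrow> (nat \<Rightarrow> 'a) \<Rightarrow> real" where
  "Zlim t w = lim (\<lambda>m. Z m t w)"

text \<open>By \<open>Z_shift\<close>, \<open>Z m t\<close> is \<open>Z n\<close> at time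
  \<open>t\<close> minus \<open>\<sigma> n m\<close>. These times decrease to \<open>t\<close> minus
  \<open>T n\<close>, so right-continuity suffices.\<close>

lemma Z_tendsto:
  assumes w: "w \<in> space \<Omega>" and T: "T n w \<le> ennreal t" and t: "t \<ge> 0"
  shows "(\<lambda>m. Z m t w) \<longlonglongrightarrow> Z n (t - enn2real (T n w)) w"
proof -
  have fin: "T n w < \<infinity>" using T by (rule le_less_trans) simp
  have "incseq (\<lambda>m. \<sigma> n (n + m) w)"
    by (rule incseq_SucI) (use \<sigma>_Suc[of n _ w] in simp)
  then have "(\<lambda>m. \<sigma> n (n + m) w) \<longlonglongrightarrow> T n w" unfolding T_eq_SUP by (rule LIMSEQ_SUP)
  then have lim: "(\<lambda>m. enn2real (\<sigma> n (n + m) w)) \<longlonglongrightarrow> enn2real (T n w)"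
    using fin by (intro tendsto_enn2real) auto
  have le: "enn2real (\<sigma> n (n + m) w) \<le> enn2real (T n w)" for m
    using \<sigma>_le_T[of n "n + m" w] fin by (intro enn2real_mono) auto
  have "(\<lambda>m. Z n (t - enn2real (\<sigma> n (n + m) w)) w) \<longlonglongrightarrow> Z n (t - enn2real (T n w)) w"
    using lim le enn2real_leI[OF t T]
    by (intro rcont_tendsto_from_right[where f="\<lambda>t. Z n t w"] Z_rcont[OF w]) (auto intro!: tendsto_intros)
  moreover have "Z (m + n) t w = Z n (t - enn2real (\<sigma> n (n + m) w)) w" for m
    using Z_shift[of n "m + n" w t] \<sigma>_le_T[of n "n + m" w] T t by (simp add: add.commute)
  ultimately have "(\<lambda>m. Z (m + n) t w) \<longlonglongrightarrow> Z n (t - enn2real (T n w)) w" by simp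
  then show ?thesis by (rule LIMSEQ_offset)
qed

lemma Zlim_eq: "w \<in> space \<Omega> \<Longrightarrow> T n w \<le> ennreal t \<Longrightarrow> t \<ge> 0 \<Longrightarrow> Zlim t w = Z n (t - enn2real (T n w)) w"
  unfolding Zlim_def by (intro limI Z_tendsto)

lemma Zlim_tendsto:
  assumes "w \<in> space \<Omega>" "good w" "t > 0"
  shows "(\<lambda>m. Z m t w) \<longlonglongrightarrow> Zlim t w"
proof -
  obtain n where "T n w < ennreal t" using good_T assms by blast
  then show ?thesis using Z_tendsto[of w n t] Zlim_eq[of w n t] assms by simp
qed

lemma Zlim_nonneg: "w \<in> space \<Omega> \<Longrightarrow> good w \<Longrightarrow> t > 0 \<Longrightarrow> Zlim t w \<ge> 0"
  using Z_nonneg by (intro LIMSEQ_le_const[OF Zlim_tendsto]) auto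

lemma Zlim_measurable [measurable]: "t > 0 \<Longrightarrow> Zlim t \<in> borel_measurable \<Omega>"
  unfolding Zlim_def[abs_def] using Z_measurable[of t] by (intro borel_measurable_lim_metric) auto

text \<open>Choose \<open>k\<close> with \<open>T k w\<close> below \<open>t\<close>, necessarily
  \<open>n \<le> k\<close>. The limit at \<open>t\<close> is then \<open>Z k\<close> at a time
  smaller than \<open>\<sigma> n k w\<close>, where \<open>Z_lower\<close> applies.\<close>

lemma Zlim_lower:
  assumes w: "w \<in> space \<Omega>" "good w" and t: "0 < t" "ennreal t < T n w"
  shows "z n \<le> Zlim t w"
proof -
  obtain k where k: "T k w < ennreal t" using good_T w t by blast
  have "T k w < T n w" using k t(2) by (rule less_trans)
  then have nk: "n \<le> k" using T_antimono[of k n w] by (meson linorder_not_less nle_le)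
  have fin: "T k w < \<infinity>" using k by (rule less_trans) simp
  define a where "a = enn2real (T k w)"
  have a: "T k w = ennreal a" "a \<ge> 0" using fin by (auto simp: a_def)
  have at: "a < t" using k a by (simp add: ennreal_less_iff)
  have "ennreal (t - a) < \<sigma> n k w"
  proof (rule ccontr)
    assume "\<not> ennreal (t - a) < \<sigma> n k w"
    then have "T n w \<le> ennreal (t - a) + ennreal a"
      unfolding T_split[OF nk] a by (intro add_right_mono) simp
    also have "\<dots> = ennreal t" using at a by (simp add: ennreal_plus[symmetric] del: ennreal_plus)
    finally show False using t by simp
  qed
  then have "z n \<le> Z k (t - a) w" using at by (intro Z_lower nk) auto
  then show ?thesis using Zlim_eq[OF w(1) less_imp_le[OF k]] t by (simp add: a_def)
qed

text \<open>Off the good set the path is constantly 0, so that every \<open>w\<close>, not just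
  almost every one, yields a cadlag path finite at positive times, as \<open>path_space\<close>
  demands.\<close>

definition Y :: "(nat \<Rightarrow> 'a) \<Rightarrow> real \<Rightarrow> ennreal" where
  "Y w t = (if good w then if t \<le> 0 then top else ennreal (Zlim t w) else 0)"

lemma Y_measurable: "(\<lambda>w. Y w t) \<in> borel_measurable \<Omega>"
proof (cases "t \<le> 0")
  case True
  then have "(\<lambda>w. Y w t) = (\<lambda>w. if good w then top else 0)" by (auto simp: Y_def)
  then show ?thesis by simp
next
  case False
  then have [measurable]: "Zlim t \<in> borel_measurable \<Omega>" by simp
  have "(\<lambda>w. Y w t) = (\<lambda>w. if good w then ennreal (Zlim t w) else 0)" using False by (auto simp: Y_def)
  then show ?thesis by simp
qed

text \<open>For a level \<open>z n\<close> above the given bound, the path exceeds it on the whole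
  interval from 0 to \<open>T n w\<close>, which has positive length.\<close>

lemma Y_tendsto_0:
  assumes w: "w \<in> space \<Omega>" "good w"
  shows "(Y w \<longlongrightarrow> top) (at_right 0)"
  unfolding tendsto_top_iff_ennreal
proof (intro allI impI)
  fix l :: real assume "l \<ge> 0"
  have "\<forall>\<^sub>F n in sequentially. l < z n" using z_at_top by (auto simp: filterlim_at_top_dense)
  then obtain n where n: "l < z n" unfolding eventually_sequentially by blast
  obtain c where c: "c > 0" "ennreal c \<le> T n w"
  proof (cases "T n w")
    case (real r)
    then show ?thesis using good_T_pos[OF w(2), of n] that[of r] by simp
  next
    case top
    then show ?thesis using that[of 1] by simp
  qed
  show "\<forall>\<^sub>F s in at_right 0. ennreal l < Y w s"
    unfolding eventually_at_right_field
  proof (intro exI[of _ c] conjI allI impI)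
    fix s assume s: "0 < s" "s < c"
    have "ennreal s < T n w" using s c(2) by (intro less_le_trans[OF ennreal_lessI c(2)]) auto
    then have "l < Zlim s w" using Zlim_lower[OF w s(1), of n] n by simp
    then show "ennreal l < Y w s" using s \<open>l \<ge> 0\<close> w by (simp add: Y_def ennreal_lessI)
  qed (rule c(1))
qed

lemma Y_cadlag:
  assumes w: "w \<in> space \<Omega>"
  shows "cadlag (Y w)"
proof (cases "good w")
  case False
  then have "Y w = (\<lambda>_. 0)" by (auto simp: Y_def)
  then show ?thesis by (auto simp: cadlag_def)
next
  case True
  have pos: "(Y w \<longlongrightarrow> Y w t) (at_right t) \<and> (\<exists>l. (Y w \<longlongrightarrow> l) (at_left t))" if t: "t > 0" for t
  proof -
    obtain n where n: "T n w < ennreal t" using good_T True t by blast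
    have fin: "T n w < \<infinity>" using n by (rule less_trans) simp
    define a where "a = enn2real (T n w)"
    have a: "T n w = ennreal a" "a \<ge> 0" using fin by (auto simp: a_def)
    have at: "a < t" using n a by (simp add: ennreal_less_iff)
    have eq: "Y w s = ennreal (Z n (s - a) w)" if "a < s" for s
      using that True Zlim_eq[OF w, of n s] a by (simp add: Y_def)
    have cad: "cadlag (\<lambda>t. ennreal (Z n t w))"
      using Z_cadlag[OF w] by (rule cadlag_ennreal)
    show ?thesis using cadlag_from_shift[OF cad at, of "Y w"] eq by auto
  qed
  have "(Y w \<longlongrightarrow> Y w t) (at_right t)" if "t \<ge> 0" for t
  proof (cases "t = 0")
    case True
    then show ?thesis using Y_tendsto_0[OF w \<open>good w\<close>] \<open>good w\<close> by (simp add: Y_def)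
  next
    case False
    then show ?thesis using pos[of t] that by simp
  qed
  then show ?thesis using pos by (auto simp: cadlag_def)
qed

lemma Z_distr: "t \<ge> 0 \<Longrightarrow> distr \<Omega> borel (Z n t) = distr (Px (z n)) borel (X t)"
proof (rule measure_eqI)
  assume t: "t \<ge> 0"
  note Zm = Z_measurable[OF t, of n] and Xm = X_measurable[OF z_nonneg[of n] t]
  fix A assume A: "A \<in> sets (distr \<Omega> borel (Z n t))"
  then have [measurable]: "A \<in> sets borel" by simp
  let ?h = "\<lambda>w. indicator A (w t) :: ennreal"
  have h: "?h \<in> borel_measurable (PiM {0..} (\<lambda>_. borel))"
    using t by (intro measurable_compose[OF measurable_component_singleton]) auto
  have "(\<integral>\<^sup>+w. ?h (\<lambda>i\<in>{0..}. Z n i w) \<partial>\<Omega>) = (\<integral>\<^sup>+w. ?h (\<lambda>i\<in>{0..}. X i w) \<partial>Px (z n))"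
    by (rule same_law_integral[OF z_nonneg \<Omega>.prob_space_axioms Z_measurable Z_law h])
  then have "(\<integral>\<^sup>+w. indicator A (Z n t w) \<partial>\<Omega>) = (\<integral>\<^sup>+w. indicator A (X t w) \<partial>Px (z n))" using t by simp
  moreover have "(\<integral>\<^sup>+w. indicator A (Z n t w) \<partial>\<Omega>) = (\<integral>\<^sup>+y. indicator A y \<partial>distr \<Omega> borel (Z n t))"
    using Zm by (subst nn_integral_distr) auto
  moreover have "(\<integral>\<^sup>+w. indicator A (X t w) \<partial>Px (z n)) = (\<integral>\<^sup>+y. indicator A y \<partial>distr (Px (z n)) borel (X t))"
    using Xm by (subst nn_integral_distr) auto
  ultimately show "emeasure (distr \<Omega> borel (Z n t)) A = emeasure (distr (Px (z n)) borel (X t)) A" by simp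
qed simp

text \<open>Continuity of \<open>f\<close> is known on the half-line only, hence the truncation; it
  is invisible almost surely, since \<open>Zlim t\<close> is nonnegative on the good set.\<close>

lemma semigroup_tendsto:
  assumes f: "continuous_on {0..} f" "bounded (f ` {0..})" and t: "t > 0"
  shows "(\<lambda>n. semigroup Px X t f (z n)) \<longlonglongrightarrow> (\<integral>w. f (max 0 (Zlim t w)) \<partial>\<Omega>)"
proof -
  define g where "g x = f (max 0 x)" for x
  have g: "continuous_on UNIV g"
    unfolding g_def[abs_def] by (rule continuous_on_compose2[OF f(1)]) (auto intro!: continuous_intros)
  have [measurable]: "g \<in> borel_measurable borel" using g by (rule borel_measurable_continuous_onI)
  obtain C where C: "\<And>x. norm (g x) \<le> C"
  proof -
    from f(2) obtain C where "\<forall>x\<in>{0..}. norm (f x) \<le> C" unfolding bounded_iff by auto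
    then show ?thesis by (intro that[of C]) (simp add: g_def)
  qed
  have t0: "t \<ge> 0" using t by simp
  have [measurable]: "Zlim t \<in> borel_measurable \<Omega>" "Z n t \<in> borel_measurable \<Omega>" for n
    using t by (auto intro: Z_measurable)
  have "semigroup Px X t f (z n) = (\<integral>w. g (Z n t w) \<partial>\<Omega>)" for n
  proof -
    have [measurable]: "X t \<in> borel_measurable (Px (z n))" by (rule X_measurable[OF z_nonneg t0])
    have "semigroup Px X t f (z n) = (\<integral>\<omega>. g (X t \<omega>) \<partial>Px (z n))"
      unfolding semigroup_def g_def using X_nonneg[OF z_nonneg _ t0, of _ n]
      by (intro Bochner_Integration.integral_cong) auto
    also have "\<dots> = (\<integral>y. g y \<partial>distr (Px (z n)) borel (X t))"
      by (rule integral_distr[symmetric]) auto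
    also have "\<dots> = (\<integral>w. g (Z n t w) \<partial>\<Omega>)"
      unfolding Z_distr[OF t0, symmetric] by (rule integral_distr) auto
    finally show ?thesis .
  qed
  moreover have "(\<lambda>n. \<integral>w. g (Z n t w) \<partial>\<Omega>) \<longlonglongrightarrow> (\<integral>w. g (Zlim t w) \<partial>\<Omega>)"
  proof (rule integral_dominated_convergence[where w="\<lambda>_. C"])
    show "AE w in \<Omega>. (\<lambda>n. g (Z n t w)) \<longlonglongrightarrow> g (Zlim t w)"
      using AE_good
    proof (rule AE_mp, intro AE_I2 impI)
      fix w assume w: "w \<in> space \<Omega>" "good w"
      show "(\<lambda>n. g (Z n t w)) \<longlonglongrightarrow> g (Zlim t w)"
        using continuous_on_tendsto_compose[OF g Zlim_tendsto[OF w t]] by simp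
    qed
  qed (use C in auto)
  ultimately show ?thesis by (simp add: g_def)
qed

lemma prod_eval_Z_tendsto:
  assumes l: "ok_list {0<..} cont_fns l"
  shows "(\<lambda>n. \<integral>\<^sup>+w. prod_eval (Z n) w l \<partial>\<Omega>) \<longlonglongrightarrow> (\<integral>\<^sup>+w. prod_eval Zlim w l \<partial>\<Omega>)"
proof (rule nn_integral_dominated_convergence[where w="\<lambda>_. 1"])
  have lu: "ok_list {0<..} unit_fns l" using l cont_fns_unit by (rule ok_list_mono)
  show "(\<lambda>w. prod_eval (Z n) w l) \<in> borel_measurable \<Omega>" for n
    by (intro prod_eval_measurable[OF _ lu] Z_measurable) auto
  show "(\<lambda>w. prod_eval Zlim w l) \<in> borel_measurable \<Omega>"
    by (intro prod_eval_measurable[OF _ lu] Zlim_measurable) auto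
  show "AE w in \<Omega>. prod_eval (Z n) w l \<le> 1" for n
    by (rule AE_I2) (rule prod_eval_le_1[OF lu])
  show "AE w in \<Omega>. (\<lambda>n. prod_eval (Z n) w l) \<longlonglongrightarrow> prod_eval Zlim w l"
    using AE_good
  proof (rule AE_mp, intro AE_I2 impI)
    fix w assume w: "w \<in> space \<Omega>" "good w"
    show "(\<lambda>n. prod_eval (Z n) w l) \<longlonglongrightarrow> prod_eval Zlim w l"
      by (rule prod_eval_tendsto[OF l]) (auto intro: Zlim_tendsto[OF w])
  qed
qed (auto simp: \<Omega>.emeasure_space_1)

text \<open>For continuous slots the Markov property of the processes from \<open>z n\<close> passes
  to the limit; \<open>ok_list_extend\<close> then covers all slots. Positivity of \<open>s\<close>
  matters because \<open>Z n\<close> is known to converge only at positive times.\<close>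

lemma markov_Zlim:
  assumes s: "s > 0" and l: "ok_list {0..} unit_fns l"
  shows "(\<integral>\<^sup>+w. prod_eval (\<lambda>t. Zlim (s + t)) w (cumul 0 l) \<partial>\<Omega>) = (\<integral>\<^sup>+w. fdd Px X (max 0 (Zlim s w)) l \<partial>\<Omega>)"
proof (rule ok_list_extend[where I="{0..}" and K=cont_fns and l=l])
  have Zm: "Zlim (s + t) \<in> borel_measurable \<Omega>" if "t \<in> {0..}" for t using that s by simp
  show "nn_functional (\<lambda>f. \<integral>\<^sup>+w. prod_eval (\<lambda>t. Zlim (s + t)) w (cumul 0 (l1 @ (u, f) # l2)) \<partial>\<Omega>)"
    if ok: "ok_list {0..} unit_fns (l1 @ l2)" and u: "u \<in> {0..}" for l1 u l2
  proof -
    have "0 \<le> (\<Sum>(s, f)\<leftarrow>l1. s)" using ok by (induction l1) auto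
    then show ?thesis
      unfolding cumul_append cumul.simps using ok u
      by (intro nn_functional_prod_eval[where I="{0..}"] Zm) (auto intro!: ok_list_cumul)
  qed
  show "nn_functional (\<lambda>f. \<integral>\<^sup>+w. fdd Px X (max 0 (Zlim s w)) (l1 @ (u, f) # l2) \<partial>\<Omega>)"
    if ok: "ok_list {0..} unit_fns (l1 @ l2)" and u: "u \<in> {0..}" for l1 u l2
  proof -
    have okb: "ok_list {0..} (borel_measurable borel) (l1 @ l2)" using ok unit_fns_borel by (rule ok_list_mono)
    have "nn_functional (\<lambda>f. \<integral>\<^sup>+w. 1 * fdd Px X (max 0 (Zlim s w)) (l1 @ (u, f) # l2) \<partial>\<Omega>)"
    proof (rule nn_functional_mixture)
      show "(\<lambda>w. fdd Px X (max 0 (Zlim s w)) (l1 @ (u, f) # l2)) \<in> borel_measurable \<Omega>"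
        if "f \<in> borel_measurable borel" for f
        using okb u that s by (intro measurable_compose[OF Zlim_measurable fdd_measurable]) auto
      show "nn_functional (\<lambda>f. fdd Px X (max 0 (Zlim s w)) (l1 @ (u, f) # l2))" for w
        using okb u by (intro nn_functional_fdd) auto
    qed simp
    then show ?thesis by simp
  qed
  show "(\<integral>\<^sup>+w. prod_eval (\<lambda>t. Zlim (s + t)) w (cumul 0 l) \<partial>\<Omega>) < \<infinity>" if "ok_list {0..} unit_fns l" for l
    using \<Omega>.finite_measure_axioms ok_list_cumul[OF order_refl that] by (rule nn_integral_prod_eval_finite)
  show "(\<integral>\<^sup>+w. prod_eval (\<lambda>t. Zlim (s + t)) w (cumul 0 l) \<partial>\<Omega>) = (\<integral>\<^sup>+w. fdd Px X (max 0 (Zlim s w)) l \<partial>\<Omega>)"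
    if l: "ok_list {0..} cont_fns l" for l
  proof -
    have lu: "ok_list {0..} unit_fns l" using l cont_fns_unit by (rule ok_list_mono)
    define L where "L = cumul 0 l"
    have L: "ok_list {0..} cont_fns L" "ok_list {0..} unit_fns L"
      unfolding L_def using l lu by (auto intro!: ok_list_cumul)
    define K where "K = expect_from L"
    have K: "K \<in> cont_fns" unfolding K_def using L(1) by (rule expect_from_cont_fns)
    have "(\<lambda>n. \<integral>\<^sup>+w. prod_eval (Z n) w (shift_list s L) \<partial>\<Omega>) \<longlonglongrightarrow> (\<integral>\<^sup>+w. prod_eval Zlim w (shift_list s L) \<partial>\<Omega>)"
      using L s by (intro prod_eval_Z_tendsto) (auto simp: ok_list_def shift_list_def)
    moreover have "(\<lambda>n. \<integral>\<^sup>+w. prod_eval (Z n) w [(s, K)] \<partial>\<Omega>) \<longlonglongrightarrow> (\<integral>\<^sup>+w. prod_eval Zlim w [(s, K)] \<partial>\<Omega>)"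
      using K s by (intro prod_eval_Z_tendsto) auto
    moreover have "(\<integral>\<^sup>+w. prod_eval (Z n) w (shift_list s L) \<partial>\<Omega>) = (\<integral>\<^sup>+w. prod_eval (Z n) w [(s, K)] \<partial>\<Omega>)" for n
    proof -
      have "(\<integral>\<^sup>+w. prod_eval (Z n) w (shift_list s L) \<partial>\<Omega>) = expect_from (shift_list s L) (z n)"
        using Z_law[of n] ok_list_shift[OF _ L(1), of s] s by (simp add: same_law_def)
      \<comment> \<open>The Markov property at time \<open>s\<close> with an empty past.\<close>
      also have "\<dots> = expect_from [(s, K)] (z n)"
        using markov_property[OF z_nonneg[of n], of s "[]" L] s L z_nonneg[of n]
        by (simp add: expect_from_def prod_eval_shift K_def)
      also have "\<dots> = (\<integral>\<^sup>+w. prod_eval (Z n) w [(s, K)] \<partial>\<Omega>)"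
        using Z_law[of n] K s unfolding same_law_def by (auto simp del: prod_eval_simps)
      finally show ?thesis .
    qed
    ultimately have "(\<integral>\<^sup>+w. prod_eval Zlim w (shift_list s L) \<partial>\<Omega>) = (\<integral>\<^sup>+w. prod_eval Zlim w [(s, K)] \<partial>\<Omega>)"
      using LIMSEQ_unique by simp
    moreover have "K y = fdd Px X (max 0 y) l" for y
      unfolding K_def expect_from_def L_def using lu by (intro integral_prod_eval_cumul) auto
    ultimately show ?thesis by (simp add: prod_eval_shift L_def)
  qed
qed (auto intro: l determining_cont_fns)

end

subsection \<open>The extended process\<close>

lemma cadlag_cong:
  assumes f: "cadlag f" and eq: "\<And>t. t \<ge> 0 \<Longrightarrow> g t = f t"
  shows "cadlag g"
  unfolding cadlag_def
proof safe
  fix t :: real assume t: "t \<ge> 0"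
  have "(f \<longlongrightarrow> g t) (at_right t)" using f t eq by (simp add: cadlag_def)
  moreover have "\<forall>\<^sub>F s in at_right t. f s = g s"
    unfolding eventually_at_right_field using t eq by (auto intro!: exI[of _ "t + 1"])
  ultimately show "(g \<longlongrightarrow> g t) (at_right t)" by (rule Lim_transform_eventually)
next
  fix t :: real assume t: "t > 0"
  then obtain l where "(f \<longlongrightarrow> l) (at_left t)" using f unfolding cadlag_def by blast
  moreover have "\<forall>\<^sub>F s in at_left t. f s = g s"
    unfolding eventually_at_left_field using t eq by (auto intro!: exI[of _ 0])
  ultimately have "(g \<longlongrightarrow> l) (at_left t)" by (rule Lim_transform_eventually)
  then show "\<exists>l. (g \<longlongrightarrow> l) (at_left t)" ..
qed

lemma bounded_range_ennreal:
  fixes f :: "ennreal \<Rightarrow> real"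
  assumes "continuous_on UNIV f"
  obtains C where "\<And>x. norm (f x) \<le> C"
proof -
  have "compact (range f)" using assms compact_UNIV by (rule compact_continuous_image)
  then show ?thesis using that compact_imp_bounded[of "range f"] by (auto simp: bounded_iff)
qed

text \<open>The filter must exclude the point \<open>top\<close> itself, where
  \<open>enn2real\<close> takes the default value 0.\<close>

lemma enn2real_at_top: "filterlim enn2real at_top (at (top::ennreal))"
  unfolding filterlim_at_top_dense
proof
  fix C :: real
  obtain D where D: "C \<le> D" "0 \<le> D" using max.cobounded1 max.cobounded2 by blast
  have "((\<lambda>y. y) \<longlongrightarrow> (top::ennreal)) (at top)" by (rule tendsto_ident_at)
  then have "\<forall>\<^sub>F y in at (top::ennreal). ennreal D < y" by (rule order_tendstoD) simp
  moreover have "\<forall>\<^sub>F y in at (top::ennreal). y \<noteq> top" by (simp add: eventually_at_filter)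
  ultimately show "\<forall>\<^sub>F y in at (top::ennreal). C < enn2real y"
  proof eventually_elim
    case (elim y)
    then show ?case using D by (cases y) (auto simp: ennreal_less_iff)
  qed
qed

text \<open>Finiteness at positive times is built into the space because, as an uncountable intersection, it
  is not evidently an event of the product \<open>\<sigma>\<close>-algebra.\<close>

definition path_space :: "(real \<Rightarrow> ennreal) measure" where
  "path_space = restrict_space (PiM UNIV (\<lambda>_. borel)) {w. cadlag w \<and> (\<forall>t>0. w t < top)}"

lemma space_path_space: "space path_space = {w. cadlag w \<and> (\<forall>t>0. w t < top)}"
  by (auto simp: path_space_def space_restrict_space space_PiM)

lemma coordinate_measurable [measurable]: "(\<lambda>w. w t) \<in> borel_measurable path_space"
  unfolding path_space_def by (intro measurable_restrict_space1 measurable_component_singleton) simp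

lemma path_space_measurableI:
  assumes "\<And>t. (\<lambda>\<omega>. F \<omega> t) \<in> borel_measurable M"
    and "\<And>\<omega>. \<omega> \<in> space M \<Longrightarrow> cadlag (F \<omega>) \<and> (\<forall>t>0. F \<omega> t < top)"
  shows "F \<in> measurable M path_space"
  unfolding path_space_def
proof (rule measurable_restrict_space2)
  have "(\<lambda>\<omega> i. F \<omega> i) \<in> measurable M (PiM UNIV (\<lambda>_. borel))"
    by (rule measurable_PiM_single') (auto simp: assms(1))
  then show "F \<in> measurable M (PiM UNIV (\<lambda>_. borel))" by simp
qed (use assms(2) in auto)

lemma mp_event_measurable:
  "(\<And>s A. (s, A) \<in> set l \<Longrightarrow> A \<in> sets borel) \<Longrightarrow> {w\<in>space path_space. mp_event (\<lambda>t \<omega>. \<omega> t) w t0 l} \<in> sets path_space"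
proof (induction l arbitrary: t0)
  case (Cons p l)
  obtain s A where p: "p = (s, A)" by (cases p)
  have "{w\<in>space path_space. mp_event (\<lambda>t \<omega>. \<omega> t) w t0 (p # l)}
     = ((\<lambda>w. w (t0 + s)) -` A \<inter> space path_space) \<inter> {w\<in>space path_space. mp_event (\<lambda>t \<omega>. \<omega> t) w (t0 + s) l}"
    by (auto simp: p)
  also have "\<dots> \<in> sets path_space"
    using Cons p by (intro sets.Int measurable_sets[OF coordinate_measurable] Cons.IH) auto
  finally show ?case .
qed simp

text \<open>Translates events about the extended state space into events about the real-valued
  process.\<close>

definition pull :: "(real \<times> ennreal set) list \<Rightarrow> (real \<times> real set) list" where
  "pull l = map (\<lambda>(s, A). (s, ennreal -` A)) l"

lemma pull_sets:
  assumes "\<And>s A. (s, A) \<in> set l \<Longrightarrow> s \<ge> 0 \<and> A \<in> sets borel"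
  shows "(s, A) \<in> set (pull l) \<Longrightarrow> s \<ge> 0 \<and> A \<in> sets borel"
  using assms measurable_sets[of ennreal borel borel] by (fastforce simp: pull_def)

lemma ok_list_pull:
  assumes "\<And>s A. (s, A) \<in> set l \<Longrightarrow> s \<ge> 0 \<and> A \<in> sets borel"
  shows "ok_list {0..} unit_fns (map (\<lambda>(s, A). (s, indicator A)) (pull l))"
  using pull_sets[OF assms] by (fastforce simp: ok_list_def unit_fns_def indicator_def)

context entrance_seq
begin

text \<open>Two sequences tending to infinity can be interleaved into a third one, so convergence along
  every admissible sequence already yields a limit independent of the sequence.\<close>

lemma semigroup_at_top:
  assumes f: "continuous_on {0..} f" "bounded (f ` {0..})" and t: "t > 0"
  shows "(semigroup Px X t f \<longlongrightarrow> (\<integral>w. f (max 0 (Zlim t w)) \<partial>\<Omega>)) at_top"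
proof (rule ccontr)
  define F where "F = semigroup Px X t f"
  define L where "L = (\<integral>w. f (max 0 (Zlim t w)) \<partial>\<Omega>)"
  have limz: "(\<lambda>n. F (z n)) \<longlonglongrightarrow> L" unfolding F_def L_def by (rule semigroup_tendsto[OF f t])
  assume "\<not> (semigroup Px X t f \<longlongrightarrow> (\<integral>w. f (max 0 (Zlim t w)) \<partial>\<Omega>)) at_top"
  then have "\<not> (F \<longlongrightarrow> L) at_top" by (simp add: F_def L_def)
  then obtain e where e: "e > 0" "\<not> (\<forall>\<^sub>F x in at_top. dist (F x) L < e)" by (auto simp: tendsto_iff)
  have far: "\<exists>x\<ge>N. e \<le> dist (F x) L" for N
    using e(2) by (auto simp: eventually_at_top_linorder not_less)
  have zfar: "\<exists>k. N \<le> z k" for N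
  proof -
    have "\<forall>\<^sub>F k in sequentially. N \<le> z k" using z_at_top by (auto simp: filterlim_at_top)
    then show ?thesis unfolding eventually_sequentially by blast
  qed
  define P where "P n x \<longleftrightarrow> x \<ge> 0 \<and> (if even n then x \<in> range z else e \<le> dist (F x) L)" for n :: nat and x :: real
  \<comment> \<open>Even positions come from \<open>z\<close>, odd ones from points where
    \<open>F\<close> stays away from \<open>L\<close>. Gaps of at least 1 make \<open>y\<close>
    strictly increasing and force it to infinity.\<close>
  have "\<exists>y. \<forall>n. P n (y n) \<and> y n + 1 \<le> y (Suc n)"
  proof (rule dependent_nat_choice)
    show "\<exists>x. P 0 x" using z_nonneg by (auto simp: P_def)
    fix x n assume "P n x"
    then have x: "x \<ge> 0" by (simp add: P_def)
    obtain x1 where x1: "x1 \<ge> x + 1" "e \<le> dist (F x1) L" using far by blast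
    obtain k where k: "x + 1 \<le> z k" using zfar by blast
    show "\<exists>y. P (Suc n) y \<and> x + 1 \<le> y"
    proof (cases "even n")
      case True
      then show ?thesis using x x1 by (intro exI[of _ x1]) (simp add: P_def)
    next
      case False
      then show ?thesis using x k by (intro exI[of _ "z k"]) (simp add: P_def)
    qed
  qed
  then obtain y where y: "\<And>n. P n (y n)" "\<And>n. y n + 1 \<le> y (Suc n)" by blast
  have y_ge: "real n \<le> y n" for n
  proof (induction n)
    case 0
    show ?case using y(1)[of 0] by (simp add: P_def)
  next
    case (Suc n)
    then show ?case using y(2)[of n] by simp
  qed
  interpret y: entrance_seq Px X y
  proof
    show "0 \<le> y n" for n using y(1) by (simp add: P_def)
    show "y n < y (Suc n)" for n using y(2)[of n] by simp
    show "filterlim y at_top sequentially"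
      by (rule filterlim_at_top_mono[OF filterlim_real_sequentially]) (simp add: y_ge)
  qed
  \<comment> \<open>Along \<open>y\<close> the values converge: the even positions identify the
    limit as \<open>L\<close>, which the odd positions contradict.\<close>
  obtain l where l: "(\<lambda>n. F (y n)) \<longlonglongrightarrow> l"
    using y.semigroup_tendsto[OF f t] unfolding F_def by blast
  obtain k where k: "\<And>j. y (2 * j) = z (k j)"
  proof -
    have "\<forall>j. \<exists>k. y (2 * j) = z k" using y(1)[of "2 * _"] by (auto simp: P_def)
    then show ?thesis using that by metis
  qed
  have "strict_mono k"
  proof (rule strict_monoI_Suc)
    fix j
    have "y (2 * j) < y (2 * Suc j)" using y(2)[of "2 * j"] y(2)[of "Suc (2 * j)"] by simp
    then have "z (k j) < z (k (Suc j))" by (simp only: k)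
    then show "k j < k (Suc j)" using z_mono[of "k (Suc j)" "k j"] by (meson linorder_not_less)
  qed
  then have "(\<lambda>j. F (z (k j))) \<longlonglongrightarrow> L" using LIMSEQ_subseq_LIMSEQ[OF limz] by (simp add: o_def)
  moreover have "(\<lambda>j. F (y (2 * j))) \<longlonglongrightarrow> l"
    using LIMSEQ_subseq_LIMSEQ[OF l, of "\<lambda>j. 2 * j"] by (simp add: o_def strict_mono_def)
  ultimately have "l = L" using LIMSEQ_unique by (simp add: k)
  moreover have "(\<lambda>j. F (y (Suc (2 * j)))) \<longlonglongrightarrow> l"
    using LIMSEQ_subseq_LIMSEQ[OF l, of "\<lambda>j. Suc (2 * j)"] by (simp add: o_def strict_mono_def)
  ultimately have "\<forall>\<^sub>F j in sequentially. dist (F (y (Suc (2 * j)))) L < e" using e(1) by (simp add: tendstoD)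
  then obtain j where "dist (F (y (Suc (2 * j)))) L < e" unfolding eventually_sequentially by blast
  then show False using y(1)[of "Suc (2 * j)"] by (simp add: P_def)
qed

section \<open>The laws on path space and their Markov property\<close>

definition embed :: "'a \<Rightarrow> real \<Rightarrow> ennreal" where
  "embed \<omega> t = (if t < 0 then 0 else ennreal (X t \<omega>))"

definition Q :: "ennreal \<Rightarrow> (real \<Rightarrow> ennreal) measure" where
  "Q x = (if x = top then distr \<Omega> path_space Y else distr (Px (enn2real x)) path_space embed)"

abbreviation "coord \<equiv> (\<lambda>(t::real) (\<omega> :: real \<Rightarrow> ennreal). \<omega> t)"

lemma Q_top: "Q top = distr \<Omega> path_space Y" by (simp add: Q_def)

lemma Q_real: "x \<ge> 0 \<Longrightarrow> Q (ennreal x) = distr (Px x) path_space embed" by (simp add: Q_def)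

lemma space_Q [simp]: "space (Q x) = space path_space" and sets_Q [simp]: "sets (Q x) = sets path_space"
  by (simp_all add: Q_def)

lemma Y_path_measurable: "Y \<in> measurable \<Omega> path_space"
  using Y_measurable Y_cadlag by (intro path_space_measurableI) (auto simp: Y_def)

lemma embed_measurable: "x \<ge> 0 \<Longrightarrow> embed \<in> measurable (Px x) path_space"
proof (rule path_space_measurableI)
  assume x: "x \<ge> 0"
  show "(\<lambda>\<omega>. embed \<omega> t) \<in> borel_measurable (Px x)" for t
    unfolding embed_def using X_measurable[OF x, of t] by (cases "t < 0") auto
  show "cadlag (embed \<omega>) \<and> (\<forall>t>0. embed \<omega> t < top)" if "\<omega> \<in> space (Px x)" for \<omega>
    using cadlag_cong[OF cadlag_ennreal[OF cadlag_paths[OF x that]], of "embed \<omega>"] by (auto simp: embed_def)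
qed

lemma Q_prob: "prob_space (Q x)"
proof (cases x)
  case (real r)
  then show ?thesis
    using prob_space.prob_space_distr[OF prob[of r] embed_measurable[of r]] by (simp add: Q_real)
next
  case top
  then show ?thesis using \<Omega>.prob_space_distr[OF Y_path_measurable] by (simp add: Q_top)
qed

lemma nn_integral_Q_real:
  assumes "x \<ge> 0" "h \<in> borel_measurable path_space"
  shows "(\<integral>\<^sup>+w. h w \<partial>Q (ennreal x)) = (\<integral>\<^sup>+\<omega>. h (embed \<omega>) \<partial>Px x)"
  unfolding Q_real[OF assms(1)] using embed_measurable[OF assms(1)] assms(2) by (intro nn_integral_distr) auto

lemma nn_integral_Q_top:
  assumes "h \<in> borel_measurable path_space"
  shows "(\<integral>\<^sup>+w. h w \<partial>Q top) = (\<integral>\<^sup>+w. h (Y w) \<partial>\<Omega>)"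
  unfolding Q_top using Y_path_measurable assms by (intro nn_integral_distr) auto

lemma Q_start: "AE w in Q x. w 0 = x"
proof (cases x)
  case (real r)
  have "AE w in distr (Px r) path_space embed. w 0 = ennreal r"
  proof (subst AE_distr_iff[OF embed_measurable])
    show "AE \<omega> in Px r. embed \<omega> 0 = ennreal r"
      using X_0[OF real(1)] by eventually_elim (simp add: embed_def)
  qed (use real in measurable)
  then show ?thesis unfolding real(2) Q_real[OF real(1)] .
next
  case top
  have "AE w in distr \<Omega> path_space Y. w 0 = top"
  proof (subst AE_distr_iff[OF Y_path_measurable])
    show "AE w in \<Omega>. Y w 0 = top"
      using AE_good by eventually_elim (simp add: Y_def)
  qed measurable
  then show ?thesis unfolding top Q_top .
qed

text \<open>Apart from the single point \<open>top\<close>, the function is a Borel function of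
  \<open>enn2real\<close>. The first hypothesis is exactly what the induction in
  \<open>mp_fdd_Q_real\<close> supplies for shorter lists.\<close>

lemma mp_fdd_Q_measurable:
  assumes "\<And>x. x \<ge> 0 \<Longrightarrow> mp_fdd Q coord (ennreal x) l = mp_fdd Px X x (pull l)"
    and l: "\<And>s A. (s, A) \<in> set l \<Longrightarrow> s \<ge> 0 \<and> A \<in> sets borel"
  shows "(\<lambda>y. mp_fdd Q coord y l) \<in> borel_measurable borel"
proof -
  have [measurable]: "(\<lambda>y. fdd Px X (max 0 y) (map (\<lambda>(s, A). (s, indicator A)) (pull l))) \<in> borel_measurable borel"
    by (intro fdd_measurable ok_list_mono[OF ok_list_pull[OF l] unit_fns_borel])
  have "mp_fdd Q coord y l = (if y = top then mp_fdd Q coord top l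
      else fdd Px X (max 0 (enn2real y)) (map (\<lambda>(s, A). (s, indicator A)) (pull l)))" for y
    by (cases y) (auto simp: assms(1) fdd_indicators)
  then have eq: "(\<lambda>y. mp_fdd Q coord y l) = (\<lambda>y. if y = top then mp_fdd Q coord top l
      else fdd Px X (max 0 (enn2real y)) (map (\<lambda>(s, A). (s, indicator A)) (pull l)))" by (rule ext)
  show ?thesis unfolding eq by measurable
qed

text \<open>From a finite starting point the embedded process stays finite, so the recursion never
  meets the law from \<open>top\<close>.\<close>

lemma mp_fdd_Q_real:
  assumes "\<And>s A. (s, A) \<in> set l \<Longrightarrow> s \<ge> 0 \<and> A \<in> sets borel" "x \<ge> 0"
  shows "mp_fdd Q coord (ennreal x) l = mp_fdd Px X x (pull l)"
  using assms
proof (induction l arbitrary: x)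
  case Nil
  then show ?case by (simp add: pull_def)
next
  case (Cons p l)
  obtain s A where p: "p = (s, A)" by (cases p)
  have s: "s \<ge> 0" and [measurable]: "A \<in> sets borel" using Cons.prems(1)[of s A] by (auto simp: p)
  have IH: "mp_fdd Q coord (ennreal x) l = mp_fdd Px X x (pull l)" if "x \<ge> 0" for x
    using Cons that by auto
  have [measurable]: "(\<lambda>y. mp_fdd Q coord y l) \<in> borel_measurable borel"
    using IH Cons.prems(1) by (intro mp_fdd_Q_measurable) auto
  have "mp_fdd Q coord (ennreal x) (p # l) = (\<integral>\<^sup>+\<omega>. indicator A (embed \<omega> s) * mp_fdd Q coord (embed \<omega> s) l \<partial>Px x)"
    unfolding p mp_fdd.simps using Cons.prems(2) by (intro nn_integral_Q_real) measurable
  also have "\<dots> = (\<integral>\<^sup>+\<omega>. indicator (ennreal -` A) (X s \<omega>) * mp_fdd Px X (X s \<omega>) (pull l) \<partial>Px x)"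
    using s X_nonneg[OF Cons.prems(2) _ s]
    by (intro nn_integral_cong) (auto simp: embed_def IH split: split_indicator)
  finally show ?case by (simp add: p pull_def)
qed

lemma mp_event_embed:
  assumes "\<And>s A. (s, A) \<in> set l \<Longrightarrow> s \<ge> 0" "t0 \<ge> 0"
  shows "mp_event coord (embed \<omega>) t0 l \<longleftrightarrow> mp_event X \<omega> t0 (pull l)"
  using assms
proof (induction l arbitrary: t0)
  case (Cons p l)
  obtain s A where p: "p = (s, A)" by (cases p)
  have s: "s \<ge> 0" using Cons.prems(1)[of s A] by (simp add: p)
  then have "mp_event coord (embed \<omega>) (t0 + s) l \<longleftrightarrow> mp_event X \<omega> (t0 + s) (pull l)"
    using Cons.prems by (intro Cons.IH) auto
  moreover have "embed \<omega> (t0 + s) = ennreal (X (t0 + s) \<omega>)" using s Cons.prems by (simp add: embed_def)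
  ultimately show ?case by (simp add: p pull_def)
qed (simp add: pull_def)

text \<open>A positive offset \<open>u\<close> keeps all times away from 0, the only nonnegative
  time at which a good path differs from \<open>Zlim\<close>.\<close>

lemma mp_event_Y:
  assumes "\<And>s A. (s, A) \<in> set l \<Longrightarrow> s \<ge> 0" "t0 \<ge> 0" "u > 0" "good w"
  shows "mp_event coord (Y w) (u + t0) l \<longleftrightarrow> mp_event (\<lambda>t. Zlim (u + t)) w t0 (pull l)"
  using assms
proof (induction l arbitrary: t0)
  case (Cons p l)
  obtain s A where p: "p = (s, A)" by (cases p)
  have s: "s \<ge> 0" using Cons.prems(1)[of s A] by (simp add: p)
  then have "mp_event coord (Y w) (u + (t0 + s)) l \<longleftrightarrow> mp_event (\<lambda>t. Zlim (u + t)) w (t0 + s) (pull l)"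
    using Cons.prems by (intro Cons.IH) auto
  moreover have "Y w (u + (t0 + s)) = ennreal (Zlim (u + (t0 + s)) w)" using s Cons.prems by (simp add: Y_def)
  ultimately show ?case by (simp add: p pull_def add.assoc)
qed (simp add: pull_def)

lemma Q_markov_real:
  assumes l: "\<And>s A. (s, A) \<in> set l \<Longrightarrow> s \<ge> 0 \<and> A \<in> sets borel" and x: "x \<ge> 0"
  shows "emeasure (Q (ennreal x)) {w\<in>space (Q (ennreal x)). mp_event coord w 0 l} = mp_fdd Q coord (ennreal x) l"
proof -
  have B: "{w\<in>space path_space. mp_event coord w 0 l} \<in> sets path_space"
    using l by (intro mp_event_measurable) auto
  have "emeasure (Q (ennreal x)) {w\<in>space (Q (ennreal x)). mp_event coord w 0 l}
     = emeasure (Px x) (embed -` {w\<in>space path_space. mp_event coord w 0 l} \<inter> space (Px x))"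
    unfolding space_Q unfolding Q_real[OF x] by (rule emeasure_distr[OF embed_measurable[OF x] B])
  also have "embed -` {w\<in>space path_space. mp_event coord w 0 l} \<inter> space (Px x) = {\<omega>\<in>space (Px x). mp_event X \<omega> 0 (pull l)}"
    using measurable_space[OF embed_measurable[OF x]] mp_event_embed[of l 0] l by auto
  also have "emeasure (Px x) \<dots> = mp_fdd Px X x (pull l)"
    using pull_sets[OF l] by (intro mp_event_eq x) auto
  finally show ?thesis using mp_fdd_Q_real[OF l x] by simp
qed

text \<open>Leading zero increments are peeled off by induction; the first positive increment brings
  the process to a finite state, where \<open>markov_Zlim\<close> takes over.\<close>

lemma Q_markov_top:
  assumes "\<And>s A. (s, A) \<in> set l \<Longrightarrow> s \<ge> 0 \<and> A \<in> sets borel"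
  shows "emeasure (Q top) {w\<in>space (Q top). mp_event coord w 0 l} = mp_fdd Q coord top l"
  using assms
proof (induction l)
  case Nil
  then show ?case using prob_space.emeasure_space_1[OF Q_prob[of top]] by simp
next
  case (Cons p l)
  obtain s A where p: "p = (s, A)" by (cases p)
  have s: "s \<ge> 0" and A[measurable]: "A \<in> sets borel" using Cons.prems(1)[of s A] by (auto simp: p)
  have l: "\<And>s A. (s, A) \<in> set l \<Longrightarrow> s \<ge> 0 \<and> A \<in> sets borel" using Cons.prems by auto
  define B where "B u = {w\<in>space path_space. mp_event coord w u l}" for u
  have Bm[measurable]: "B u \<in> sets path_space" for u
    unfolding B_def using l by (intro mp_event_measurable) auto
  have fm[measurable]: "(\<lambda>y. mp_fdd Q coord y l) \<in> borel_measurable borel"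
    using mp_fdd_Q_real[OF l] l by (intro mp_fdd_Q_measurable) auto
  have lhs: "emeasure (Q top) {w\<in>space (Q top). mp_event coord w 0 (p # l)} = (\<integral>\<^sup>+w. indicator A (w s) * indicator (B s) w \<partial>Q top)"
  proof -
    have "{w\<in>space (Q top). mp_event coord w 0 (p # l)} \<in> sets path_space"
      using Cons.prems unfolding space_Q by (intro mp_event_measurable) auto
    then have "emeasure (Q top) {w\<in>space (Q top). mp_event coord w 0 (p # l)}
       = (\<integral>\<^sup>+w. indicator {w\<in>space (Q top). mp_event coord w 0 (p # l)} w \<partial>Q top)" by simp
    also have "\<dots> = (\<integral>\<^sup>+w. indicator A (w s) * indicator (B s) w \<partial>Q top)"
      by (intro nn_integral_cong) (auto simp: p B_def split: split_indicator)
    finally show ?thesis .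
  qed
  show ?case
  \<comment> \<open>At time 0 the position is almost surely \<open>top\<close>, so the slot is a
    constant factor.\<close>
  proof (cases "s = 0")
    case True
    have "(\<integral>\<^sup>+w. indicator A (w s) * indicator (B s) w \<partial>Q top) = (\<integral>\<^sup>+w. indicator A top * indicator (B 0) w \<partial>Q top)"
      using Q_start[of top] True by (intro nn_integral_cong_AE) auto
    also have "\<dots> = indicator A top * emeasure (Q top) (B 0)"
      using Bm[of 0] by (simp add: nn_integral_cmult_indicator)
    also have "emeasure (Q top) (B 0) = mp_fdd Q coord top l"
      using Cons.IH l by (simp add: B_def)
    also have "indicator A top * mp_fdd Q coord top l = (\<integral>\<^sup>+w. indicator A top * mp_fdd Q coord top l \<partial>Q top)"
      using prob_space.emeasure_space_1[OF Q_prob[of top]] by simp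
    also have "\<dots> = (\<integral>\<^sup>+w. indicator A (w s) * mp_fdd Q coord (w s) l \<partial>Q top)"
      using Q_start[of top] True by (intro nn_integral_cong_AE) auto
    finally show ?thesis using lhs by (simp add: p)
  next
    case False
    then have s: "s > 0" using s by simp
    \<comment> \<open>The zero increment in front records the position at time \<open>s\<close>
      itself; the remaining times are counted from \<open>s\<close>.\<close>
    define L where "L = (0, indicator (ennreal -` A)) # map (\<lambda>(s, A). (s, indicator A :: real \<Rightarrow> ennreal)) (pull l)"
    have L: "ok_list {0..} unit_fns L"
    proof -
      have "ok_list {0..} unit_fns (map (\<lambda>(s, A). (s, indicator A :: real \<Rightarrow> ennreal)) (pull ((0, A) # l)))"
        using l A by (intro ok_list_pull) auto
      then show ?thesis by (simp add: L_def pull_def)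
    qed
    have "(\<integral>\<^sup>+w. indicator A (w s) * indicator (B s) w \<partial>Q top) = (\<integral>\<^sup>+w. indicator A (Y w s) * indicator (B s) (Y w) \<partial>\<Omega>)"
      by (rule nn_integral_Q_top) measurable
    also have "\<dots> = (\<integral>\<^sup>+w. prod_eval (\<lambda>t. Zlim (s + t)) w (cumul 0 L) \<partial>\<Omega>)"
    proof (rule nn_integral_cong_AE, rule AE_mp[OF AE_good], intro AE_I2 impI)
      fix w assume w: "w \<in> space \<Omega>" "good w"
      have "prod_eval (\<lambda>t. Zlim (s + t)) w (cumul 0 L)
         = indicator (ennreal -` A) (Zlim s w) * indicator {w. mp_event (\<lambda>t. Zlim (s + t)) w 0 (pull l)} w"
        by (simp add: L_def prod_eval_indicators)
      also have "\<dots> = indicator A (Y w s) * indicator (B s) (Y w)"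
        using mp_event_Y[of l 0 s w] l s w measurable_space[OF Y_path_measurable w(1)]
        by (auto simp: B_def Y_def split: split_indicator)
      finally show "indicator A (Y w s) * indicator (B s) (Y w) = prod_eval (\<lambda>t. Zlim (s + t)) w (cumul 0 L)" ..
    qed
    also have "\<dots> = (\<integral>\<^sup>+w. fdd Px X (max 0 (Zlim s w)) L \<partial>\<Omega>)" by (rule markov_Zlim[OF s L])
    also have "\<dots> = (\<integral>\<^sup>+w. indicator A (Y w s) * mp_fdd Q coord (Y w s) l \<partial>\<Omega>)"
    proof (rule nn_integral_cong_AE, rule AE_mp[OF AE_good], intro AE_I2 impI)
      fix w assume w: "w \<in> space \<Omega>" "good w"
      have "Zlim s w \<ge> 0" using Zlim_nonneg[OF w s] .
      then show "fdd Px X (max 0 (Zlim s w)) L = indicator A (Y w s) * mp_fdd Q coord (Y w s) l"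
        unfolding L_def using w s mp_fdd_Q_real[OF l Zlim_nonneg[OF w s]]
        by (subst fdd_time_0) (auto simp: Y_def fdd_indicators split: split_indicator)
    qed
    also have "\<dots> = (\<integral>\<^sup>+w. indicator A (w s) * mp_fdd Q coord (w s) l \<partial>Q top)"
      by (rule nn_integral_Q_top[symmetric]) measurable
    finally show ?thesis using lhs by (simp add: p)
  qed
qed

lemma Q_kernel_measurable:
  assumes t: "t \<ge> 0" and A: "A \<in> sets borel"
  shows "(\<lambda>x. emeasure (Q x) {w\<in>space (Q x). w t \<in> A}) \<in> borel_measurable borel"
proof -
  have [measurable]: "(\<lambda>y. emeasure (Px (max 0 y)) {\<omega>\<in>space (Px (max 0 y)). X t \<omega> \<in> ennreal -` A}) \<in> borel_measurable borel"
    using A measurable_sets[of ennreal borel borel A]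
    by (intro measurable_compose[OF max_measurable kernel_measurable[OF t]]) auto
  have Am: "{w\<in>space path_space. w t \<in> A} \<in> sets path_space" using A by measurable
  have eq: "emeasure (Q x) {w\<in>space (Q x). w t \<in> A} = (if x = top then emeasure (Q top) {w\<in>space path_space. w t \<in> A}
     else emeasure (Px (max 0 (enn2real x))) {\<omega>\<in>space (Px (max 0 (enn2real x))). X t \<omega> \<in> ennreal -` A})" for x
  proof (cases x)
    case (real r)
    have "emeasure (Q (ennreal r)) {w\<in>space path_space. w t \<in> A} = emeasure (Px r) (embed -` {w\<in>space path_space. w t \<in> A} \<inter> space (Px r))"
      unfolding Q_real[OF real(1)] by (rule emeasure_distr[OF embed_measurable[OF real(1)] Am])
    also have "embed -` {w\<in>space path_space. w t \<in> A} \<inter> space (Px r) = {\<omega>\<in>space (Px r). X t \<omega> \<in> ennreal -` A}"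
      using measurable_space[OF embed_measurable[OF real(1)]] t by (auto simp: embed_def)
    finally show ?thesis using real by simp
  qed simp
  show ?thesis unfolding ext[OF eq] by measurable
qed

lemma Q_markov_family: "markov_family UNIV Q coord"
  unfolding markov_family_def
proof (intro conjI ballI allI impI)
  show "prob_space (Q x)" for x by (rule Q_prob)
  show "coord t \<in> borel_measurable (Q x)" for x t
    using coordinate_measurable[of t] by (simp add: measurable_cong_sets[OF sets_Q refl])
  show "AE w in Q x. w 0 = x" for x by (rule Q_start)
  show "(\<lambda>x. emeasure (Q x) {w\<in>space (Q x). w t \<in> A}) \<in> borel_measurable (restrict_space borel UNIV)"
    if "t \<ge> 0" "A \<in> sets borel" for t A
    using Q_kernel_measurable[OF that] by (rule measurable_restrict_space1)
  show "emeasure (Q x) {w\<in>space (Q x). mp_event coord w 0 l} = mp_fdd Q coord x l"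
    if "\<forall>(s, A)\<in>set l. s \<ge> 0 \<and> A \<in> sets borel" for x l
  proof -
    have l: "\<And>s A. (s, A) \<in> set l \<Longrightarrow> s \<ge> 0 \<and> A \<in> sets borel" using that by auto
    show ?thesis
    proof (cases x)
      case (real r)
      then show ?thesis using Q_markov_real[OF l real(1)] by simp
    next
      case top
      then show ?thesis using Q_markov_top[OF l] by simp
    qed
  qed
qed auto

lemma Q_one_dim_law:
  assumes "x \<ge> 0" "t \<ge> 0"
  shows "distr (Q (ennreal x)) borel (\<lambda>w. w t) = distr (Px x) borel (\<lambda>\<omega>. ennreal (X t \<omega>))"
  unfolding Q_real[OF assms(1)] using assms
  by (subst distr_distr[OF coordinate_measurable embed_measurable]) (auto simp: o_def embed_def)

section \<open>The Feller property on the compactified state space\<close>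

context
  fixes f :: "ennreal \<Rightarrow> real"
  assumes f: "continuous_on UNIV f"
begin

lemma f_ennreal: "continuous_on {0..} (\<lambda>x. f (ennreal x))" "bounded ((\<lambda>x. f (ennreal x)) ` {0..})"
proof -
  show "continuous_on {0..} (\<lambda>x. f (ennreal x))"
    by (rule continuous_on_compose2[OF f]) (auto intro!: continuous_on_ennreal continuous_on_id)
  obtain C where "\<And>x. norm (f x) \<le> C" using bounded_range_ennreal[OF f] by blast
  then show "bounded ((\<lambda>x. f (ennreal x)) ` {0..})" by (auto simp: bounded_iff intro!: exI[of _ C])
qed

lemma f_measurable: "f \<in> borel_measurable borel" using f by (rule borel_measurable_continuous_onI)

lemma semigroup_Q_real:
  assumes "x \<ge> 0" "t \<ge> 0"
  shows "semigroup Q coord t f (ennreal x) = semigroup Px X t (\<lambda>x. f (ennreal x)) x"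
proof -
  have [measurable]: "f \<in> borel_measurable borel" by (rule f_measurable)
  have "semigroup Q coord t f (ennreal x) = (\<integral>\<omega>. f (embed \<omega> t) \<partial>Px x)"
    unfolding semigroup_def Q_real[OF assms(1)] by (rule integral_distr[OF embed_measurable[OF assms(1)]]) measurable
  then show ?thesis using assms by (simp add: semigroup_def embed_def)
qed

lemma semigroup_Q_top: "semigroup Q coord t f top = (\<integral>w. f (Y w t) \<partial>\<Omega>)"
proof -
  have [measurable]: "f \<in> borel_measurable borel" by (rule f_measurable)
  show ?thesis unfolding semigroup_def Q_top by (rule integral_distr[OF Y_path_measurable]) measurable
qed

text \<open>At time 0 the semigroup is the identity. At positive times, continuity at finite points
  is inherited from the original semigroup, as \<open>f\<close> restricts to a bounded continuous
  function, and continuity at \<open>top\<close> is \<open>semigroup_at_top\<close>.\<close>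

lemma Q_feller_continuous:
  assumes t: "t \<ge> 0"
  shows "continuous_on UNIV (semigroup Q coord t f)"
proof (cases "t = 0")
  case True
  have "semigroup Q coord t f x = f x" for x
  proof -
    interpret prob_space "Q x" by (rule Q_prob)
    have [measurable]: "f \<in> borel_measurable borel" by (rule f_measurable)
    have "(\<integral>w. f (w 0) \<partial>Q x) = (\<integral>w. f x \<partial>Q x)"
      using Q_start[of x] by (intro integral_cong_AE) (auto simp: measurable_cong_sets[OF sets_Q refl])
    then show ?thesis by (simp add: semigroup_def True prob_space[simplified])
  qed
  then have "semigroup Q coord t f = f" by auto
  then show ?thesis using f by simp
next
  case False
  then have t: "t > 0" using t by simp
  define F where "F = semigroup Px X t (\<lambda>x. f (ennreal x))"
  have F: "continuous_on {0..} F" unfolding F_def using t by (intro feller f_ennreal) auto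
  have GF: "semigroup Q coord t f y = F (enn2real y)" if "y \<noteq> top" for y
    using that t semigroup_Q_real[of "enn2real y" t] by (simp add: F_def less_top)
  show ?thesis
    unfolding continuous_on_eq_continuous_at[OF open_UNIV] isCont_def
  proof
    fix y :: ennreal
    show "(semigroup Q coord t f \<longlongrightarrow> semigroup Q coord t f y) (at y)"
    proof (cases "y = top")
      case True
      have "(F \<longlongrightarrow> (\<integral>w. f (ennreal (max 0 (Zlim t w))) \<partial>\<Omega>)) at_top"
        unfolding F_def by (rule semigroup_at_top[OF f_ennreal t])
      also have "(\<integral>w. f (ennreal (max 0 (Zlim t w))) \<partial>\<Omega>) = (\<integral>w. f (Y w t) \<partial>\<Omega>)"
      proof (rule integral_cong_AE)
        show "AE w in \<Omega>. f (ennreal (max 0 (Zlim t w))) = f (Y w t)"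
        proof (rule AE_mp[OF AE_good], intro AE_I2 impI)
          fix w assume w: "w \<in> space \<Omega>" "good w"
          then show "f (ennreal (max 0 (Zlim t w))) = f (Y w t)"
            using Zlim_nonneg[OF w t] t by (simp add: Y_def)
        qed
        have [measurable]: "f \<in> borel_measurable borel" "Zlim t \<in> borel_measurable \<Omega>" "(\<lambda>w. Y w t) \<in> borel_measurable \<Omega>"
          using f_measurable t Y_measurable by auto
        show "(\<lambda>w. f (ennreal (max 0 (Zlim t w)))) \<in> borel_measurable \<Omega>" "(\<lambda>w. f (Y w t)) \<in> borel_measurable \<Omega>"
          by measurable
      qed
      finally have "((\<lambda>y. F (enn2real y)) \<longlongrightarrow> semigroup Q coord t f top) (at top)"
        unfolding semigroup_Q_top by (rule filterlim_compose[OF _ enn2real_at_top])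
      moreover have "\<forall>\<^sub>F y in at top. F (enn2real y) = semigroup Q coord t f y"
        using GF by (auto simp: eventually_at_filter)
      ultimately show ?thesis unfolding True by (rule Lim_transform_eventually)
    next
      case False
      have "(enn2real \<longlongrightarrow> enn2real y) (at y)"
        using False by (intro tendsto_enn2real tendsto_ident_at) (auto simp: less_top)
      then have "((\<lambda>y. F (enn2real y)) \<longlongrightarrow> F (enn2real y)) (at y)"
        by (intro continuous_on_tendsto_compose[OF F]) auto
      moreover have "\<forall>\<^sub>F y in at y. F (enn2real y) = semigroup Q coord t f y"
      proof -
        have "\<forall>\<^sub>F u in at y. u < top" using False by (intro order_tendstoD[OF tendsto_ident_at]) (simp add: less_top)
        then show ?thesis by eventually_elim (simp add: GF)
      qed
      ultimately show ?thesis unfolding GF[OF False] by (rule Lim_transform_eventually)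
    qed
  qed
qed

text \<open>At finite points this is the hypothesis on the original semigroup. At \<open>top\<close>
  almost every path tends to \<open>top\<close> at time 0, and \<open>f\<close> is bounded by
  compactness, so dominated convergence applies.\<close>

lemma Q_feller_0: "((\<lambda>t. semigroup Q coord t f x) \<longlongrightarrow> f x) (at_right 0)"
proof (cases x)
  case (real r)
  have "((\<lambda>t. semigroup Px X t (\<lambda>x. f (ennreal x)) r) \<longlongrightarrow> f (ennreal r)) (at_right 0)"
    using feller_0[OF f_ennreal real(1)] .
  moreover have "\<forall>\<^sub>F t in at_right 0. semigroup Px X t (\<lambda>x. f (ennreal x)) r = semigroup Q coord t f (ennreal r)"
    unfolding eventually_at_right_field using semigroup_Q_real[OF real(1)] by (auto intro!: exI[of _ 1])
  ultimately show ?thesis unfolding real(2) by (rule Lim_transform_eventually)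
next
  case top
  obtain C where C: "\<And>x. norm (f x) \<le> C" using bounded_range_ennreal[OF f] by blast
  have [measurable]: "f \<in> borel_measurable borel" "(\<lambda>w. Y w t) \<in> borel_measurable \<Omega>" for t
    using f_measurable Y_measurable by auto
  have "((\<lambda>t. \<integral>w. f (Y w t) \<partial>\<Omega>) \<longlongrightarrow> (\<integral>w. f top \<partial>\<Omega>)) (at_right 0)"
  proof (rule tendsto_at_right_sequentially[of 0 1])
    fix S :: "nat \<Rightarrow> real"
    assume S: "\<And>n. 0 < S n" "S \<longlonglongrightarrow> 0"
    have S0: "filterlim S (at_right 0) sequentially"
      using S by (intro tendsto_imp_filterlim_at_right) auto
    show "(\<lambda>n. \<integral>w. f (Y w (S n)) \<partial>\<Omega>) \<longlonglongrightarrow> (\<integral>w. f top \<partial>\<Omega>)"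
    proof (rule integral_dominated_convergence[where w="\<lambda>_. C"])
      show "AE w in \<Omega>. (\<lambda>n. f (Y w (S n))) \<longlonglongrightarrow> f top"
      proof (rule AE_mp[OF AE_good], intro AE_I2 impI)
        fix w assume w: "w \<in> space \<Omega>" "good w"
        have "(\<lambda>n. Y w (S n)) \<longlonglongrightarrow> top" by (rule filterlim_compose[OF Y_tendsto_0[OF w] S0])
        then show "(\<lambda>n. f (Y w (S n))) \<longlonglongrightarrow> f top"
          by (intro continuous_on_tendsto_compose[OF f]) auto
      qed
    qed (use C in auto)
  qed simp
  then show ?thesis unfolding top semigroup_Q_top by (simp add: \<Omega>.prob_space)
qed

end

lemma Q_top_start: "measure (Q top) {w\<in>space (Q top). w 0 = top} = 1"
proof -
  interpret prob_space "Q top" by (rule Q_prob)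
  have "{w\<in>space path_space. w 0 = top} \<in> sets path_space" by measurable
  then show ?thesis using Q_start[of top] by (intro prob_eq_1[THEN iffD2]) auto
qed

text \<open>True by the choice of \<open>path_space\<close>; the content lies in
  \<open>Y_path_measurable\<close>, which says that the limit process takes its values
  there.\<close>

lemma Q_top_finite: "measure (Q top) {w\<in>space (Q top). \<forall>t>0. w t < top} = 1"
proof -
  interpret prob_space "Q top" by (rule Q_prob)
  have "{w\<in>space (Q top). \<forall>t>0. w t < top} = space (Q top)" by (auto simp: space_path_space)
  then show ?thesis using prob_space by simp
qed

end

theorem theorem1:
  fixes Px :: "real \<Rightarrow> 'w measure" and X :: "real \<Rightarrow> 'w \<Rightarrow> real"
  assumes markov: "markov_family {0..} Px X"
    and paths: "\<forall>x\<ge>0. \<forall>\<omega>\<in>space (Px x). cadlag (\<lambda>t. X t \<omega>) \<and> no_negative_jumps (\<lambda>t. X t \<omega>)"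
    and feller_i: "\<forall>f t. continuous_on {0..} f \<and> bounded (f ` {0..}) \<and> t \<ge> 0 \<longrightarrow>
                     continuous_on {0..} (semigroup Px X t f) \<and> bounded (semigroup Px X t f ` {0..})"
    and feller_ii: "\<forall>f x. continuous_on {0..} f \<and> bounded (f ` {0..}) \<and> x \<ge> 0 \<longrightarrow>
                     ((\<lambda>t. semigroup Px X t f x) \<longlongrightarrow> f x) (at_right 0)"
    and entrance: "\<forall>t>0. ((\<lambda>b. Liminf at_top (\<lambda>x. ereal (measure (Px x)
                      {\<omega>\<in>space (Px x). hit_below X b \<omega> \<le> ennreal t}))) \<longlongrightarrow> 1) at_top"
  shows "\<exists>Qx :: ennreal \<Rightarrow> (real \<Rightarrow> ennreal) measure.
           markov_family UNIV Qx (\<lambda>t \<omega>. \<omega> t) \<and>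
           (\<forall>x. \<forall>\<omega>\<in>space (Qx x). cadlag \<omega>) \<and>
           (\<forall>x\<ge>0. \<forall>t\<ge>0. distr (Qx (ennreal x)) borel (\<lambda>\<omega>. \<omega> t)
                            = distr (Px x) borel (\<lambda>\<omega>. ennreal (X t \<omega>))) \<and>
           (\<forall>f :: ennreal \<Rightarrow> real. continuous_on UNIV f \<longrightarrow>
              (\<forall>t\<ge>0. continuous_on UNIV (semigroup Qx (\<lambda>t \<omega>. \<omega> t) t f)) \<and>
              (\<forall>x. ((\<lambda>t. semigroup Qx (\<lambda>t \<omega>. \<omega> t) t f x) \<longlongrightarrow> f x) (at_right 0))) \<and>
           measure (Qx top) {\<omega>\<in>space (Qx top). \<omega> 0 = top} = 1 \<and>
           measure (Qx top) {\<omega>\<in>space (Qx top). \<forall>t>0. \<omega> t < top} = 1"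
proof -
  \<comment> \<open>The natural numbers serve as levels.\<close>
  interpret entrance_seq Px X real
  proof
    show "markov_family {0..} Px X" by (rule markov)
    show "continuous_on {0..} (semigroup Px X t f)"
      if "continuous_on {0..} f" "bounded (f ` {0..})" "t \<ge> 0" for f t
      using feller_i that by blast
    show "((\<lambda>t. semigroup Px X t f x) \<longlongrightarrow> f x) (at_right 0)"
      if "continuous_on {0..} f" "bounded (f ` {0..})" "x \<ge> 0" for f x
      using feller_ii that by blast
    show "cadlag (\<lambda>t. X t \<omega>)" "no_negative_jumps (\<lambda>t. X t \<omega>)" if "x \<ge> 0" "\<omega> \<in> space (Px x)" for x \<omega>
      using paths that by blast+
    show "((\<lambda>b. Liminf at_top (\<lambda>x. ereal (measure (Px x)
        {\<omega>\<in>space (Px x). hit_below X b \<omega> \<le> ennreal t}))) \<longlongrightarrow> 1) at_top" if "t > 0" for t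
      using entrance that by blast
    show "filterlim real at_top sequentially" by (rule filterlim_real_sequentially)
  qed auto
  show ?thesis
    using Q_markov_family Q_one_dim_law Q_feller_continuous Q_feller_0 Q_top_start Q_top_finite
    by (intro exI[of _ Q]) (auto simp: space_path_space)
qed

end
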